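(* Let $r_i,s_i\in[1,\infty]$ satisfy $r_i<s_i$ for $i=1,2$ and let $\gamma\in[0,1)$ be fixed. Let $(p_1(\cdot),q_1(\cdot))\in\vec{\mathcal{E}}^{\gamma}_{(\vec r,\vec s)}$ and $w_1\in\mathcal{A}_{(p_1(\cdot),q_1(\cdot)),(\vec r,\vec s)}$, and let $(p(\cdot),q(\cdot))\in\vec{\mathcal{E}}^{\gamma}_{(\vec r,\vec s)}$ and $w\in\mathcal{A}_{(p(\cdot),q(\cdot)),(\vec r,\vec s)}$. For $\theta\in(0,1)$ define the variable exponents $(p_0(\cdot),q_0(\cdot))$ and the weight $w_0$ (all depending on $\theta$) through $$\frac{1}{p(\cdot)}=\frac{1-\theta}{p_0(\cdot)}+\frac{\theta}{p_1(\cdot)},\qquad \frac{1}{q(\cdot)}=\frac{1-\theta}{q_0(\cdot)}+\frac{\theta}{q_1(\cdot)},\qquad w=w_0^{1-\theta}w_1^{\theta}.$$ Then there exists $\eta\in(0,1)$ such that for all $\theta\in(0,\eta)$ there holds that $$(p_0(\cdot),q_0(\cdot))\in\vec{\mathcal{E}}^{\gamma}_{(\vec r,\vec s)}\quad\text{and}\quad w_0\in\mathcal{A}_{(p_0(\cdot),q_0(\cdot)),(\vec r,\vec s)}.$$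
   Context: Everything takes place on $\mathbb{R}^d$, $d\ge 1$, with Lebesgue measure; convention $1/\infty=0$. Variable exponents: $\mathcal{P}$ is the set of measurable functions $p(\cdot):\mathbb{R}^d\to[1,\infty]$. Write $p_-=\operatorname{ess\,inf}_{x}p(x)$ and $p_+=\operatorname{ess\,sup}_{x}p(x)$. Variable Lebesgue norm: for $p(\cdot)\in\mathcal{P}$ and measurable $f$, $\|f\|_{p(\cdot)}:=\inf\{\lambda>0:\rho_{p(\cdot)}(f/\lambda)\le 1\}$, where $\rho_{p(\cdot)}(f):=\int_{\mathbb{R}^d\setminus\{p(\cdot)=\infty\}}|f(x)|^{p(x)}\,dx+\|f\|_{L^\infty(\{p(\cdot)=\infty\})}$. Log-Hölder classes: $p(\cdot)\in LH_0$ if there is $C_0>0$ such that $|p(x)-p(y)|\le \frac{C_0}{-\log(|x-y|)}$ whenever $|x-y|<\frac12$. $p(\cdot)\in LH_\infty$ if there are $p_\infty\in\mathbb{R}$ and $C_\infty>0$ such that $|p(x)-p_\infty|\le\frac{C_\infty}{\log(e+|x|)}$ for all $x$. $LH:=LH_0\cap LH_\infty$. Exponent classes: for $r<s$, $\mathcal{E}^0_{(r,s)}:=\{p(\cdot)\in\mathcal{P}\cap LH: r<p_-\le p_+<s\}$. For $\gamma\in[0,1)$ and $1\le r_i<s_i\le\infty$, $i=1,2$, with $\vec r=(r_1,r_2)$, $\vec s=(s_1,s_2)$, $$\vec{\mathcal{E}}^{\gamma}_{(\vec r,\vec s)}:=\Big\{(p(\cdot),q(\cdot))\in\mathcal{E}^0_{(r_1,s_1)}\times\mathcal{E}^0_{(r_2,s_2)}:\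 \frac1{p(\cdot)}-\frac1{q(\cdot)}=\frac1{r_1}-\frac1{r_2}=\frac1{s_1}-\frac1{s_2}=\gamma\Big\}.$$ In particular this set is empty unless $\frac1{r_1}-\frac1{r_2}=\frac1{s_1}-\frac1{s_2}=\gamma$. Weights: a weight is a measurable, almost everywhere positive (real-valued) function on $\mathbb{R}^d$. For $(p(\cdot),q(\cdot))\in\vec{\mathcal{E}}^{\gamma}_{(\vec r,\vec s)}$, a weight $w$ belongs to $\mathcal{A}_{(p(\cdot),q(\cdot)),(\vec r,\vec s)}$ if $$[w]_{(p(\cdot),q(\cdot)),(\vec r,\vec s)}:=\sup_Q|Q|^{-(\frac1{r_1}-\frac1{s_1})}\,\|w\chi_Q\|_{\frac{1}{\frac1{q(\cdot)}-\frac1{s_2}}}\,\|w^{-1}\chi_Q\|_{\frac{1}{\frac1{r_1}-\frac1{p(\cdot)}}}<\infty,$$ the supremum being over all cubes $Q\subset\mathbb{R}^d$; the subscripts on the norms are the variable exponents $x\mapsto \big(\frac1{q(x)}-\frac1{s_2}\big)^{-1}$ and $x\mapsto\big(\frac1{r_1}-\frac1{p(x)}\big)^{-1}$. *)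

theory Defs
  imports "HOL-Analysis.Analysis" "HOL-Probability.Essential_Supremum"
begin

text \<open>
  Throughout, the role of \<open>\<real>\<^sup>d\<close> (\<open>d \<ge> 1\<close>) is played by an arbitrary type of class
  \<open>euclidean_space\<close>. Exponents take values in \<^typ>\<open>ereal\<close> rather than \<^typ>\<open>ennreal\<close>: the
  differences of reciprocals below must not be truncated at \<open>0\<close>. In \<^typ>\<open>ereal\<close> one has
  \<open>1 / \<infinity> = 0\<close> and \<open>1 / 0 = \<infinity>\<close>.
\<close>

definition essinf :: "'a measure \<Rightarrow> ('a \<Rightarrow> ereal) \<Rightarrow> ereal" where
  "essinf M f = Sup {z. AE x in M. z \<le> f x}"

definition var_exponents :: "('a::euclidean_space \<Rightarrow> ereal) set" where
  "var_exponents = {p \<in> borel_measurable lebesgue. \<forall>x. 1 \<le> p x}"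

definition modular :: "('a::euclidean_space \<Rightarrow> ereal) \<Rightarrow> ('a \<Rightarrow> real) \<Rightarrow> ennreal" where
  "modular p f =
     (\<integral>\<^sup>+ x \<in> - {x. p x = \<infinity>}. ennreal (\<bar>f x\<bar> powr real_of_ereal (p x)) \<partial>lebesgue)
     + esssup (restrict_space lebesgue {x. p x = \<infinity>}) (\<lambda>x. ennreal \<bar>f x\<bar>)"

text \<open>The norm is \<open>\<infinity>\<close> if no \<open>\<lambda>\<close> is admissible, since \<open>Inf {} = \<infinity>\<close> in \<^typ>\<open>ennreal\<close>.\<close>

definition var_norm :: "('a::euclidean_space \<Rightarrow> ereal) \<Rightarrow> ('a \<Rightarrow> real) \<Rightarrow> ennreal" where
  "var_norm p f = Inf {ennreal l | l. 0 < l \<and> modular p (\<lambda>x. f x / l) \<le> 1}"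

text \<open>
  For \<open>x = y\<close> the bound below reads \<open>C / (- ln 0) = 0\<close>, because \<open>ln 0 = 0\<close> and \<open>C / 0 = 0\<close>
  in \<^typ>\<open>real\<close>. In \<^typ>\<open>ereal\<close> one has \<open>\<bar>\<infinity> - \<infinity>\<bar> = \<infinity>\<close>, so the bounds fail wherever \<open>p\<close>
  is infinite; in particular every exponent in \<open>LH\<^sub>\<infinity>\<close> is finite everywhere.
\<close>

definition LH0 :: "('a::euclidean_space \<Rightarrow> ereal) set" where
  "LH0 = {p. \<exists>C::real. 0 < C \<and>
     (\<forall>x y. norm (x - y) < 1/2 \<longrightarrow> \<bar>p x - p y\<bar> \<le> ereal (C / (- ln (norm (x - y)))))}"

definition LH_infinity :: "('a::euclidean_space \<Rightarrow> ereal) set" where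
  "LH_infinity = {p. \<exists>(p\<^sub>i::real) (C::real). 0 < C \<and>
     (\<forall>x. \<bar>p x - ereal p\<^sub>i\<bar> \<le> ereal (C / ln (exp 1 + norm x)))}"

definition LH :: "('a::euclidean_space \<Rightarrow> ereal) set" where
  "LH = LH0 \<inter> LH_infinity"

definition exponent_class :: "ereal \<Rightarrow> ereal \<Rightarrow> ('a::euclidean_space \<Rightarrow> ereal) set" where
  "exponent_class r s =
     {p \<in> var_exponents \<inter> LH. r < essinf lebesgue p \<and> esssup lebesgue p < s}"

text \<open>The four extended reals are \<open>r\<^sub>1, r\<^sub>2, s\<^sub>1, s\<^sub>2\<close>, in this order.\<close>

definition exponent_pairs ::
  "real \<Rightarrow> ereal \<Rightarrow> ereal \<Rightarrow> ereal \<Rightarrow> ereal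
    \<Rightarrow> (('a::euclidean_space \<Rightarrow> ereal) \<times> ('a \<Rightarrow> ereal)) set" where
  "exponent_pairs \<gamma> r1 r2 s1 s2 =
     {(p, q). p \<in> exponent_class r1 s1 \<and> q \<in> exponent_class r2 s2 \<and>
        (\<forall>x. 1 / p x - 1 / q x = ereal \<gamma>) \<and>
        1 / r1 - 1 / r2 = ereal \<gamma> \<and> 1 / s1 - 1 / s2 = ereal \<gamma>}"

definition weight :: "('a::euclidean_space \<Rightarrow> real) \<Rightarrow> bool" where
  "weight w \<longleftrightarrow> w \<in> borel_measurable lebesgue \<and> (AE x in lebesgue. 0 < w x)"

definition cubes :: "'a::euclidean_space set set" where
  "cubes = {cbox a b | a b. \<exists>l>0. \<forall>i\<in>Basis. b \<bullet> i - a \<bullet> i = l}"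

definition weight_const ::
  "('a::euclidean_space \<Rightarrow> ereal) \<Rightarrow> ('a \<Rightarrow> ereal)
    \<Rightarrow> ereal \<Rightarrow> ereal \<Rightarrow> ereal \<Rightarrow> ereal \<Rightarrow> ('a \<Rightarrow> real) \<Rightarrow> ennreal" where
  "weight_const p q r1 r2 s1 s2 w =
     (SUP Q\<in>cubes.
        ennreal (measure lebesgue Q powr (- real_of_ereal (1 / r1 - 1 / s1)))
        * var_norm (\<lambda>x. 1 / (1 / q x - 1 / s2)) (\<lambda>x. w x * indicator Q x)
        * var_norm (\<lambda>x. 1 / (1 / r1 - 1 / p x)) (\<lambda>x. inverse (w x) * indicator Q x))"

definition weight_class ::
  "('a::euclidean_space \<Rightarrow> ereal) \<Rightarrow> ('a \<Rightarrow> ereal)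
    \<Rightarrow> ereal \<Rightarrow> ereal \<Rightarrow> ereal \<Rightarrow> ereal \<Rightarrow> ('a \<Rightarrow> real) set" where
  "weight_class p q r1 r2 s1 s2 = {w. weight w \<and> weight_const p q r1 r2 s1 s2 w < \<infinity>}"

text \<open>
  The equations determining \<open>p\<^sub>0\<close>, \<open>q\<^sub>0\<close>, \<open>w\<^sub>0\<close>. No range is prescribed for \<open>p\<^sub>0\<close> and \<open>q\<^sub>0\<close>.
  Weights are functions up to null sets, so the equation for \<open>w\<^sub>0\<close> is required almost
  everywhere (\<open>w\<^sub>1\<close> may vanish on a null set where \<open>w\<close> does not). That \<open>w\<^sub>0\<close> is a weight
  is part of the condition because the real power function is also defined, and not
  injective, on bases of arbitrary sign.
\<close>

definition interpolates ::
  "real \<Rightarrow> ('a::euclidean_space \<Rightarrow> ereal) \<Rightarrow> ('a \<Rightarrow> ereal) \<Rightarrow> ('a \<Rightarrow> real)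
    \<Rightarrow> ('a \<Rightarrow> ereal) \<Rightarrow> ('a \<Rightarrow> ereal) \<Rightarrow> ('a \<Rightarrow> real)
    \<Rightarrow> ('a \<Rightarrow> ereal) \<Rightarrow> ('a \<Rightarrow> ereal) \<Rightarrow> ('a \<Rightarrow> real) \<Rightarrow> bool" where
  "interpolates \<theta> p0 q0 w0 p1 q1 w1 p q w \<longleftrightarrow>
     (\<forall>x. 1 / p x = ereal (1 - \<theta>) / p0 x + ereal \<theta> / p1 x) \<and>
     (\<forall>x. 1 / q x = ereal (1 - \<theta>) / q0 x + ereal \<theta> / q1 x) \<and>
     weight w0 \<and> (AE x in lebesgue. w x = w0 x powr (1 - \<theta>) * w1 x powr \<theta>)"

end

theory Submission
  imports Defs "HOL-Probability.Probability_Measure"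
begin

text \<open>
  Put \<open>\<delta> = 1 / r\<^sub>1 - 1 / s\<^sub>1\<close>, \<open>1 / v = 1 / q - 1 / s\<^sub>2\<close> and \<open>1 / u = 1 / r\<^sub>1 - 1 / p\<close>, so that
  \<open>1 / v + 1 / u = \<delta>\<close>. Since \<open>w\<^sub>0 = w powr (1 / (1 - \<theta>)) * w\<^sub>1 powr (- \<theta> / (1 - \<theta>))\<close>, Hoelder's
  inequality bounds the norms of \<open>w\<^sub>0\<close> and \<open>1 / w\<^sub>0\<close> on a cube by those of \<open>1 / w\<^sub>1\<close> and \<open>w\<^sub>1\<close>
  and by norms of \<open>w\<close> and \<open>1 / w\<close> with the slightly larger exponents given by
  \<open>1 / v - \<theta> * \<delta>\<close> and \<open>1 / u - \<theta> * \<delta>\<close>. The theorem thus reduces to a reverse Hoelder inequality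
  for \<open>W = w powr (1 / \<delta>)\<close>, which satisfies a Muckenhoupt condition with variable exponent
  \<open>P = \<delta> * v\<close>.

  For a cube \<open>Q\<close> let \<open>V Q = (W / lam Q) powr P\<close> on \<open>Q\<close>, with \<open>lam Q\<close> the norm of \<open>W\<close> on \<open>Q\<close>, so that
  \<open>V Q\<close> is a probability density. If \<open>Q\<close> is small or far from the origin compared to its size,
  log-Hoelder continuity makes \<open>V Q\<close> an \<open>A\<^sub>\<infinity>\<close> weight on the dyadic subcubes of \<open>Q\<close>, with uniform
  constants, and the reverse Hoelder inequality for \<open>V Q\<close> follows by a stopping time argument. Cubes
  centred at the origin are treated by induction on their size: the annulus between two
  successive cubes consists of boundedly many cubes of the first kind, and the inner cube
  contributes with a factor less than \<open>1\<close>. Any other cube is comparable to a centred one.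
\<close>

section \<open>Dyadic cubes\<close>

text \<open>Solving for \<open>w_0\<close> puts \<open>w_1\<close> in the denominator, so it enters
  through \<open>1 / w_1\<close>, whose norm has reciprocal exponent
  \<open>1 / u_1 = \<delta> - 1 / v_1\<close>. Hence \<open>(1 - \<theta>) / v_0 = 1 / v - \<theta>
  / v_1 = (1 / v - \<theta> * \<delta>) + \<theta> / u_1\<close>: the loss
  \<open>\<theta> * \<delta>\<close> is the price of turning a difference of exponents into a sum.
  Only \<open>w\<close> and \<open>1 / w\<close> must be more integrable than assumed; for
  \<open>w_1\<close> the given norms suffice. The obstacle is that passing from a cube of side
  \<open>l\<close> to a subcube of side \<open>s\<close> multiplies the density by a power of the
  quotient of their norms with the variable exponent \<open>P x\<close>. This is harmless if the
  oscillation of \<open>P\<close> on the subcube times \<open>ln (l / s)\<close> is bounded. Local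
  continuity controls the part \<open>ln (1 / s)\<close>, but for large \<open>l\<close> the part
  \<open>ln l\<close> is controlled only where \<open>norm x\<close> is at least of order
  \<open>l\<close>. A large cube around the origin has subcubes near the origin for which this
  fails, so there the stopping time argument gives way to the induction over annuli.\<close>

abbreviation cube :: "'a::euclidean_space \<Rightarrow> real \<Rightarrow> 'a set" where
  "cube a l \<equiv> cbox a (a + l *\<^sub>R One)"

text \<open>The half-open grid cube of side \<open>l / 2 ^ n\<close> around \<open>x\<close>,
  encoded as the class of all points with the same grid index. Cubes of one level are thus equal or
  disjoint without any discussion of faces.\<close>

definition dyadic_cube :: "'a::euclidean_space \<Rightarrow> real \<Rightarrow> nat \<Rightarrow> 'a \<Rightarrow> 'a set" where
  "dyadic_cube a l n x =
     {y. \<forall>i\<in>Basis. \<lfloor>2 ^ n * ((y - a) \<bullet> i) / l\<rfloor> = \<lfloor>2 ^ n * ((x - a) \<bullet> i) / l\<rfloor>}"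

lemma dyadic_cube_self [simp]: "x \<in> dyadic_cube a l n x"
  by (simp add: dyadic_cube_def)

lemma dyadic_cube_eq: "y \<in> dyadic_cube a l n x \<Longrightarrow> dyadic_cube a l n y = dyadic_cube a l n x"
  by (auto simp: dyadic_cube_def)

lemma dyadic_cube_Suc: "dyadic_cube a l (Suc n) x \<subseteq> dyadic_cube a l n x"
proof
  fix y assume y: "y \<in> dyadic_cube a l (Suc n) x"
  \<comment> \<open>The index at level \<open>n\<close> is half the index at level
    \<open>n + 1\<close>, rounded down, so the grids are nested.\<close>
  have half: "\<lfloor>t\<rfloor> = \<lfloor>2 * t\<rfloor> div 2" for t :: real
    using floor_divide_real_eq_div[of 2 "2 * t"] by simp
  show "y \<in> dyadic_cube a l n x"
    unfolding dyadic_cube_def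
  proof safe
    fix i :: 'a assume i: "i \<in> Basis"
    have *: "2 * (2 ^ n * ((z - a) \<bullet> i) / l) = 2 ^ Suc n * ((z - a) \<bullet> i) / l" for z
      by simp
    show "\<lfloor>2 ^ n * ((y - a) \<bullet> i) / l\<rfloor> = \<lfloor>2 ^ n * ((x - a) \<bullet> i) / l\<rfloor>"
      using y i unfolding half[of "2 ^ n * ((y - a) \<bullet> i) / l"] half[of "2 ^ n * ((x - a) \<bullet> i) / l"] *
      by (simp only: dyadic_cube_def mem_Collect_eq)
  qed
qed

lemma dyadic_cube_antimono: "m \<le> n \<Longrightarrow> dyadic_cube a l n x \<subseteq> dyadic_cube a l m x"
  by (induction rule: dec_induct) (use dyadic_cube_Suc in blast)+

lemma dyadic_cube_subset_0: "x \<in> dyadic_cube a l 0 a \<Longrightarrow> dyadic_cube a l n x \<subseteq> dyadic_cube a l 0 a"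
  using dyadic_cube_antimono[of 0 n a l x] dyadic_cube_eq[of x a l 0 a] by auto

text \<open>Measurability and volume of the half-open cube follow from this sandwich, since the two
  boxes differ only by a negligible frontier.\<close>

lemma dyadic_cube_between_boxes:
  fixes a :: "'a::euclidean_space"
  assumes "0 < l"
  obtains c where "box c (c + (l / 2 ^ n) *\<^sub>R One) \<subseteq> dyadic_cube a l n x"
    and "dyadic_cube a l n x \<subseteq> cube c (l / 2 ^ n)"
proof -
  define k where "k i = real_of_int \<lfloor>2 ^ n * ((x - a) \<bullet> i) / l\<rfloor>" for i
  define c where "c = a + (\<Sum>i\<in>Basis. ((l / 2 ^ n) * k i) *\<^sub>R i)"
  have c: "c \<bullet> i = a \<bullet> i + (l / 2 ^ n) * k i" if "i \<in> Basis" for i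
    using that by (simp add: c_def inner_add_left)
  have iff: "\<lfloor>2 ^ n * ((y - a) \<bullet> i) / l\<rfloor> = \<lfloor>2 ^ n * ((x - a) \<bullet> i) / l\<rfloor> \<longleftrightarrow>
      c \<bullet> i \<le> y \<bullet> i \<and> y \<bullet> i < c \<bullet> i + l / 2 ^ n" if "i \<in> Basis" for i y
  proof -
    have "\<lfloor>2 ^ n * ((y - a) \<bullet> i) / l\<rfloor> = \<lfloor>2 ^ n * ((x - a) \<bullet> i) / l\<rfloor> \<longleftrightarrow>
       k i \<le> 2 ^ n * ((y - a) \<bullet> i) / l \<and> 2 ^ n * ((y - a) \<bullet> i) / l < k i + 1"
      unfolding k_def by (simp add: floor_eq_iff)
    also have "\<dots> \<longleftrightarrow> c \<bullet> i \<le> y \<bullet> i \<and> y \<bullet> i < c \<bullet> i + l / 2 ^ n"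
      using assms by (simp add: c[OF that] field_simps inner_diff_left)
    finally show ?thesis .
  qed
  show thesis
    by (rule that[of c]) (force simp: dyadic_cube_def iff mem_box inner_add_left less_imp_le)+
qed

lemma measure_cube:
  fixes c :: "'a::euclidean_space"
  assumes "0 \<le> l"
  shows "emeasure lebesgue (box c (c + l *\<^sub>R One)) = ennreal (l ^ DIM('a))"
    and "emeasure lebesgue (cube c l) = ennreal (l ^ DIM('a))"
  using assms by (simp_all add: emeasure_lborel_box emeasure_lborel_cbox inner_add_left)

lemma dyadic_cube_sets [measurable]:
  assumes "0 < l" shows "dyadic_cube a l n x \<in> sets lebesgue"
proof -
  obtain c where c: "box c (c + (l / 2 ^ n) *\<^sub>R One) \<subseteq> dyadic_cube a l n x"
    "dyadic_cube a l n x \<subseteq> cube c (l / 2 ^ n)"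
    using dyadic_cube_between_boxes[OF assms] .
  have "negligible (dyadic_cube a l n x - box c (c + (l / 2 ^ n) *\<^sub>R One))"
    by (rule negligible_subset[OF negligible_frontier_interval]) (use c in blast)
  then have "dyadic_cube a l n x - box c (c + (l / 2 ^ n) *\<^sub>R One) \<in> sets lebesgue"
    by (simp add: negligible_imp_sets)
  moreover have "dyadic_cube a l n x =
      box c (c + (l / 2 ^ n) *\<^sub>R One) \<union> (dyadic_cube a l n x - box c (c + (l / 2 ^ n) *\<^sub>R One))"
    using c by blast
  ultimately show ?thesis
    by (metis sets.Un borel_open open_box sets_completionI_sets sets_lborel)
qed

lemma emeasure_dyadic_cube:
  fixes a :: "'a::euclidean_space"
  assumes "0 < l"
  shows "emeasure lebesgue (dyadic_cube a l n x) = ennreal ((l / 2 ^ n) ^ DIM('a))"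
proof -
  obtain c where c: "box c (c + (l / 2 ^ n) *\<^sub>R One) \<subseteq> dyadic_cube a l n x"
    "dyadic_cube a l n x \<subseteq> cube c (l / 2 ^ n)"
    using dyadic_cube_between_boxes[OF assms] .
  show ?thesis
  proof (rule antisym)
    show "emeasure lebesgue (dyadic_cube a l n x) \<le> ennreal ((l / 2 ^ n) ^ DIM('a))"
      using emeasure_mono[OF c(2), of lebesgue] measure_cube(2)[of "l / 2 ^ n" c] assms by simp
    show "ennreal ((l / 2 ^ n) ^ DIM('a)) \<le> emeasure lebesgue (dyadic_cube a l n x)"
      using emeasure_mono[OF c(1), of lebesgue] measure_cube(1)[of "l / 2 ^ n" c]
        dyadic_cube_sets[OF assms] assms by simp
  qed
qed

lemma countable_dyadic_cubes: "countable {dyadic_cube a l n x | n x. True}"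
proof -
  let ?G = "\<lambda>n k. {y. \<forall>i\<in>Basis. \<lfloor>2 ^ n * ((y - a) \<bullet> i) / l\<rfloor> = k i}"
  have "{dyadic_cube a l n x | n x. True}
      \<subseteq> (\<lambda>(n, k). ?G n k) ` (UNIV \<times> (PiE Basis (\<lambda>_. UNIV :: int set)))"
  proof clarify
    fix n x
    have "dyadic_cube a l n x = ?G n (restrict (\<lambda>i. \<lfloor>2 ^ n * ((x - a) \<bullet> i) / l\<rfloor>) Basis)"
      by (auto simp: dyadic_cube_def)
    then show "dyadic_cube a l n x
        \<in> (\<lambda>(n, k). ?G n k) ` (UNIV \<times> (PiE Basis (\<lambda>_. UNIV :: int set)))"
      by (intro image_eqI[of _ _ "(n, restrict (\<lambda>i. \<lfloor>2 ^ n * ((x - a) \<bullet> i) / l\<rfloor>) Basis)"]) auto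
  qed
  then show ?thesis
    by (rule countable_subset) (intro countable_image countable_SIGMA countable_PiE; simp)
qed

lemma finite_dyadic_subcubes:
  fixes a :: "'a::euclidean_space"
  assumes "0 < l"
  shows "finite {dyadic_cube a l n x | x. x \<in> dyadic_cube a l 0 a}"
    and "card {dyadic_cube a l n x | x. x \<in> dyadic_cube a l 0 a} \<le> (2 ^ n) ^ DIM('a)"
proof -
  let ?G = "\<lambda>k. {y. \<forall>i\<in>Basis. \<lfloor>2 ^ n * ((y - a) \<bullet> i) / l\<rfloor> = k i}"
  let ?K = "PiE (Basis :: 'a set) (\<lambda>_. {0..<2 ^ n :: int})"
  have sub: "{dyadic_cube a l n x | x. x \<in> dyadic_cube a l 0 a} \<subseteq> ?G ` ?K"
  proof clarify
    fix x assume x: "x \<in> dyadic_cube a l 0 a"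
    have "\<lfloor>2 ^ n * ((x - a) \<bullet> i) / l\<rfloor> \<in> {0..<2 ^ n}" if "i \<in> Basis" for i
    proof -
      have "\<lfloor>((x - a) \<bullet> i) / l\<rfloor> = 0"
        using x that by (simp add: dyadic_cube_def)
      then have *: "0 \<le> ((x - a) \<bullet> i) / l" "((x - a) \<bullet> i) / l < 1"
        by (simp_all add: floor_eq_iff)
      have "2 ^ n * (((x - a) \<bullet> i) / l) < 2 ^ n * 1"
        by (rule mult_strict_left_mono) (use * in auto)
      moreover have "0 \<le> 2 ^ n * (((x - a) \<bullet> i) / l)"
        using * by (intro mult_nonneg_nonneg) auto
      ultimately show ?thesis
        by (simp add: floor_less_iff)
    qed
    moreover have "dyadic_cube a l n x = ?G (restrict (\<lambda>i. \<lfloor>2 ^ n * ((x - a) \<bullet> i) / l\<rfloor>) Basis)"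
      by (auto simp: dyadic_cube_def)
    ultimately show "dyadic_cube a l n x \<in> ?G ` ?K"
      by (intro image_eqI[of _ _ "restrict (\<lambda>i. \<lfloor>2 ^ n * ((x - a) \<bullet> i) / l\<rfloor>) Basis"])
        (auto simp: PiE_iff)
  qed
  have fin: "finite ?K"
    by (intro finite_PiE) auto
  then show "finite {dyadic_cube a l n x | x. x \<in> dyadic_cube a l 0 a}"
    using finite_subset[OF sub] by blast
  have "card {dyadic_cube a l n x | x. x \<in> dyadic_cube a l 0 a} \<le> card (?G ` ?K)"
    by (rule card_mono[OF _ sub]) (use fin in blast)
  also have "\<dots> \<le> card ?K"
    by (rule card_image_le[OF fin])
  also have "\<dots> = (2 ^ n) ^ DIM('a)"
    by (simp add: card_PiE nat_power_eq)
  finally show "card {dyadic_cube a l n x | x. x \<in> dyadic_cube a l 0 a} \<le> (2 ^ n) ^ DIM('a)" .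
qed

lemma norm_diff_le_cube:
  fixes c :: "'a::euclidean_space" and s :: real
  assumes "x \<in> cube c s" "y \<in> cube c s"
  shows "norm (x - y) \<le> DIM('a) * s"
proof -
  have "\<bar>(x - y) \<bullet> i\<bar> \<le> s" if "i \<in> Basis" for i
  proof -
    have "c \<bullet> i \<le> x \<bullet> i" "x \<bullet> i \<le> c \<bullet> i + s" "c \<bullet> i \<le> y \<bullet> i" "y \<bullet> i \<le> c \<bullet> i + s"
      using assms that by (auto simp: mem_box inner_add_left)
    then show ?thesis
      by (simp add: inner_diff_left)
  qed
  then have "norm (x - y) \<le> (\<Sum>i\<in>(Basis::'a set). s)"
    by (intro order_trans[OF norm_le_l1] sum_mono)
  then show ?thesis
    by simp
qed

lemma open_contains_dyadic_cube:
  fixes a :: "'a::euclidean_space"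
  assumes "open U" "x \<in> U" "0 < l"
  obtains n where "dyadic_cube a l n x \<subseteq> U"
proof -
  obtain e where e: "0 < e" "ball x e \<subseteq> U"
    using assms by (meson open_contains_ball)
  obtain n where n: "real DIM('a) * l / e < 2 ^ n"
    using real_arch_pow[of 2] by auto
  show thesis
  proof (rule that[of n], rule subsetI)
    fix y assume y: "y \<in> dyadic_cube a l n x"
    obtain c where c: "dyadic_cube a l n x \<subseteq> cube c (l / 2 ^ n)"
      using dyadic_cube_between_boxes[OF assms(3)] by metis
    have "norm (x - y) \<le> DIM('a) * (l / 2 ^ n)"
      by (rule norm_diff_le_cube) (use c y in auto)
    also have "\<dots> < e"
      using n e(1) by (simp add: field_simps)
    finally show "y \<in> U"
      using e(2) by (auto simp: dist_norm)
  qed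
qed

section \<open>Stopping times on dyadic cubes\<close>

lemma emeasure_dyadic_partition:
  fixes a :: "'a::euclidean_space"
  assumes "sets \<mu> = sets lebesgue" "0 < l" "R \<subseteq> {dyadic_cube a l n x | n x. True}"
    and "disjoint R" "F \<in> sets lebesgue"
  shows "emeasure \<mu> (F \<inter> \<Union>R) = (\<integral>\<^sup>+D. emeasure \<mu> (F \<inter> D) \<partial>count_space R)"
proof -
  have "F \<inter> \<Union>R = (\<Union>D\<in>R. F \<inter> D)"
    by blast
  moreover have "countable R"
    using countable_dyadic_cubes assms(3) by (rule countable_subset[rotated])
  moreover have "F \<inter> D \<in> sets \<mu>" if "D \<in> R" for D
    using that assms(1,2,3,5) dyadic_cube_sets[OF assms(2)] by auto
  moreover have "disjoint_family_on (\<lambda>D. F \<inter> D) R"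
    using assms(4) by (auto simp: disjoint_family_on_def disjoint_def)
  ultimately show ?thesis
    by (simp only: emeasure_UN_countable)
qed

text \<open>
  The cubes \<open>R\<close> are those at which a stopping time argument for the density of \<open>F\<close> halts:
  the maximal dyadic cubes in which \<open>F\<close> has density more than \<open>\<alpha> / 2 ^ d\<close>. Maximality bounds
  the density of \<open>F\<close> in them by \<open>\<alpha>\<close>.
\<close>

lemma dyadic_stopping_cubes:
  fixes a :: "'a::euclidean_space"
  assumes l: "0 < l" and \<alpha>: "0 < \<alpha>" "\<alpha> < 1"
    and F: "F \<subseteq> dyadic_cube a l 0 a" "\<And>x. x \<in> F \<Longrightarrow> \<exists>n. dyadic_cube a l n x \<subseteq> F"
      "F \<in> sets lebesgue"
    and small: "emeasure lebesgue F \<le> ennreal \<alpha> * emeasure lebesgue (dyadic_cube a l 0 a)"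
  obtains R where "R \<subseteq> {dyadic_cube a l n x | n x. x \<in> dyadic_cube a l 0 a}" "disjoint R"
    "F \<subseteq> \<Union>R"
    "\<And>D. D \<in> R \<Longrightarrow> emeasure lebesgue (F \<inter> D) \<le> ennreal \<alpha> * emeasure lebesgue D"
    "\<And>D. D \<in> R \<Longrightarrow> ennreal (\<alpha> / 2 ^ DIM('a)) * emeasure lebesgue D \<le> emeasure lebesgue (F \<inter> D)"
proof -
  let ?D = "dyadic_cube a l"
  let ?\<alpha> = "ennreal (\<alpha> / 2 ^ DIM('a))"
  define dense where
    "dense n y \<longleftrightarrow> ?\<alpha> * emeasure lebesgue (?D n y) < emeasure lebesgue (F \<inter> ?D n y)" for n y
  define stop where "stop y = (LEAST n. dense n y)" for y
  define F' where "F' = {y \<in> ?D 0 a. \<exists>n. dense n y}"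
  define R where "R = (\<lambda>y. ?D (stop y) y) ` F'"
  have dense_cong: "dense n y \<longleftrightarrow> dense n z" if "z \<in> ?D n y" for n y z
    using dyadic_cube_eq[OF that] by (simp add: dense_def)
  have dense_stop: "dense (stop y) y" if "y \<in> F'" for y
    using that LeastI_ex[of "\<lambda>n. dense n y"] by (auto simp: stop_def F'_def)
  \<comment> \<open>A point of the stopping cube of \<open>y\<close> shares with \<open>y\<close>
    all cubes up to level \<open>stop y\<close>, hence stops at the same level. This makes the
    stopping cubes pairwise disjoint.\<close>
  have stop_eq: "z \<in> F'" "stop z = stop y" if "y \<in> F'" "z \<in> ?D (stop y) y" for y z
  proof -
    have "z \<in> ?D 0 y"
      using dyadic_cube_antimono[of 0 "stop y"] that by blast
    moreover have "?D 0 y = ?D 0 a"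
      using that by (intro dyadic_cube_eq) (auto simp: F'_def)
    moreover have "dense (stop y) z"
      using dense_stop that dense_cong by blast
    ultimately show "z \<in> F'"
      by (auto simp: F'_def)
    have "dense n z \<longleftrightarrow> dense n y" if "n \<le> stop y" for n
      using dense_cong[of z n y] \<open>z \<in> ?D (stop y) y\<close> dyadic_cube_antimono[OF that, of a l y] by blast
    then have "(LEAST n. dense n z) = stop y"
    proof (intro Least_equality)
      show "dense (stop y) z"
        by fact
      fix n assume n: "dense n z"
      show "stop y \<le> n"
      proof (rule ccontr)
        assume "\<not> stop y \<le> n"
        then have "n < stop y" "dense n y"
          using n \<open>\<And>n. n \<le> stop y \<Longrightarrow> dense n z \<longleftrightarrow> dense n y\<close> by auto
        then show False
          using not_less_Least[of n "\<lambda>n. dense n y"] by (simp add: stop_def)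
      qed
    qed
    then show "stop z = stop y"
      by (simp add: stop_def)
  qed
  show thesis
  proof (rule that[of R])
    show "R \<subseteq> {?D n x | n x. x \<in> ?D 0 a}"
      by (auto simp: R_def F'_def)
    show "disjoint R"
    proof (rule disjointI)
      fix A B assume AB: "A \<in> R" "B \<in> R" "A \<noteq> B"
      then obtain y z where yz: "A = ?D (stop y) y" "B = ?D (stop z) z" "y \<in> F'" "z \<in> F'"
        by (auto simp: R_def)
      show "A \<inter> B = {}"
      proof (rule ccontr)
        assume "A \<inter> B \<noteq> {}"
        then obtain t where t: "t \<in> A" "t \<in> B"
          by blast
        then have "stop t = stop y" "stop t = stop z"
          using stop_eq yz by blast+
        then have "A = B"
          using yz t dyadic_cube_eq by metis
        then show False
          using AB by simp
      qed
    qed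
    show "F \<subseteq> \<Union>R"
    proof
      fix x assume x: "x \<in> F"
      then obtain n where n: "?D n x \<subseteq> F"
        using F by blast
      have pos: "0 < (l / 2 ^ n) ^ DIM('a)"
        using l by simp
      \<comment> \<open>A dyadic cube inside \<open>F\<close> has density 1, which is above the
        threshold. So every point of \<open>F\<close> stops, without recourse to Lebesgue
        differentiation.\<close>
      have "\<alpha> / 2 ^ DIM('a) < 1"
        using \<alpha> one_le_power[of "2::real" "DIM('a)"]
        by (auto simp: divide_less_eq intro: less_le_trans[of \<alpha> 1])
      then have "\<alpha> / 2 ^ DIM('a) * (l / 2 ^ n) ^ DIM('a) < (l / 2 ^ n) ^ DIM('a)"
        using mult_strict_right_mono[OF _ pos, of _ 1] by (simp only: mult_1)
      then have "?\<alpha> * ennreal ((l / 2 ^ n) ^ DIM('a)) < ennreal ((l / 2 ^ n) ^ DIM('a))"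
        using pos \<alpha> by (subst ennreal_mult[symmetric]) (auto intro: ennreal_lessI)
      then have "dense n x"
        using n by (simp only: dense_def Int_absorb1 emeasure_dyadic_cube[OF l])
      then have "x \<in> F'"
        using x F(1) by (auto simp: F'_def)
      then show "x \<in> \<Union>R"
        by (auto simp: R_def intro!: bexI[of _ x])
    qed
    fix D assume "D \<in> R"
    then obtain y where y: "y \<in> F'" "D = ?D (stop y) y"
      by (auto simp: R_def)
    show "?\<alpha> * emeasure lebesgue D \<le> emeasure lebesgue (F \<inter> D)"
      using dense_stop[OF y(1)] y(2) by (simp add: dense_def)
    show "emeasure lebesgue (F \<inter> D) \<le> ennreal \<alpha> * emeasure lebesgue D"
    proof (cases "stop y")
      case 0
      then have "D = ?D 0 a"
        using y dyadic_cube_eq[of y a l 0 a] by (auto simp: F'_def)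
      then show ?thesis
        using small F(1) by (simp add: Int_absorb2)
    next
      \<comment> \<open>The parent cube is not dense, and its volume is \<open>2 ^ DIM('a)\<close>
        times that of \<open>D\<close>; this is the quotient of the two density bounds.\<close>
      case (Suc m)
      then have "\<not> dense m y"
        using not_less_Least[of m "\<lambda>n. dense n y"] by (simp add: stop_def)
      have "emeasure lebesgue (F \<inter> D) \<le> emeasure lebesgue (F \<inter> ?D m y)"
        using Suc y(2) dyadic_cube_Suc[of a l m y] F(3) sets.Int[OF F(3) dyadic_cube_sets[OF l, of a m y]]
        by (intro emeasure_mono) auto
      also have "\<dots> \<le> ?\<alpha> * emeasure lebesgue (?D m y)"
        using \<open>\<not> dense m y\<close> by (simp add: dense_def)
      also have "\<dots> = ennreal \<alpha> * emeasure lebesgue D"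
        using Suc y(2) l \<alpha>
        by (simp add: emeasure_dyadic_cube[OF l] power_divide power_mult_distrib flip: ennreal_mult)
      finally show ?thesis .
    qed
  qed
qed

text \<open>Each induction step enlarges \<open>F\<close> to the union of its stopping cubes. By
  \<open>A\<close> on every such cube, \<open>F\<close> carries at most the share
  \<open>\<beta>\<close> of the \<open>\<mu>\<close>-measure of the union, while the volume grows at
  most by the factor \<open>2 ^ DIM('a) / \<alpha>\<close>. A set with volume fraction
  \<open>(\<alpha> / 2 ^ DIM('a)) ^ k\<close> therefore allows \<open>k\<close> steps.\<close>

lemma dyadic_union_power_bound:
  fixes a :: "'a::euclidean_space"
  assumes \<mu>: "sets \<mu> = sets lebesgue" and l: "0 < l" and \<alpha>: "0 < \<alpha>" "\<alpha> < 1"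
    and A: "\<And>n x E. x \<in> dyadic_cube a l 0 a \<Longrightarrow> E \<subseteq> dyadic_cube a l n x \<Longrightarrow> E \<in> sets lebesgue \<Longrightarrow>
      emeasure lebesgue E \<le> ennreal \<alpha> * emeasure lebesgue (dyadic_cube a l n x) \<Longrightarrow>
      emeasure \<mu> E \<le> ennreal \<beta> * emeasure \<mu> (dyadic_cube a l n x)"
    and F: "F \<subseteq> dyadic_cube a l 0 a" "\<And>x. x \<in> F \<Longrightarrow> \<exists>n. dyadic_cube a l n x \<subseteq> F"
      "F \<in> sets lebesgue"
    and small: "emeasure lebesgue F
      \<le> ennreal ((\<alpha> / 2 ^ DIM('a)) ^ k) * emeasure lebesgue (dyadic_cube a l 0 a)"
  shows "emeasure \<mu> F \<le> ennreal \<beta> ^ k * emeasure \<mu> (dyadic_cube a l 0 a)"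
  using F small
proof (induction k arbitrary: F)
  case 0
  then show ?case
    by (simp add: emeasure_mono dyadic_cube_sets[OF l] \<mu>)
next
  case (Suc k)
  let ?D = "dyadic_cube a l"
  let ?\<alpha> = "ennreal (\<alpha> / 2 ^ DIM('a))"
  let ?L = "emeasure lebesgue (?D 0 a)"
  have \<alpha>1: "\<alpha> / 2 ^ DIM('a) \<le> 1" "\<alpha> / 2 ^ DIM('a) \<le> \<alpha>" "0 < \<alpha> / 2 ^ DIM('a)"
    using \<alpha> one_le_power[of "2::real" "DIM('a)"]
    by (auto simp: divide_le_eq intro: order_trans[of \<alpha> 1])
  have "(\<alpha> / 2 ^ DIM('a)) * (\<alpha> / 2 ^ DIM('a)) ^ k \<le> \<alpha> * 1"
    using \<alpha> \<alpha>1 by (intro mult_mono power_le_one) auto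
  then have "ennreal ((\<alpha> / 2 ^ DIM('a)) ^ Suc k) * ?L \<le> ennreal \<alpha> * ?L"
    by (intro mult_right_mono ennreal_leI) auto
  with Suc.prems(4) have "emeasure lebesgue F \<le> ennreal \<alpha> * ?L"
    by (rule order_trans)
  then obtain R where R: "R \<subseteq> {?D n x | n x. x \<in> ?D 0 a}" "disjoint R" "F \<subseteq> \<Union>R"
    "\<And>D. D \<in> R \<Longrightarrow> emeasure lebesgue (F \<inter> D) \<le> ennreal \<alpha> * emeasure lebesgue D"
    "\<And>D. D \<in> R \<Longrightarrow> ?\<alpha> * emeasure lebesgue D \<le> emeasure lebesgue (F \<inter> D)"
    using Suc.prems(1-3) by (blast intro: dyadic_stopping_cubes[OF l \<alpha>])
  have R': "R \<subseteq> {?D n x | n x. True}"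
    using R(1) by blast
  have meas: "\<Union>R \<in> sets lebesgue"
    using countable_subset[OF R' countable_dyadic_cubes] R' dyadic_cube_sets[OF l]
    by (intro sets.countable_Union) auto
  have part: "emeasure \<mu>' (S \<inter> \<Union>R) = (\<integral>\<^sup>+D. emeasure \<mu>' (S \<inter> D) \<partial>count_space R)"
    if "sets \<mu>' = sets lebesgue" "S \<in> sets lebesgue" for \<mu>' S
    using emeasure_dyadic_partition[OF that(1) l R' R(2) that(2)] .
  have FR: "F \<inter> \<Union>R = F"
    using R(3) by blast
  have "emeasure \<mu> F = (\<integral>\<^sup>+D. emeasure \<mu> (F \<inter> D) \<partial>count_space R)"
    using part[OF \<mu> Suc.prems(3)] FR by simp
  also have "\<dots> \<le> (\<integral>\<^sup>+D. ennreal \<beta> * emeasure \<mu> (UNIV \<inter> D) \<partial>count_space R)"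
  proof (intro nn_integral_mono)
    fix D assume "D \<in> space (count_space R)"
    then have D: "D \<in> R"
      by simp
    then obtain n x where nx: "D = ?D n x" "x \<in> ?D 0 a"
      using R(1) by blast
    show "emeasure \<mu> (F \<inter> D) \<le> ennreal \<beta> * emeasure \<mu> (UNIV \<inter> D)"
      using A[OF nx(2), of "F \<inter> D" n] R(4)[OF D] sets.Int[OF Suc.prems(3) dyadic_cube_sets[OF l, of a n x]]
      unfolding nx(1) Int_UNIV_left by blast
  qed
  also have "\<dots> = ennreal \<beta> * emeasure \<mu> (\<Union>R)"
    using part[OF \<mu>, of UNIV] by (simp add: nn_integral_cmult)
  also have "\<dots> \<le> ennreal \<beta> * (ennreal \<beta> ^ k * emeasure \<mu> (?D 0 a))"
  proof (intro mult_left_mono Suc.IH)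
    show "\<Union>R \<subseteq> ?D 0 a"
    proof clarify
      fix y D assume "y \<in> D" "D \<in> R"
      then obtain n x where "D = ?D n x" "x \<in> ?D 0 a" "y \<in> ?D n x"
        using R(1) by blast
      then show "y \<in> ?D 0 a"
        using dyadic_cube_subset_0[of x a l n] by auto
    qed
    show "\<exists>n. ?D n y \<subseteq> \<Union>R" if y: "y \<in> \<Union>R" for y
    proof -
      obtain D where D: "D \<in> R" "y \<in> D"
        using y by blast
      then obtain n x where "D = ?D n x" "y \<in> ?D n x"
        using R(1) by blast
      then have "?D n y = D"
        using dyadic_cube_eq by metis
      then show ?thesis
        using D by blast
    qed
    show "\<Union>R \<in> sets lebesgue"
      by (rule meas)
    have "?\<alpha> * emeasure lebesgue (\<Union>R) = (\<integral>\<^sup>+D. ?\<alpha> * emeasure lebesgue D \<partial>count_space R)"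
      using part[of lebesgue UNIV] by (simp add: nn_integral_cmult)
    also have "\<dots> \<le> (\<integral>\<^sup>+D. emeasure lebesgue (F \<inter> D) \<partial>count_space R)"
      using R(5) by (intro nn_integral_mono) auto
    also have "\<dots> = emeasure lebesgue F"
      using part[of lebesgue F] Suc.prems(3) FR by simp
    also have "\<dots> \<le> ?\<alpha> * (ennreal ((\<alpha> / 2 ^ DIM('a)) ^ k) * ?L)"
      using Suc.prems(4) \<alpha>1 unfolding power_Suc by (subst (asm) ennreal_mult) (simp_all only: mult.assoc zero_le_power less_imp_le)
    finally show "emeasure lebesgue (\<Union>R) \<le> ennreal ((\<alpha> / 2 ^ DIM('a)) ^ k) * ?L"
      using \<alpha>1(3) by (subst (asm) ennreal_mult_le_mult_iff) (auto simp only: ennreal_neq_top ennreal_eq_0_iff not_le)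
  qed auto
  finally show ?case
    by (simp add: mult.assoc)
qed

text \<open>An open set contains a dyadic cube around each of its points, so a general
  \<open>F\<close> is replaced by an open superset, cut down to the top cube. The strict inequality
  leaves room for the added volume.\<close>

lemma dyadic_power_bound:
  fixes a :: "'a::euclidean_space"
  assumes \<mu>: "sets \<mu> = sets lebesgue" and l: "0 < l" and \<alpha>: "0 < \<alpha>" "\<alpha> < 1"
    and A: "\<And>n x E. x \<in> dyadic_cube a l 0 a \<Longrightarrow> E \<subseteq> dyadic_cube a l n x \<Longrightarrow> E \<in> sets lebesgue \<Longrightarrow>
      emeasure lebesgue E \<le> ennreal \<alpha> * emeasure lebesgue (dyadic_cube a l n x) \<Longrightarrow>
      emeasure \<mu> E \<le> ennreal \<beta> * emeasure \<mu> (dyadic_cube a l n x)"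
    and F: "F \<subseteq> dyadic_cube a l 0 a" "F \<in> sets lebesgue"
    and small: "emeasure lebesgue F < ennreal ((\<alpha> / 2 ^ DIM('a)) ^ k * l ^ DIM('a))"
  shows "emeasure \<mu> F \<le> ennreal \<beta> ^ k * emeasure \<mu> (dyadic_cube a l 0 a)"
proof -
  let ?D = "dyadic_cube a l"
  let ?c = "(\<alpha> / 2 ^ DIM('a)) ^ k * l ^ DIM('a)"
  have L: "emeasure lebesgue (?D 0 a) = ennreal (l ^ DIM('a))"
    using emeasure_dyadic_cube[OF l, of a 0 a] by simp
  obtain f where f: "0 \<le> f" "emeasure lebesgue F = ennreal f"
    using small by (cases "emeasure lebesgue F") auto
  then have "f < ?c"
    using small by (simp add: ennreal_less_iff)
  then have "0 < ?c - f"
    by simp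
  obtain U where U: "open U" "F \<subseteq> U" "emeasure lebesgue (U - F) < ennreal (?c - f)"
    by (rule sets_lebesgue_outer_open[OF F(2) \<open>0 < ?c - f\<close>])
  have Us: "U \<in> sets lebesgue" "U \<inter> ?D 0 a \<in> sets lebesgue"
    using U(1) by (auto intro!: sets.Int dyadic_cube_sets[OF l])
  have "emeasure lebesgue (U \<inter> ?D 0 a) \<le> emeasure lebesgue U"
    using Us by (intro emeasure_mono) auto
  also have "\<dots> = emeasure lebesgue F + emeasure lebesgue (U - F)"
    using U(2) F(2) Us by (subst plus_emeasure) (auto simp: Un_absorb1)
  also have "\<dots> \<le> ennreal f + ennreal (?c - f)"
    using U(3) f by (intro add_mono) auto
  also have "\<dots> = ennreal ((\<alpha> / 2 ^ DIM('a)) ^ k) * emeasure lebesgue (?D 0 a)"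
    using f \<open>f < ?c\<close> \<alpha> l by (simp add: L flip: ennreal_mult ennreal_plus)
  finally have small': "emeasure lebesgue (U \<inter> ?D 0 a)
      \<le> ennreal ((\<alpha> / 2 ^ DIM('a)) ^ k) * emeasure lebesgue (?D 0 a)" .
  have "emeasure \<mu> F \<le> emeasure \<mu> (U \<inter> ?D 0 a)"
    using U(2) F(1) Us \<mu> by (intro emeasure_mono) auto
  also have "\<dots> \<le> ennreal \<beta> ^ k * emeasure \<mu> (?D 0 a)"
  proof (rule dyadic_union_power_bound[OF \<mu> l \<alpha>])
    show "emeasure \<mu> E \<le> ennreal \<beta> * emeasure \<mu> (?D n x)"
      if "x \<in> ?D 0 a" "E \<subseteq> ?D n x" "E \<in> sets lebesgue"
        "emeasure lebesgue E \<le> ennreal \<alpha> * emeasure lebesgue (?D n x)" for n x E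
      using that by (rule A)
    fix x assume x: "x \<in> U \<inter> ?D 0 a"
    then have "x \<in> U"
      by simp
    obtain n where n: "?D n x \<subseteq> U"
      by (rule open_contains_dyadic_cube[OF U(1) \<open>x \<in> U\<close> l])
    have "?D n x \<subseteq> ?D 0 a"
      using dyadic_cube_subset_0[of x a l n] x by auto
    then show "\<exists>n. ?D n x \<subseteq> U \<inter> ?D 0 a"
      using n by blast
  qed (rule Int_lower2 Us(2) small')+
  finally show ?thesis .
qed

section \<open>Muckenhoupt weights with variable exponent\<close>

lemma cubes_iff:
  fixes Q :: "'a::euclidean_space set"
  shows "Q \<in> cubes \<longleftrightarrow> (\<exists>a l. 0 < l \<and> Q = cube a l)"
proof
  assume "Q \<in> cubes"
  then obtain a b l where l: "0 < l" "\<forall>i\<in>Basis. b \<bullet> i - a \<bullet> i = l" "Q = cbox a b"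
    unfolding cubes_def mem_Collect_eq by (elim exE conjE)
  have "b = a + l *\<^sub>R One"
  proof (rule euclidean_eqI)
    fix i :: 'a assume i: "i \<in> Basis"
    then have "b \<bullet> i = a \<bullet> i + l"
      using l(2) by (metis add.commute diff_add_cancel)
    then show "b \<bullet> i = (a + l *\<^sub>R One) \<bullet> i"
      using i by (simp add: inner_add_left)
  qed
  then show "\<exists>a l. 0 < l \<and> Q = cube a l"
    using l(1,3) by (intro exI conjI) auto
next
  assume "\<exists>a l. 0 < l \<and> Q = cube a l"
  then obtain a l where al: "0 < l" "Q = cube a l"
    by blast
  then show "Q \<in> cubes"
    unfolding cubes_def by (intro CollectI exI[of _ a] exI[of _ "a + l *\<^sub>R One"]) (auto simp: inner_add_left)
qed

lemma measure_cbox_cube: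
  "0 < l \<Longrightarrow> measure lebesgue (cube a l) = l ^ DIM('a)" for a :: "'a::euclidean_space"
  using measure_cube(2)[of l a] by (simp add: measure_def)

lemma cubes_sets: "Q \<in> cubes \<Longrightarrow> Q \<in> sets lebesgue"
  by (auto simp: cubes_def)

lemma measure_cubes_pos: "Q \<in> cubes \<Longrightarrow> 0 < measure lebesgue Q"
  unfolding cubes_iff using measure_cbox_cube by (metis zero_less_power)

lemma emeasure_cubes: "Q \<in> cubes \<Longrightarrow> emeasure lebesgue Q = ennreal (measure lebesgue Q)"
  unfolding cubes_iff using measure_cube(2) measure_cbox_cube by (metis less_imp_le)

lemma dyadic_cube_0:
  fixes a :: "'a::euclidean_space"
  assumes "0 < l"
  shows "box a (a + l *\<^sub>R One) \<subseteq> dyadic_cube a l 0 a"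
    and "dyadic_cube a l 0 a \<subseteq> cube a l"
proof -
  have "\<lfloor>((y - a) \<bullet> i) / l\<rfloor> = 0 \<longleftrightarrow> a \<bullet> i \<le> y \<bullet> i \<and> y \<bullet> i < a \<bullet> i + l" for y i
    using assms by (simp add: floor_eq_iff inner_diff_left divide_less_eq zero_le_divide_iff) linarith
  then show "box a (a + l *\<^sub>R One) \<subseteq> dyadic_cube a l 0 a"
    "dyadic_cube a l 0 a \<subseteq> cube a l"
    by (force simp: dyadic_cube_def mem_box inner_add_left less_imp_le)+
qed

lemma dyadic_cube_in_cube:
  fixes a :: "'a::euclidean_space"
  assumes "0 < l" "x \<in> dyadic_cube a l 0 a"
  obtains c where "dyadic_cube a l n x \<subseteq> cube c (l / 2 ^ n)"
    and "cube c (l / 2 ^ n) \<subseteq> cube a l"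
    and "box c (c + (l / 2 ^ n) *\<^sub>R One) \<subseteq> dyadic_cube a l n x"
proof -
  obtain c where c: "box c (c + (l / 2 ^ n) *\<^sub>R One) \<subseteq> dyadic_cube a l n x"
    "dyadic_cube a l n x \<subseteq> cube c (l / 2 ^ n)"
    using dyadic_cube_between_boxes[OF assms(1)] .
  have "box c (c + (l / 2 ^ n) *\<^sub>R One) \<subseteq> cube a l"
    using c(1) dyadic_cube_subset_0[OF assms(2), of n] dyadic_cube_0(2)[OF assms(1), of a] by blast
  then have "closure (box c (c + (l / 2 ^ n) *\<^sub>R One)) \<subseteq> cube a l"
    by (intro closure_minimal closed_cbox)
  moreover have "box c (c + (l / 2 ^ n) *\<^sub>R One) \<noteq> {}"
    using assms(1) by (simp add: box_ne_empty inner_add_left)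
  ultimately have "cube c (l / 2 ^ n) \<subseteq> cube a l"
    by simp
  then show thesis
    using that c by blast
qed

text \<open>Each factor is at most the corresponding root of the larger of the two powers. Dropping
  the factors \<open>1 / p\<close> and \<open>1 / q\<close> of Young's inequality gives a bound
  whose constants do not depend on the exponents, which later vary with the point.\<close>

lemma Young_weak:
  fixes x y p q :: real
  assumes "0 \<le> x" "0 \<le> y" "0 < p" "0 < q" "1 / p + 1 / q = 1"
  shows "x * y \<le> x powr p + y powr q"
proof -
  define m where "m = max (x powr p) (y powr q)"
  have "x = (x powr p) powr (1 / p)" "y = (y powr q) powr (1 / q)"
    using assms by (simp_all add: powr_powr)
  moreover have "(x powr p) powr (1 / p) \<le> m powr (1 / p)" "(y powr q) powr (1 / q) \<le> m powr (1 / q)"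
    using assms(1-4) by (intro powr_mono2; simp add: m_def)+
  ultimately have "x \<le> m powr (1 / p)" "y \<le> m powr (1 / q)"
    by linarith+
  then have "x * y \<le> m powr (1 / p) * m powr (1 / q)"
    using assms(1-4) by (intro mult_mono) auto
  also have "\<dots> = m"
    using assms by (simp add: m_def le_max_iff_disj flip: powr_add)
  also have "\<dots> \<le> x powr p + y powr q"
    by (simp add: m_def)
  finally show ?thesis .
qed

text \<open>A value \<open>y\<close> above 2 is charged to the one layer with
  \<open>2 * b ^ m < y \<le> 2 * b ^ Suc m\<close>. Integrated, this turns geometric decay of level
  sets into a bound for the integral of a power.\<close>

lemma powr_le_layers:
  fixes y b \<epsilon> :: real
  assumes "0 \<le> y" "1 < b" "0 < \<epsilon>"
  shows "ennreal (y powr \<epsilon>) \<le> ennreal (2 powr \<epsilon>)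
    + (\<Sum>k. ennreal ((2 * b ^ Suc k) powr \<epsilon>) * (if 2 * b ^ k < y then 1 else 0))"
    (is "_ \<le> _ + suminf ?f")
proof -
  define k where "k = (LEAST k. y \<le> 2 * b ^ k)"
  obtain k' where "y / 2 < b ^ k'"
    using real_arch_pow[OF assms(2)] by blast
  then have "\<exists>k. y \<le> 2 * b ^ k"
    by (intro exI[of _ k']) auto
  then have k: "y \<le> 2 * b ^ k"
    unfolding k_def by (rule LeastI_ex)
  show ?thesis
  proof (cases k)
    case 0
    then have "ennreal (y powr \<epsilon>) \<le> ennreal (2 powr \<epsilon>)"
      using k assms by (intro ennreal_leI powr_mono2) auto
    then show ?thesis
      by (rule add_increasing2[rotated]) simp
  next
    case (Suc m)
    then have "2 * b ^ m < y"
      using not_less_Least[of m "\<lambda>k. y \<le> 2 * b ^ k"] by (simp add: k_def)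
    then have "ennreal (y powr \<epsilon>) \<le> ?f m"
      using k assms Suc by (auto intro!: ennreal_leI powr_mono2)
    also have "?f m \<le> suminf ?f"
      using sum_le_suminf[of ?f "{m}"] by simp
    finally show ?thesis
      by (rule add_increasing[rotated]) simp
  qed
qed

lemma AE_cube_dyadic:
  fixes a :: "'a::euclidean_space"
  assumes "0 < l"
  shows "AE x in lebesgue. x \<in> cube a l \<longrightarrow> x \<in> dyadic_cube a l 0 a"
proof -
  have "negligible (cube a l - dyadic_cube a l 0 a)"
    by (rule negligible_subset[OF negligible_frontier_interval]) (use dyadic_cube_0[OF assms] in blast)
  then have "AE x in lebesgue. x \<notin> cube a l - dyadic_cube a l 0 a"
    unfolding negligible_iff_null_sets by (rule AE_not_in)
  then show ?thesis
    by (rule AE_mp) simp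
qed

text \<open>Both continuity conditions as products comparing two points, without a limit value at
  infinity and without a restriction to small distances. The form passes at once to functions whose
  differences are dominated by those of \<open>f\<close>.\<close>

definition log_Holder :: "real \<Rightarrow> ('a::real_normed_vector \<Rightarrow> real) \<Rightarrow> bool" where
  "log_Holder L f \<longleftrightarrow> (\<forall>x y.
     \<bar>f x - f y\<bar> * ln (exp 1 + 1 / norm (x - y)) \<le> L \<and>
     \<bar>f x - f y\<bar> * ln (exp 1 + min (norm x) (norm y)) \<le> L)"

text \<open>
  \<open>lam Q\<close> and \<open>sig Q\<close> stand for the norms of \<open>W\<close> and \<open>1 / W\<close> on the cube \<open>Q\<close>.
\<close>

locale variable_muckenhoupt =
  fixes P P' W :: "'a::euclidean_space \<Rightarrow> real" and lam sig :: "'a set \<Rightarrow> real" and C pmax L :: real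
  assumes PW_measurable [measurable]: "P \<in> borel_measurable lebesgue" "P' \<in> borel_measurable lebesgue"
      "W \<in> borel_measurable lebesgue"
    and W_pos: "0 < W x"
    and P_ge: "1 \<le> P x" and P'_ge: "1 \<le> P' x" and P_le: "P x \<le> pmax"
    and conjugate: "1 / P x + 1 / P' x = 1"
    and lam_pos: "Q \<in> cubes \<Longrightarrow> 0 < lam Q" and sig_pos: "Q \<in> cubes \<Longrightarrow> 0 < sig Q"
    and modular_lam: "Q \<in> cubes \<Longrightarrow>
      (\<integral>\<^sup>+x. ennreal (indicator Q x * (W x / lam Q) powr P x) \<partial>lebesgue) = 1"
    and modular_sig: "Q \<in> cubes \<Longrightarrow>
      (\<integral>\<^sup>+x. ennreal (indicator Q x * (inverse (W x) / sig Q) powr P' x) \<partial>lebesgue) \<le> 1"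
    and lam_sig: "Q \<in> cubes \<Longrightarrow> lam Q * sig Q \<le> C * measure lebesgue Q"
    and C_ge: "1 \<le> C"
    and log_Holder: "log_Holder L P"
begin

definition V :: "'a set \<Rightarrow> 'a \<Rightarrow> real" where
  "V Q x = indicator Q x * (W x / lam Q) powr P x"

definition \<mu> :: "'a set \<Rightarrow> 'a measure" where
  "\<mu> Q = density lebesgue (\<lambda>x. ennreal (V Q x))"

lemma V_nonneg [simp]: "0 \<le> V Q x"
  by (simp add: V_def)

lemma V_measurable [measurable]:
  assumes [measurable]: "Q \<in> sets lebesgue"
  shows "V Q \<in> borel_measurable lebesgue"
  unfolding V_def by measurable

lemma sets_\<mu> [simp]: "sets (\<mu> Q) = sets lebesgue"
  by (simp add: \<mu>_def)

lemma space_\<mu> [simp]: "space (\<mu> Q) = UNIV"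
  by (simp add: \<mu>_def)

lemma pmax_ge: "1 \<le> pmax"
  using P_ge P_le order_trans by blast

lemma L_nonneg: "0 \<le> L"
  using log_Holder[unfolded log_Holder_def, rule_format, of 0 0] by auto

lemma emeasure_\<mu>:
  assumes "Q \<in> cubes" "G \<in> sets lebesgue"
  shows "emeasure (\<mu> Q) G = (\<integral>\<^sup>+x. ennreal (V Q x) * indicator G x \<partial>lebesgue)"
proof -
  have [measurable]: "Q \<in> sets lebesgue"
    using assms cubes_sets by blast
  show ?thesis
    using assms(2) unfolding \<mu>_def by (subst emeasure_density) auto
qed

lemma prob_space_\<mu>: "Q \<in> cubes \<Longrightarrow> prob_space (\<mu> Q)"
  using emeasure_\<mu>[of Q UNIV] modular_lam[of Q] by (intro prob_spaceI) (simp add: V_def)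

lemma measure_\<mu>_cube:
  assumes "Q \<in> cubes"
  shows "measure (\<mu> Q) Q = 1"
proof -
  have "emeasure (\<mu> Q) Q = 1"
    using modular_lam[OF assms] emeasure_\<mu>[OF assms cubes_sets[OF assms]]
    by (subst (asm) nn_integral_cong[where v = "\<lambda>x. ennreal (V Q x) * indicator Q x"])
      (auto simp: V_def indicator_def)
  then show ?thesis
    by (simp add: measure_def)
qed

lemma measure_\<mu>_le_1: "Q \<in> cubes \<Longrightarrow> measure (\<mu> Q) G \<le> 1"
  using prob_space_\<mu> prob_space.prob_le_1 by blast

lemma emeasure_\<mu>_eq: "Q \<in> cubes \<Longrightarrow> emeasure (\<mu> Q) G = ennreal (measure (\<mu> Q) G)"
  using prob_space_\<mu> finite_measure.emeasure_eq_measure prob_space.finite_measure by metis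

text \<open>
  The \<open>A\<^sub>p\<close> condition enters through this lemma only. On \<open>G\<close> the constant
  \<open>1 / (lam Q * sig Q)\<close> is the product of \<open>A * W / lam Q\<close> and \<open>1 / (A * W * sig Q)\<close>.
\<close>

lemma measure_le_\<mu>:
  assumes Q: "Q \<in> cubes" and G: "G \<in> sets lebesgue" "G \<subseteq> Q" and A: "1 \<le> A"
  shows "measure lebesgue G \<le> C * measure lebesgue Q * (A powr pmax * measure (\<mu> Q) G + 1 / A)"
proof -
  have [measurable]: "Q \<in> sets lebesgue" "G \<in> sets lebesgue"
    using Q G cubes_sets by blast+
  let ?S = "\<lambda>x. indicator Q x * (inverse (W x) / sig Q) powr P' x"
  have pw: "1 / (lam Q * sig Q) \<le> A powr pmax * V Q x + (1 / A) * ?S x" if "x \<in> G" for x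
  proof -
    define h k where "h = W x / lam Q" and "k = inverse (W x) / sig Q"
    have hk: "0 < h" "0 < k"
      using lam_pos[OF Q] sig_pos[OF Q] W_pos by (simp_all add: h_def k_def)
    have "1 / (lam Q * sig Q) = (A * h) * (k / A)"
      using lam_pos[OF Q] sig_pos[OF Q] W_pos[of x] A by (simp add: h_def k_def field_simps)
    also have "\<dots> \<le> (A * h) powr P x + (k / A) powr P' x"
      using hk A P_ge[of x] P'_ge[of x] conjugate[of x] by (intro Young_weak) auto
    \<comment> \<open>\<open>A \<ge> 1\<close> together with \<open>P x \<le> pmax\<close> and
      \<open>P' x \<ge> 1\<close> removes the variable exponents of \<open>A\<close>. A large
      \<open>A\<close> makes the last term small at the cost of the factor
      \<open>A powr pmax\<close>.\<close>
    also have "(A * h) powr P x \<le> A powr pmax * h powr P x"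
      using hk A P_le[of x] by (simp add: powr_mult mult_right_mono powr_mono)
    also have "(k / A) powr P' x \<le> (1 / A) * k powr P' x"
    proof -
      have "A powr 1 \<le> A powr P' x"
        using A P'_ge[of x] by (intro powr_mono) auto
      then show ?thesis
        using hk A by (simp add: powr_divide frac_le)
    qed
    finally show ?thesis
      using that G(2) by (auto simp: V_def h_def k_def)
  qed
  have fin: "emeasure lebesgue G = ennreal (measure lebesgue G)"
    using emeasure_mono[OF G(2) \<open>Q \<in> sets lebesgue\<close>] emeasure_cubes[OF Q]
    by (intro emeasure_eq_ennreal_measure) (auto simp: top_unique)
  have "ennreal (1 / (lam Q * sig Q) * measure lebesgue G)
      = (\<integral>\<^sup>+x. ennreal (1 / (lam Q * sig Q)) * indicator G x \<partial>lebesgue)"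
    using lam_pos[OF Q] sig_pos[OF Q] fin by (simp add: nn_integral_cmult_indicator flip: ennreal_mult)
  also have "\<dots> \<le> (\<integral>\<^sup>+x. ennreal (A powr pmax) * (ennreal (V Q x) * indicator G x)
      + ennreal (1 / A) * ennreal (?S x) \<partial>lebesgue)"
  proof (rule nn_integral_mono)
    fix x
    show "ennreal (1 / (lam Q * sig Q)) * indicator G x
      \<le> ennreal (A powr pmax) * (ennreal (V Q x) * indicator G x) + ennreal (1 / A) * ennreal (?S x)"
    proof (cases "x \<in> G")
      case True
      have "ennreal (1 / (lam Q * sig Q)) \<le> ennreal (A powr pmax * V Q x + (1 / A) * ?S x)"
        by (rule ennreal_leI[OF pw[OF True]])
      then show ?thesis
        using True A by (simp add: ennreal_plus flip: ennreal_mult)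
    qed simp
  qed
  also have "\<dots> = ennreal (A powr pmax) * emeasure (\<mu> Q) G
      + ennreal (1 / A) * (\<integral>\<^sup>+x. ennreal (?S x) \<partial>lebesgue)"
    using emeasure_\<mu>[OF Q G(1)] by (simp add: nn_integral_add nn_integral_cmult)
  also have "\<dots> \<le> ennreal (A powr pmax) * emeasure (\<mu> Q) G + ennreal (1 / A) * 1"
    by (intro add_left_mono mult_left_mono modular_sig[OF Q]) auto
  also have "\<dots> = ennreal (A powr pmax * measure (\<mu> Q) G + 1 / A)"
    using A by (simp add: emeasure_\<mu>_eq[OF Q] ennreal_mult ennreal_plus)
  finally have "1 / (lam Q * sig Q) * measure lebesgue G \<le> A powr pmax * measure (\<mu> Q) G + 1 / A"
    using A by (subst (asm) ennreal_le_iff) auto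
  then have "measure lebesgue G \<le> (lam Q * sig Q) * (A powr pmax * measure (\<mu> Q) G + 1 / A)"
    using lam_pos[OF Q] sig_pos[OF Q] by (simp add: field_simps)
  also have "\<dots> \<le> C * measure lebesgue Q * (A powr pmax * measure (\<mu> Q) G + 1 / A)"
    using lam_sig[OF Q] A by (intro mult_right_mono) auto
  finally show ?thesis .
qed

definition c\<^sub>1 :: real where "c\<^sub>1 = (4 * C) powr (- (pmax + 1))"

lemma c\<^sub>1: "0 < c\<^sub>1" "c\<^sub>1 < 1"
proof -
  have "c\<^sub>1 < (4 * C) powr 0"
    unfolding c\<^sub>1_def using C_ge pmax_ge by (intro powr_less_mono) auto
  then show "0 < c\<^sub>1" "c\<^sub>1 < 1"
    using C_ge by (auto simp: c\<^sub>1_def)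
qed

lemma \<mu>_half_ge:
  assumes Q: "Q \<in> cubes" and G: "G \<in> sets lebesgue" "G \<subseteq> Q"
    and half: "measure lebesgue Q / 2 \<le> measure lebesgue G"
  shows "c\<^sub>1 \<le> measure (\<mu> Q) G"
proof -
  define m where "m = measure (\<mu> Q) G"
  have pos: "0 < measure lebesgue Q"
    using Q by (rule measure_cubes_pos)
  \<comment> \<open>With \<open>A = 4 * C\<close> the term \<open>1 / A\<close> accounts for a
    quarter of the volume of \<open>Q\<close>, which is half of what \<open>G\<close> has. The
    constant \<open>c\<^sub>1\<close> results from this choice.\<close>
  have "measure lebesgue Q / 2 \<le> C * measure lebesgue Q * ((4 * C) powr pmax * m + 1 / (4 * C))"
    using half measure_le_\<mu>[OF Q G, of "4 * C"] C_ge unfolding m_def by linarith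
  also have "\<dots> = measure lebesgue Q * (C * ((4 * C) powr pmax * m) + 1 / 4)"
    using C_ge by (simp add: field_simps)
  finally have "1 / 2 \<le> C * ((4 * C) powr pmax * m) + 1 / 4"
    using pos by (simp add: field_simps)
  then have "1 \<le> (4 * C) * (4 * C) powr pmax * m"
    by simp
  also have "(4 * C) * (4 * C) powr pmax = (4 * C) powr (pmax + 1)"
    using C_ge by (simp add: powr_add)
  finally have "1 \<le> (4 * C) powr (pmax + 1) * m" .
  then show ?thesis
    using C_ge unfolding c\<^sub>1_def powr_minus m_def by (simp add: divide_simps mult.commute)
qed

section \<open>Changing the reference cube\<close>

lemma V_change_cube:
  assumes "Q \<in> cubes" "Q\<^sub>0 \<in> cubes" "Q \<subseteq> Q\<^sub>0" "x \<in> Q"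
  shows "V Q\<^sub>0 x = (lam Q / lam Q\<^sub>0) powr P x * V Q x"
proof -
  have "W x / lam Q\<^sub>0 = (lam Q / lam Q\<^sub>0) * (W x / lam Q)"
    using lam_pos[OF assms(1)] by simp
  then have "(W x / lam Q\<^sub>0) powr P x = (lam Q / lam Q\<^sub>0) powr P x * (W x / lam Q) powr P x"
    by (metis powr_mult)
  then show ?thesis
    using assms by (auto simp: V_def)
qed

lemma \<mu>_change_cube_le:
  assumes Q: "Q \<in> cubes" "Q\<^sub>0 \<in> cubes" "Q \<subseteq> Q\<^sub>0" and G: "G \<in> sets lebesgue" "G \<subseteq> Q"
    and c: "\<And>x. x \<in> Q \<Longrightarrow> (lam Q / lam Q\<^sub>0) powr P x \<le> c" "0 \<le> c"
  shows "measure (\<mu> Q\<^sub>0) G \<le> c * measure (\<mu> Q) G"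
proof -
  have [measurable]: "Q \<in> sets lebesgue" "Q\<^sub>0 \<in> sets lebesgue" "G \<in> sets lebesgue"
    using Q G cubes_sets by blast+
  have "emeasure (\<mu> Q\<^sub>0) G \<le> (\<integral>\<^sup>+x. ennreal c * (ennreal (V Q x) * indicator G x) \<partial>lebesgue)"
    unfolding emeasure_\<mu>[OF Q(2) G(1)]
  proof (rule nn_integral_mono)
    fix x
    show "ennreal (V Q\<^sub>0 x) * indicator G x \<le> ennreal c * (ennreal (V Q x) * indicator G x)"
      using V_change_cube[OF Q, of x] c(1)[of x] c(2) G(2)
      by (auto simp: indicator_def mult_right_mono intro!: ennreal_leI simp flip: ennreal_mult)
  qed
  also have "\<dots> = ennreal c * emeasure (\<mu> Q) G"
    by (simp add: emeasure_\<mu>[OF Q(1) G(1)] nn_integral_cmult)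
  finally show ?thesis
    using c(2) by (simp add: emeasure_\<mu>_eq Q flip: ennreal_mult)
qed

lemma \<mu>_change_cube_ge:
  assumes Q: "Q \<in> cubes" "Q\<^sub>0 \<in> cubes" "Q \<subseteq> Q\<^sub>0" and G: "G \<in> sets lebesgue" "G \<subseteq> Q"
    and c: "\<And>x. x \<in> Q \<Longrightarrow> c \<le> (lam Q / lam Q\<^sub>0) powr P x" "0 \<le> c"
  shows "c * measure (\<mu> Q) G \<le> measure (\<mu> Q\<^sub>0) G"
proof -
  have [measurable]: "Q \<in> sets lebesgue" "Q\<^sub>0 \<in> sets lebesgue" "G \<in> sets lebesgue"
    using Q G cubes_sets by blast+
  have "ennreal c * emeasure (\<mu> Q) G = (\<integral>\<^sup>+x. ennreal c * (ennreal (V Q x) * indicator G x) \<partial>lebesgue)"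
    by (simp add: emeasure_\<mu>[OF Q(1) G(1)] nn_integral_cmult)
  also have "\<dots> \<le> emeasure (\<mu> Q\<^sub>0) G"
    unfolding emeasure_\<mu>[OF Q(2) G(1)]
  proof (rule nn_integral_mono)
    fix x
    show "ennreal c * (ennreal (V Q x) * indicator G x) \<le> ennreal (V Q\<^sub>0 x) * indicator G x"
      using V_change_cube[OF Q, of x] c(1)[of x] c(2) G(2)
      by (auto simp: indicator_def mult_right_mono intro!: ennreal_leI simp flip: ennreal_mult)
  qed
  finally show ?thesis
    using c(2) by (simp add: emeasure_\<mu>_eq Q flip: ennreal_mult)
qed

text \<open>If the ratio exceeded 1, so would its powers with exponent \<open>P x \<ge> 1\<close>,
  at least by the ratio itself, and \<open>Q\<close> would have
  \<open>\<mu> Q\<^sub>0\<close>-measure above 1.\<close>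

lemma lam_mono:
  assumes Q: "Q \<in> cubes" "Q\<^sub>0 \<in> cubes" "Q \<subseteq> Q\<^sub>0"
  shows "lam Q / lam Q\<^sub>0 \<le> 1"
proof (rule ccontr)
  assume N: "\<not> lam Q / lam Q\<^sub>0 \<le> 1"
  have "(lam Q / lam Q\<^sub>0) powr 1 \<le> (lam Q / lam Q\<^sub>0) powr P x" for x
    using N P_ge by (intro powr_mono) auto
  then have "(lam Q / lam Q\<^sub>0) powr 1 * measure (\<mu> Q) Q \<le> measure (\<mu> Q\<^sub>0) Q"
    by (intro \<mu>_change_cube_ge Q cubes_sets) auto
  then show False
    using measure_\<mu>_cube[OF Q(1)] measure_\<mu>_le_1[OF Q(2), of Q] N lam_pos[OF Q(1)] lam_pos[OF Q(2)]
    by simp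
qed

text \<open>The \<open>\<mu> Q\<^sub>0\<close>-measure of \<open>Q\<close> lies between a power of
  the volume ratio, by \<open>measure_le_\<mu>\<close>, and the ratio of the norms, because that
  ratio is at most 1 and \<open>P x \<ge> 1\<close>.\<close>

lemma lam_lower:
  assumes Q: "Q \<in> cubes" "Q\<^sub>0 \<in> cubes" "Q \<subseteq> Q\<^sub>0"
  shows "(2 * C * measure lebesgue Q\<^sub>0 / measure lebesgue Q) powr (- (pmax + 1)) \<le> lam Q / lam Q\<^sub>0"
proof -
  define K where "K = 2 * C * measure lebesgue Q\<^sub>0 / measure lebesgue Q"
  define m where "m = measure (\<mu> Q\<^sub>0) Q"
  have pos: "0 < measure lebesgue Q" "0 < measure lebesgue Q\<^sub>0"
    using Q measure_cubes_pos by blast+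
  have le: "measure lebesgue Q \<le> measure lebesgue Q\<^sub>0"
    using emeasure_mono[OF Q(3) cubes_sets[OF Q(2)]] pos by (simp add: emeasure_cubes Q)
  have "1 * measure lebesgue Q \<le> (2 * C) * measure lebesgue Q\<^sub>0"
    using le C_ge pos by (intro mult_mono) auto
  then have K: "1 \<le> K"
    using pos by (simp add: K_def)
  \<comment> \<open>\<open>K\<close> is chosen as the parameter \<open>A\<close> for which the term
    \<open>1 / A\<close> accounts for exactly half of the volume of \<open>Q\<close>.\<close>
  have "measure lebesgue Q \<le> C * measure lebesgue Q\<^sub>0 * (K powr pmax * m + 1 / K)"
    unfolding m_def by (rule measure_le_\<mu>[OF Q(2) cubes_sets[OF Q(1)] Q(3) K])
  also have "\<dots> = C * measure lebesgue Q\<^sub>0 * (K powr pmax * m) + measure lebesgue Q / 2"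
    using pos C_ge by (simp add: K_def field_simps)
  finally have "1 \<le> K * (K powr pmax * m)"
    using pos by (simp add: K_def field_simps)
  also have "K * (K powr pmax * m) = K powr (pmax + 1) * m"
    using K by (simp add: powr_add)
  finally have "K powr (- (pmax + 1)) \<le> m"
    using K unfolding powr_minus by (simp add: divide_simps mult.commute)
  also have "m \<le> (lam Q / lam Q\<^sub>0) powr 1 * measure (\<mu> Q) Q"
    unfolding m_def
  proof (intro \<mu>_change_cube_le Q cubes_sets order_refl powr_ge_zero)
    fix x
    show "(lam Q / lam Q\<^sub>0) powr P x \<le> (lam Q / lam Q\<^sub>0) powr 1"
      using lam_mono[OF Q] lam_pos[OF Q(1)] lam_pos[OF Q(2)] P_ge by (intro powr_mono') auto
  qed
  also have "\<dots> = lam Q / lam Q\<^sub>0"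
    using measure_\<mu>_cube[OF Q(1)] lam_pos Q by (simp add: less_imp_le)
  finally show ?thesis
    by (simp add: K_def)
qed

section \<open>Oscillation of the exponent and the \<open>A_\<infinity>\<close> property\<close>

lemma P_diff_le: "\<bar>P x - P y\<bar> \<le> pmax"
  using P_ge[of x] P_ge[of y] P_le[of x] P_le[of y] by linarith

definition L\<^sub>2 :: real where "L\<^sub>2 = pmax * (ln DIM('a) + ln (exp 1 + 2)) + 2 * L"

text \<open>Split \<open>ln (l / s)\<close> into \<open>ln l\<close> and \<open>ln (1 / s)\<close>.
  The second is controlled by local continuity, up to \<open>ln DIM('a)\<close> from the diameter of
  the cube. The first is bounded if \<open>l \<le> 2\<close>; otherwise the whole cube has distance
  at least \<open>l / 2\<close> from the origin and continuity at infinity applies. The term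
  \<open>ln (exp 1 + 2)\<close> in \<open>L\<^sub>2\<close> covers both cases.\<close>

lemma oscillation_le:
  assumes s: "0 < s" and l: "0 < l"
    and Q: "cube c s \<subseteq> cube a l"
    and good: "l \<le> 2 \<or> (\<forall>x\<in>cube a l. l / 2 \<le> norm x)"
    and xy: "x \<in> cube c s" "y \<in> cube c s"
  shows "\<bar>P x - P y\<bar> * ln (l / s) \<le> L\<^sub>2"
proof -
  define D where "D = \<bar>P x - P y\<bar>"
  have D: "0 \<le> D" "D \<le> pmax"
    using P_diff_le by (auto simp: D_def)
  have e: "0 < exp (1::real)"
    by simp
  have LH: "D * ln (exp 1 + 1 / norm (x - y)) \<le> L"
    "D * ln (exp 1 + min (norm x) (norm y)) \<le> L"
    using log_Holder by (simp_all add: log_Holder_def D_def)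
  have d: "1 \<le> real DIM('a)"
    using DIM_positive[where 'a = 'a] by linarith
  have small: "D * ln (exp 1 + 1 / s) \<le> pmax * ln DIM('a) + L"
  proof (cases "x = y")
    case True
    then show ?thesis
      using d pmax_ge L_nonneg by (simp add: D_def)
  next
    case False
    define n where "n = norm (x - y)"
    have n: "0 < n" "n \<le> DIM('a) * s"
      using False norm_diff_le_cube[OF xy] by (auto simp: n_def)
    have "exp 1 + 1 / s \<le> DIM('a) * (exp 1 + 1 / n)"
    proof -
      have "1 * exp 1 \<le> DIM('a) * exp (1::real)"
        using d by (intro mult_right_mono) auto
      moreover have "1 / s \<le> DIM('a) * (1 / n)"
        using n s by (simp add: field_simps)
      ultimately show ?thesis
        unfolding distrib_left by linarith
    qed
    then have "ln (exp 1 + 1 / s) \<le> ln (DIM('a) * (exp 1 + 1 / n))"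
      using s e by (subst ln_le_cancel_iff) (auto intro!: add_pos_pos mult_pos_pos simp: n)
    also have "\<dots> = ln DIM('a) + ln (exp 1 + 1 / n)"
      using n e by (intro ln_mult_pos) (auto intro!: add_pos_pos)
    finally have "D * ln (exp 1 + 1 / s) \<le> D * (ln DIM('a) + ln (exp 1 + 1 / n))"
      using D by (intro mult_left_mono) auto
    also have "\<dots> \<le> pmax * ln DIM('a) + L"
      using LH(1) D d mult_right_mono[of D pmax "ln DIM('a)"] by (simp add: distrib_left n_def)
    finally show ?thesis .
  qed
  have large: "D * ln (exp 1 + l) \<le> pmax * ln (exp 1 + 2) + L"
    using good
  proof
    assume "l \<le> 2"
    then have "ln (exp 1 + l) \<le> ln (exp 1 + 2)"
      using l e by (subst ln_le_cancel_iff) (auto intro!: add_pos_pos)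
    moreover have "0 \<le> ln (exp 1 + l)"
      using l one_le_exp_iff[of 1] by (intro ln_ge_zero) linarith
    ultimately have "D * ln (exp 1 + l) \<le> pmax * ln (exp 1 + 2)"
      using D by (intro mult_mono) auto
    then show ?thesis
      using L_nonneg by linarith
  next
    assume far: "\<forall>x\<in>cube a l. l / 2 \<le> norm x"
    define m where "m = min (norm x) (norm y)"
    have m: "l / 2 \<le> m"
      using far xy Q by (auto simp: m_def)
    have "exp 1 + l \<le> 2 * (exp 1 + m)"
      using m e unfolding distrib_left by linarith
    then have "ln (exp 1 + l) \<le> ln (2 * (exp 1 + m))"
      using l e by (intro ln_mono) (auto intro!: add_pos_pos)
    also have "\<dots> = ln 2 + ln (exp 1 + m)"
      using l m e by (intro ln_mult_pos add_pos_pos) auto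
    also have "ln 2 \<le> ln (exp 1 + (2::real))"
      using e by (subst ln_le_cancel_iff) (auto intro!: add_pos_pos)
    finally have "D * ln (exp 1 + l) \<le> D * (ln (exp 1 + 2) + ln (exp 1 + m))"
      using D by (intro mult_left_mono) auto
    also have "\<dots> = D * ln (exp 1 + 2) + D * ln (exp 1 + m)"
      by (simp add: distrib_left)
    also have "D * ln (exp 1 + 2) \<le> pmax * ln (exp 1 + 2)"
      using D one_le_exp_iff[of 1] by (intro mult_right_mono ln_ge_zero) linarith+
    finally show ?thesis
      using LH(2) by (simp add: m_def)
  qed
  have "ln (l / s) = ln l + ln (1 / s)"
    using s l ln_mult_pos[of l "1 / s"] by simp
  also have "ln l \<le> ln (exp 1 + l)"
    using l e by (subst ln_le_cancel_iff) (auto intro!: add_pos_pos)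
  also have "ln (1 / s) \<le> ln (exp 1 + 1 / s)"
    using s e by (subst ln_le_cancel_iff) (auto intro!: add_pos_pos)
  finally have "D * ln (l / s) \<le> D * (ln (exp 1 + l) + ln (exp 1 + 1 / s))"
    using D by (intro mult_left_mono) auto
  then show ?thesis
    using small large by (simp add: L\<^sub>2_def D_def distrib_left)
qed

text \<open>A lower bound for \<open>N powr D\<close>, where \<open>N\<close> is the ratio of two
  norms and \<open>D\<close> a difference of values of \<open>P\<close>: \<open>lam_lower\<close>
  bounds \<open>N\<close> below by \<open>K powr (- (pmax + 1))\<close>, and
  \<open>oscillation_le\<close> bounds \<open>D * ln K\<close> above by the inner sum.\<close>

definition c\<^sub>2 :: real where
  "c\<^sub>2 = exp (- ((pmax + 1) * (pmax * ln (2 * C) + DIM('a) * L\<^sub>2)))"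

lemma c\<^sub>2: "0 < c\<^sub>2" "c\<^sub>2 \<le> 1"
proof -
  have "1 \<le> real DIM('a)"
    using DIM_positive[where 'a = 'a] by linarith
  moreover have "0 \<le> ln (exp 1 + (2::real))"
    using one_le_exp_iff[of 1] by (intro ln_ge_zero) linarith
  ultimately have "0 \<le> L\<^sub>2"
    unfolding L\<^sub>2_def using pmax_ge L_nonneg by (intro add_nonneg_nonneg mult_nonneg_nonneg) auto
  then have "0 \<le> (pmax + 1) * (pmax * ln (2 * C) + DIM('a) * L\<^sub>2)"
    using pmax_ge C_ge by (intro mult_nonneg_nonneg add_nonneg_nonneg) auto
  then show "c\<^sub>2 \<le> 1"
    unfolding c\<^sub>2_def by simp
qed (simp add: c\<^sub>2_def)

text \<open>
  The factor relating \<open>V\<close> on \<open>Q\<close> and on \<open>Q\<^sub>0\<close> is almost constant on \<open>Q\<close>: it is at least a power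
  of \<open>|Q| / |Q\<^sub>0|\<close>, and the oscillation of \<open>P\<close> on \<open>Q\<close> is at most of order \<open>1 / ln (|Q\<^sub>0| / |Q|)\<close>.
\<close>

lemma ratio_powr_P:
  assumes s: "0 < s" and l: "0 < l"
    and Q: "cube c s \<subseteq> cube a l"
    and good: "l \<le> 2 \<or> (\<forall>x\<in>cube a l. l / 2 \<le> norm x)"
    and xy: "x \<in> cube c s" "y \<in> cube c s"
    and N: "N = lam (cube c s) / lam (cube a l)"
  shows "c\<^sub>2 * N powr P y \<le> N powr P x"
proof -
  define D where "D = \<bar>P x - P y\<bar>"
  define K where "K = 2 * C * l ^ DIM('a) / s ^ DIM('a)"
  have cubes: "cube c s \<in> cubes" "cube a l \<in> cubes"
    using s l cubes_iff by blast+
  have K: "0 < K"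
    using C_ge s l by (simp add: K_def)
  have N1: "N \<le> 1" "K powr (- (pmax + 1)) \<le> N"
    using lam_mono[OF cubes Q] lam_lower[OF cubes Q] measure_cbox_cube[OF s, of c]
      measure_cbox_cube[OF l, of a] by (simp_all add: N K_def)
  have N0: "0 < N"
    using N1(2) K by (smt (verit) powr_gt_zero)
  have "ln K = ln (2 * C) + DIM('a) * ln (l / s)"
  proof -
    have "K = (2 * C) * (l / s) ^ DIM('a)"
      by (simp add: K_def power_divide)
    then show ?thesis
      using C_ge s l by (simp add: ln_mult_pos ln_realpow)
  qed
  then have "D * ln K = D * ln (2 * C) + DIM('a) * (D * ln (l / s))"
    by (simp add: distrib_left)
  also have "\<dots> \<le> pmax * ln (2 * C) + DIM('a) * L\<^sub>2"
    using oscillation_le[OF s l Q good xy] P_diff_le[of x y] C_ge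
    by (intro add_mono mult_right_mono mult_left_mono) (auto simp: D_def)
  finally have "(pmax + 1) * (D * ln K) \<le> (pmax + 1) * (pmax * ln (2 * C) + DIM('a) * L\<^sub>2)"
    using pmax_ge by (intro mult_left_mono) auto
  then have "c\<^sub>2 \<le> exp (- ((pmax + 1) * (D * ln K)))"
    by (simp add: c\<^sub>2_def)
  also have "\<dots> = (K powr (- (pmax + 1))) powr D"
    using K by (simp add: powr_powr powr_def algebra_simps)
  also have "\<dots> \<le> N powr D"
    using N1 by (intro powr_mono2) (auto simp: D_def)
  finally have "c\<^sub>2 * N powr P y \<le> N powr D * N powr P y"
    by (intro mult_right_mono) auto
  also have "\<dots> = N powr (D + P y)"
    using N0 by (simp add: powr_add)
  also have "\<dots> \<le> N powr P x"
    using N0 N1 by (intro powr_mono') (auto simp: D_def)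
  finally show ?thesis .
qed

text \<open>The complement of \<open>E\<close> keeps the share \<open>c\<^sub>1\<close> on its own
  cube. One factor \<open>c\<^sub>2\<close> is lost in carrying its measure to the large cube, the
  other in carrying that of the whole dyadic cube.\<close>

definition \<beta> :: real where "\<beta> = 1 - c\<^sub>1 * c\<^sub>2\<^sup>2"

lemma \<beta>: "0 < \<beta>" "\<beta> < 1"
proof -
  have "c\<^sub>1 * c\<^sub>2\<^sup>2 \<le> c\<^sub>1 * 1"
    using c\<^sub>1 c\<^sub>2 by (intro mult_left_mono power_le_one) auto
  then show "0 < \<beta>" "\<beta> < 1"
    using c\<^sub>1 c\<^sub>2 unfolding \<beta>_def by (linarith, simp)
qed

text \<open>The argument bounds the complement \<open>G\<close> of \<open>E\<close> from below: it
  has at least half the volume, hence \<open>\<mu> Q\<close>-measure at least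
  \<open>c\<^sub>1\<close>, and on \<open>Q\<close> the densities of \<open>\<mu> Q\<close> and
  \<open>\<mu> Q\<^sub>0\<close> are proportional up to \<open>c\<^sub>2\<close>. The closed cube
  \<open>Q\<close> stands in for \<open>D\<close>, since norms are given on closed cubes
  only.\<close>

lemma A_infinity_good:
  assumes l: "0 < l" and good: "l \<le> 2 \<or> (\<forall>x\<in>cube a l. l / 2 \<le> norm x)"
    and x: "x \<in> dyadic_cube a l 0 a"
    and E: "E \<subseteq> dyadic_cube a l n x" "E \<in> sets lebesgue"
      "emeasure lebesgue E \<le> ennreal (1 / 2) * emeasure lebesgue (dyadic_cube a l n x)"
  shows "emeasure (\<mu> (cube a l)) E
    \<le> ennreal \<beta> * emeasure (\<mu> (cube a l)) (dyadic_cube a l n x)"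
proof -
  define D Q\<^sub>0 s where "D = dyadic_cube a l n x" and "Q\<^sub>0 = cube a l" and "s = l / 2 ^ n"
  have s: "0 < s"
    using l by (simp add: s_def)
  obtain c where c: "D \<subseteq> cube c s" "cube c s \<subseteq> Q\<^sub>0"
    using dyadic_cube_in_cube[OF l x, of n] unfolding D_def Q\<^sub>0_def s_def by metis
  define Q where "Q = cube c s"
  have cubes: "Q \<in> cubes" "Q\<^sub>0 \<in> cubes"
    using s l cubes_iff unfolding Q_def Q\<^sub>0_def by blast+
  have D: "D \<in> sets lebesgue" "D \<subseteq> Q" "measure lebesgue D = measure lebesgue Q" "x \<in> D"
    using dyadic_cube_sets[OF l] c measure_cbox_cube[OF s, of c] emeasure_dyadic_cube[OF l, of a n x] l
    by (auto simp: D_def Q_def s_def measure_def)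
  have Dfin: "emeasure lebesgue D = ennreal (measure lebesgue Q)"
    using emeasure_dyadic_cube[OF l, of a n x] measure_cbox_cube[OF s, of c]
    by (simp add: D_def Q_def s_def)
  define G where "G = D - E"
  have G: "G \<in> sets lebesgue" "G \<subseteq> D" "G \<subseteq> Q"
    using D E by (auto simp: G_def)
  have ED: "E \<subseteq> D"
    using E by (simp add: D_def)
  have Efin: "emeasure lebesgue E \<noteq> \<infinity>"
    using emeasure_mono[OF ED D(1)] Dfin by (auto simp: top_unique)
  have "measure lebesgue E \<le> measure lebesgue Q / 2"
  proof -
    have "ennreal (measure lebesgue E) \<le> ennreal (1 / 2) * ennreal (measure lebesgue Q)"
      using E(3) Dfin Efin unfolding D_def by (metis emeasure_eq_ennreal_measure infinity_ennreal_def)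
    then show ?thesis
      by (subst (asm) ennreal_mult[symmetric]) auto
  qed
  moreover have "measure lebesgue G = measure lebesgue D - measure lebesgue E"
    unfolding G_def using D E ED Dfin Efin by (intro measure_Diff) auto
  ultimately have "c\<^sub>1 \<le> measure (\<mu> Q) G"
    using D(3) by (intro \<mu>_half_ge cubes G) auto
  then have 1: "c\<^sub>2 * (lam Q / lam Q\<^sub>0) powr P x * c\<^sub>1 \<le> c\<^sub>2 * (lam Q / lam Q\<^sub>0) powr P x * measure (\<mu> Q) G"
    using c\<^sub>2 by (intro mult_left_mono) auto
  have ratio: "c\<^sub>2 * (lam Q / lam Q\<^sub>0) powr P z \<le> (lam Q / lam Q\<^sub>0) powr P y" if "y \<in> Q" "z \<in> Q" for y z
    using ratio_powr_P[OF s l c(2)[unfolded Q\<^sub>0_def] good that[unfolded Q_def] refl]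
    by (simp add: Q_def Q\<^sub>0_def)
  have 2: "c\<^sub>2 * (lam Q / lam Q\<^sub>0) powr P x * measure (\<mu> Q) G \<le> measure (\<mu> Q\<^sub>0) G"
    using D c\<^sub>2 c(2) by (intro \<mu>_change_cube_ge cubes G ratio) (auto simp: Q_def)
  have "measure (\<mu> Q\<^sub>0) D \<le> ((lam Q / lam Q\<^sub>0) powr P x / c\<^sub>2) * measure (\<mu> Q) D"
  proof (intro \<mu>_change_cube_le cubes D)
    fix y assume "y \<in> Q"
    then show "(lam Q / lam Q\<^sub>0) powr P y \<le> (lam Q / lam Q\<^sub>0) powr P x / c\<^sub>2"
      using ratio[of x y] D c\<^sub>2 by (auto simp: field_simps)
  qed (use c c\<^sub>2 in \<open>auto simp: Q_def\<close>)
  also have "\<dots> \<le> ((lam Q / lam Q\<^sub>0) powr P x / c\<^sub>2) * 1"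
    using c\<^sub>2 measure_\<mu>_le_1[OF cubes(1), of D] by (intro mult_left_mono) auto
  finally have "c\<^sub>1 * c\<^sub>2\<^sup>2 * measure (\<mu> Q\<^sub>0) D \<le> c\<^sub>1 * c\<^sub>2\<^sup>2 * ((lam Q / lam Q\<^sub>0) powr P x / c\<^sub>2)"
    using c\<^sub>1 c\<^sub>2 by (intro mult_left_mono) auto
  also have "\<dots> = c\<^sub>2 * (lam Q / lam Q\<^sub>0) powr P x * c\<^sub>1"
    using c\<^sub>2 by (simp add: power2_eq_square)
  finally have "c\<^sub>1 * c\<^sub>2\<^sup>2 * measure (\<mu> Q\<^sub>0) D \<le> measure (\<mu> Q\<^sub>0) G"
    using 1 2 by linarith
  moreover have "measure (\<mu> Q\<^sub>0) G = measure (\<mu> Q\<^sub>0) D - measure (\<mu> Q\<^sub>0) E"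
    unfolding G_def using D E ED emeasure_\<mu>_eq[OF cubes(2)] by (intro measure_Diff) auto
  ultimately have "measure (\<mu> Q\<^sub>0) E \<le> \<beta> * measure (\<mu> Q\<^sub>0) D"
    by (simp add: \<beta>_def algebra_simps)
  then have "ennreal (measure (\<mu> Q\<^sub>0) E) \<le> ennreal (\<beta> * measure (\<mu> Q\<^sub>0) D)"
    by (rule ennreal_leI)
  then show ?thesis
    using \<beta> by (simp add: emeasure_\<mu>_eq[OF cubes(2)] ennreal_mult Q\<^sub>0_def[symmetric] D_def[symmetric])
qed

section \<open>The reverse Hoelder inequality\<close>

text \<open>Since \<open>V Q\<close> is a probability density, the product of \<open>V Q\<close> and
  the volume has mean 1 on \<open>Q\<close>, and \<open>R \<epsilon> Q\<close> is the mean of its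
  power \<open>1 + \<epsilon>\<close>. A bound for \<open>R\<close> uniform in \<open>Q\<close> is
  the reverse Hoelder inequality.\<close>

definition R :: "real \<Rightarrow> 'a set \<Rightarrow> ennreal" where
  "R \<epsilon> Q = (\<integral>\<^sup>+x. ennreal (V Q x * (measure lebesgue Q * V Q x) powr \<epsilon>) \<partial>lebesgue)"

text \<open>By Chebyshev the level set above \<open>2 * b ^ k\<close> has volume fraction below
  \<open>1 / b ^ k\<close>. As \<open>1 / b\<close> is \<open>\<alpha> / 2 ^ DIM('a)\<close> for
  \<open>\<alpha> = 1 / 2\<close>, its \<open>\<mu> Q\<close>-measure is at most
  \<open>\<beta> ^ k\<close>, and the layers sum to a geometric series of ratio
  \<open>b powr \<epsilon> * \<beta>\<close>.\<close>

lemma R_good: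
  assumes l: "0 < l" and good: "l \<le> 2 \<or> (\<forall>x\<in>cube a l. l / 2 \<le> norm x)"
    and b: "b = 2 ^ Suc (DIM('a))" and \<epsilon>: "0 < \<epsilon>" "b powr \<epsilon> * \<beta> < 1"
  shows "R \<epsilon> (cube a l)
    \<le> ennreal (2 powr \<epsilon> + (2 * b) powr \<epsilon> / (1 - b powr \<epsilon> * \<beta>))"
proof -
  define Q D M where "Q = cube a l" and "D = dyadic_cube a l 0 a" and "M = l ^ DIM('a)"
  have Q: "Q \<in> cubes" "measure lebesgue Q = M" "0 < M"
    using l cubes_iff measure_cbox_cube[OF l, of a] unfolding Q_def M_def by auto
  have [measurable]: "Q \<in> sets lebesgue" "D \<in> sets lebesgue"
    using cubes_sets[OF Q(1)] dyadic_cube_sets[OF l] by (auto simp: D_def)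
  have b1: "1 < b"
    unfolding b by (intro one_less_power) auto
  \<comment> \<open>The factor 2 provides the strict inequality that
    \<open>dyadic_power_bound\<close> demands.\<close>
  define T where "T k = 2 * b ^ k" for k
  have T: "0 < T k" for k
    using b1 by (simp add: T_def)
  define F where "F k = {x \<in> space lebesgue. T k < M * V Q x} \<inter> D" for k
  have F [measurable]: "F k \<in> sets lebesgue" for k
    unfolding F_def by measurable
  have \<mu>F: "emeasure (\<mu> Q) (F k) \<le> ennreal (\<beta> ^ k)" for k
  proof -
    have "ennreal (T k) * emeasure lebesgue (F k) = (\<integral>\<^sup>+x. ennreal (T k) * indicator (F k) x \<partial>lebesgue)"
      by (simp add: nn_integral_cmult_indicator)
    also have "\<dots> \<le> (\<integral>\<^sup>+x. ennreal M * (ennreal (V Q x) * indicator (F k) x) \<partial>lebesgue)"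
      using Q(3) by (intro nn_integral_mono) (auto simp: F_def indicator_def intro!: ennreal_leI simp flip: ennreal_mult)
    also have "\<dots> = ennreal M * emeasure (\<mu> Q) (F k)"
      using F by (simp add: emeasure_\<mu>[OF Q(1)] nn_integral_cmult)
    also have "\<dots> \<le> ennreal M * 1"
      using measure_\<mu>_le_1[OF Q(1)] by (intro mult_left_mono) (auto simp: emeasure_\<mu>_eq[OF Q(1)])
    finally have TF: "ennreal (T k) * emeasure lebesgue (F k) \<le> ennreal M"
      by simp
    have "emeasure lebesgue (F k) \<noteq> \<infinity>"
    proof
      assume "emeasure lebesgue (F k) = \<infinity>"
      then have "ennreal (T k) * emeasure lebesgue (F k) = top"
        using T[of k] by (simp only: infinity_ennreal_def ennreal_mult_top) simp
      then show False
        using TF by (simp add: top_unique)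
    qed
    then obtain f where f: "0 \<le> f" "emeasure lebesgue (F k) = ennreal f"
      by (cases "emeasure lebesgue (F k)") auto
    have "T k * f \<le> M"
      using TF f T[of k] Q(3) by (simp flip: ennreal_mult)
    then have "f \<le> M / T k"
      using T[of k] by (simp add: field_simps)
    also have "\<dots> < M / b ^ k"
      using Q(3) b1 by (intro divide_strict_left_mono) (auto simp: T_def)
    also have "\<dots> = (1 / 2 / 2 ^ DIM('a)) ^ k * l ^ DIM('a)"
      unfolding b M_def by (simp add: power_divide power_mult_distrib field_simps)
    finally have "emeasure lebesgue (F k) < ennreal ((1 / 2 / 2 ^ DIM('a)) ^ k * l ^ DIM('a))"
      using f by (simp only: ennreal_lessI ennreal_less_iff)
    then have "emeasure (\<mu> Q) (F k) \<le> ennreal \<beta> ^ k * emeasure (\<mu> Q) (dyadic_cube a l 0 a)"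
      using A_infinity_good[OF l good] F[of k]
      by (intro dyadic_power_bound[where \<alpha> = "1 / 2"] l) (auto simp: Q_def F_def D_def)
    also have "\<dots> \<le> ennreal \<beta> ^ k * 1"
      using measure_\<mu>_le_1[OF Q(1)] by (intro mult_left_mono) (auto simp: emeasure_\<mu>_eq[OF Q(1)])
    finally show ?thesis
      using \<beta> by (simp add: ennreal_power)
  qed
  have "R \<epsilon> Q \<le> (\<integral>\<^sup>+x. ennreal (2 powr \<epsilon>) * ennreal (V Q x)
      + (\<Sum>k. ennreal (T (Suc k) powr \<epsilon>) * (ennreal (V Q x) * indicator (F k) x)) \<partial>lebesgue)"
    unfolding R_def
  proof (rule nn_integral_mono_AE, rule AE_mp[OF AE_cube_dyadic[OF l, of a]], intro always_eventually allI impI)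
    fix x assume x: "x \<in> cube a l \<longrightarrow> x \<in> dyadic_cube a l 0 a"
    show "ennreal (V Q x * (measure lebesgue Q * V Q x) powr \<epsilon>) \<le> ennreal (2 powr \<epsilon>) * ennreal (V Q x)
      + (\<Sum>k. ennreal (T (Suc k) powr \<epsilon>) * (ennreal (V Q x) * indicator (F k) x))"
    proof (cases "x \<in> Q")
      case False
      then show ?thesis
        by (simp add: V_def)
    next
      case True
      then have "x \<in> D"
        using x by (simp add: Q_def D_def)
      then have ind: "(indicator (F k) x :: ennreal) = (if 2 * b ^ k < M * V Q x then 1 else 0)" for k
        by (simp add: F_def T_def indicator_def)
      have "ennreal (V Q x * (measure lebesgue Q * V Q x) powr \<epsilon>)
          = ennreal (V Q x) * ennreal ((M * V Q x) powr \<epsilon>)"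
        by (simp add: Q(2) ennreal_mult)
      also have "\<dots> \<le> ennreal (V Q x) * (ennreal (2 powr \<epsilon>) + (\<Sum>k. ennreal (T (Suc k) powr \<epsilon>) * indicator (F k) x))"
        unfolding ind unfolding T_def using Q(3) b1 \<epsilon>(1)
        by (intro mult_left_mono powr_le_layers) auto
      also have "\<dots> = ennreal (2 powr \<epsilon>) * ennreal (V Q x)
          + (\<Sum>k. ennreal (V Q x) * (ennreal (T (Suc k) powr \<epsilon>) * indicator (F k) x))"
        unfolding distrib_left by (subst ennreal_suminf_cmult) (simp add: mult.commute)
      finally show ?thesis
        by (simp add: mult.left_commute)
    qed
  qed
  also have "\<dots> = ennreal (2 powr \<epsilon>) * emeasure (\<mu> Q) UNIV
      + (\<Sum>k. ennreal (T (Suc k) powr \<epsilon>) * emeasure (\<mu> Q) (F k))"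
    using F by (simp add: nn_integral_add nn_integral_suminf nn_integral_cmult emeasure_\<mu>[OF Q(1)])
  also have "\<dots> \<le> ennreal (2 powr \<epsilon>) * 1
      + (\<Sum>k. ennreal (T (Suc k) powr \<epsilon>) * ennreal (\<beta> ^ k))"
    using measure_\<mu>_le_1[OF Q(1), of UNIV] \<mu>F
    by (intro add_mono suminf_le mult_left_mono) (auto simp: emeasure_\<mu>_eq[OF Q(1)])
  also have "(\<lambda>k. ennreal (T (Suc k) powr \<epsilon>) * ennreal (\<beta> ^ k))
      = (\<lambda>k. ennreal ((2 * b) powr \<epsilon> * (b powr \<epsilon> * \<beta>) ^ k))"
  proof
    fix k
    have "T (Suc k) powr \<epsilon> = (2 * b) powr \<epsilon> * (b ^ k) powr \<epsilon>"
      using b1 by (simp add: T_def powr_mult)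
    also have "(b ^ k) powr \<epsilon> = (b powr \<epsilon>) ^ k"
      using b1 by (simp add: powr_powr powr_realpow[symmetric] mult.commute)
    finally show "ennreal (T (Suc k) powr \<epsilon>) * ennreal (\<beta> ^ k)
        = ennreal ((2 * b) powr \<epsilon> * (b powr \<epsilon> * \<beta>) ^ k)"
      using \<beta> by (simp add: power_mult_distrib flip: ennreal_mult)
  qed
  also have "(\<Sum>k. ennreal ((2 * b) powr \<epsilon> * (b powr \<epsilon> * \<beta>) ^ k))
      = ennreal ((2 * b) powr \<epsilon> * (1 / (1 - b powr \<epsilon> * \<beta>)))"
    using \<epsilon> \<beta> by (intro suminf_ennreal_eq sums_mult geometric_sums) auto
  finally show ?thesis
    using \<epsilon> by (simp add: Q_def flip: ennreal_plus)
qed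

text \<open>The integrand has degree \<open>1 + \<epsilon>\<close> in the density and degree
  \<open>\<epsilon>\<close> in the volume, which gives the constant. Both the annulus step and the
  passage to an enclosing cube use it.\<close>

lemma R_piece:
  assumes Q: "Q \<in> cubes" "Q\<^sub>0 \<in> cubes" and S: "S \<in> sets lebesgue" "S \<subseteq> Q"
    and c: "\<And>x. x \<in> S \<Longrightarrow> V Q\<^sub>0 x \<le> c * V Q x" "0 \<le> c" and \<epsilon>: "0 < \<epsilon>"
  shows "(\<integral>\<^sup>+x. ennreal (V Q\<^sub>0 x * (measure lebesgue Q\<^sub>0 * V Q\<^sub>0 x) powr \<epsilon>) * indicator S x \<partial>lebesgue)
    \<le> ennreal (c * (c * (measure lebesgue Q\<^sub>0 / measure lebesgue Q)) powr \<epsilon>) * R \<epsilon> Q"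
proof -
  have [measurable]: "Q \<in> sets lebesgue" "Q\<^sub>0 \<in> sets lebesgue" "S \<in> sets lebesgue"
    using Q S cubes_sets by blast+
  have pos: "0 < measure lebesgue Q" "0 < measure lebesgue Q\<^sub>0"
    using Q measure_cubes_pos by blast+
  let ?C = "c * (c * (measure lebesgue Q\<^sub>0 / measure lebesgue Q)) powr \<epsilon>"
  have "(\<integral>\<^sup>+x. ennreal (V Q\<^sub>0 x * (measure lebesgue Q\<^sub>0 * V Q\<^sub>0 x) powr \<epsilon>) * indicator S x \<partial>lebesgue)
    \<le> (\<integral>\<^sup>+x. ennreal ?C * ennreal (V Q x * (measure lebesgue Q * V Q x) powr \<epsilon>) \<partial>lebesgue)"
  proof (rule nn_integral_mono)
    fix x
    show "ennreal (V Q\<^sub>0 x * (measure lebesgue Q\<^sub>0 * V Q\<^sub>0 x) powr \<epsilon>) * indicator S x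
      \<le> ennreal ?C * ennreal (V Q x * (measure lebesgue Q * V Q x) powr \<epsilon>)"
    proof (cases "x \<in> S")
      case True
      have "(measure lebesgue Q\<^sub>0 * V Q\<^sub>0 x) powr \<epsilon> \<le> (measure lebesgue Q\<^sub>0 * (c * V Q x)) powr \<epsilon>"
        using c(1)[OF True] pos \<epsilon> by (intro powr_mono2 mult_left_mono) auto
      then have "V Q\<^sub>0 x * (measure lebesgue Q\<^sub>0 * V Q\<^sub>0 x) powr \<epsilon>
          \<le> (c * V Q x) * (measure lebesgue Q\<^sub>0 * (c * V Q x)) powr \<epsilon>"
        using c(1)[OF True] c(2) by (intro mult_mono) auto
      also have "measure lebesgue Q\<^sub>0 * (c * V Q x)
          = (c * (measure lebesgue Q\<^sub>0 / measure lebesgue Q)) * (measure lebesgue Q * V Q x)"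
        using pos by simp
      also have "\<dots> powr \<epsilon> = (c * (measure lebesgue Q\<^sub>0 / measure lebesgue Q)) powr \<epsilon>
          * (measure lebesgue Q * V Q x) powr \<epsilon>"
        by (rule powr_mult)
      finally have "V Q\<^sub>0 x * (measure lebesgue Q\<^sub>0 * V Q\<^sub>0 x) powr \<epsilon>
          \<le> ?C * (V Q x * (measure lebesgue Q * V Q x) powr \<epsilon>)"
        by (simp add: mult_ac)
      then show ?thesis
        using True c(2) by (auto intro!: ennreal_leI simp flip: ennreal_mult)
    qed simp
  qed
  also have "\<dots> = ennreal ?C * R \<epsilon> Q"
    unfolding R_def by (rule nn_integral_cmult) measurable
  finally show ?thesis .
qed

section \<open>Cubes centred at the origin\<close>

abbreviation central_cube :: "nat \<Rightarrow> 'a set" where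
  "central_cube K \<equiv> cbox (- (2 ^ K) *\<^sub>R One) (- (2 ^ K) *\<^sub>R One + (2 * 2 ^ K) *\<^sub>R One)"

lemma central_cube_cubes: "central_cube K \<in> cubes"
  unfolding cubes_iff by (intro exI[of _ "- (2 ^ K) *\<^sub>R One"] exI[of _ "2 * 2 ^ K"]) auto

lemma mem_central_cube: "x \<in> central_cube K \<longleftrightarrow> (\<forall>i\<in>Basis. \<bar>x \<bullet> i\<bar> \<le> 2 ^ K)"
proof -
  have "- (2 ^ K) \<le> t \<and> t \<le> - (2 ^ K) + 2 * 2 ^ K \<longleftrightarrow> \<bar>t\<bar> \<le> 2 ^ K" for t :: real
    by auto
  then show ?thesis
    by (simp add: mem_box inner_diff_left)
qed

lemma central_cube_Suc: "central_cube K \<subseteq> central_cube (Suc K)"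
  unfolding subset_iff mem_central_cube by force

lemma measure_central_cube: "measure lebesgue (central_cube K) = (2 * 2 ^ K) ^ DIM('a)"
  by (rule measure_cbox_cube) simp

definition \<rho> :: real where "\<rho> = (1 - c\<^sub>1) powr (1 / pmax)"

lemma \<rho>: "0 < \<rho>" "\<rho> < 1"
proof -
  have "(1 - c\<^sub>1) powr (1 / pmax) < 1 powr (1 / pmax)"
    using c\<^sub>1 pmax_ge by (intro powr_less_mono2) auto
  then show "0 < \<rho>" "\<rho> < 1"
    using c\<^sub>1 by (auto simp: \<rho>_def)
qed

text \<open>The annulus has at least half the volume of the larger cube, so it takes at least
  \<open>c\<^sub>1\<close> of the probability. What remains for the inner cube is at least
  \<open>N powr pmax\<close>, where \<open>N\<close> is the ratio of the norms.\<close>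

lemma central_ratio: "lam (central_cube K) / lam (central_cube (Suc K)) \<le> \<rho>"
proof -
  define Q Q' N where "Q = central_cube K" and "Q' = central_cube (Suc K)"
    and "N = lam (central_cube K) / lam (central_cube (Suc K))"
  have Q: "Q \<in> cubes" "Q' \<in> cubes" "Q \<subseteq> Q'"
    using central_cube_cubes central_cube_Suc unfolding Q_def Q'_def by blast+
  have sets: "Q \<in> sets lebesgue" "Q' \<in> sets lebesgue"
    using Q cubes_sets by auto
  have N: "0 < N" "N \<le> 1"
    using lam_mono[OF Q] lam_pos Q by (auto simp: N_def Q_def Q'_def)
  have meas: "measure lebesgue Q' = 2 ^ DIM('a) * measure lebesgue Q"
    unfolding Q_def Q'_def measure_central_cube by (simp only: power_mult_distrib[symmetric] power_Suc)
  have "measure lebesgue (Q' - Q) = measure lebesgue Q' - measure lebesgue Q"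
    using emeasure_cubes[OF Q(2)] by (intro measure_Diff sets Q(3)) (simp only: infinity_ennreal_def ennreal_neq_top not_False_eq_True)
  moreover have "2 * measure lebesgue Q \<le> measure lebesgue Q'"
    using power_increasing[of 1 "DIM('a)" "2::real"] measure_cubes_pos[OF Q(1)]
      DIM_positive[where 'a = 'a] by (simp add: meas)
  ultimately have "measure lebesgue Q' / 2 \<le> measure lebesgue (Q' - Q)"
    by linarith
  then have "c\<^sub>1 \<le> measure (\<mu> Q') (Q' - Q)"
    by (intro \<mu>_half_ge Q sets sets.Diff Diff_subset)
  also have "\<dots> = measure (\<mu> Q') Q' - measure (\<mu> Q') Q"
    using Q sets emeasure_\<mu>_eq[OF Q(2)] by (intro measure_Diff) auto
  finally have "measure (\<mu> Q') Q \<le> 1 - c\<^sub>1"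
    using measure_\<mu>_cube[OF Q(2)] by simp
  moreover have "N powr pmax * measure (\<mu> Q) Q \<le> measure (\<mu> Q') Q"
    using N P_le by (intro \<mu>_change_cube_ge Q sets) (auto simp: N_def Q_def Q'_def intro: powr_mono')
  ultimately have "N powr pmax \<le> 1 - c\<^sub>1"
    using measure_\<mu>_cube[OF Q(1)] by simp
  then have "(N powr pmax) powr (1 / pmax) \<le> \<rho>"
    unfolding \<rho>_def using pmax_ge by (intro powr_mono2) auto
  moreover have "(N powr pmax) powr (1 / pmax) = N"
    using N pmax_ge by (simp add: powr_powr)
  ultimately show ?thesis
    by (simp only: N_def)
qed

text \<open>At level 2 the grid of the larger cube has mesh \<open>2 ^ K\<close>, so the faces of
  the inner cube are grid planes, and a grid cube with a point outside stays outside up to its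
  boundary. Level 1 would be too coarse, since its cubes have a corner at the origin.\<close>

lemma dyadic_annulus:
  assumes x: "x \<in> dyadic_cube (- (2 ^ Suc K) *\<^sub>R One) (2 * 2 ^ Suc K) 0 (- (2 ^ Suc K) *\<^sub>R One)"
    and c: "dyadic_cube (- (2 ^ Suc K) *\<^sub>R One) (2 * 2 ^ Suc K) 2 x \<subseteq> cube c (2 ^ K)"
      "box c (c + (2 ^ K) *\<^sub>R One) \<subseteq> dyadic_cube (- (2 ^ Suc K) *\<^sub>R One) (2 * 2 ^ Suc K) 2 x"
    and not: "x \<notin> central_cube K"
  shows "\<forall>y\<in>cbox c (c + (2 ^ K) *\<^sub>R One :: 'a). 2 ^ K \<le> norm y"
proof -
  \<comment> \<open>The summand 2 arises because the corner of the grid has coordinates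
    \<open>- 2\<close> in units of the mesh \<open>2 ^ K\<close>.\<close>
  have floor: "\<lfloor>2 ^ 2 * ((y - - (2 ^ Suc K) *\<^sub>R One) \<bullet> i) / (2 * 2 ^ Suc K)\<rfloor> = \<lfloor>y \<bullet> i / 2 ^ K\<rfloor> + 2"
    if "i \<in> Basis" for y i :: 'a
  proof -
    have "2 ^ 2 * ((y - - (2 ^ Suc K) *\<^sub>R One) \<bullet> i) / (2 * 2 ^ Suc K) = y \<bullet> i / 2 ^ K + 2"
      using that by (simp add: inner_add_left field_simps)
    then show ?thesis
      using floor_add_int[of "y \<bullet> i / 2 ^ K" 2] by simp
  qed
  obtain i where i: "i \<in> Basis" "2 ^ K < \<bar>x \<bullet> i\<bar>"
    using not unfolding mem_central_cube by force
  have "box c (c + (2 ^ K) *\<^sub>R One) \<subseteq> {y. 2 ^ K \<le> norm y}"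
  proof
    fix y assume "y \<in> box c (c + (2 ^ K) *\<^sub>R One)"
    then have "y \<in> dyadic_cube (- (2 ^ Suc K) *\<^sub>R One) (2 * 2 ^ Suc K) 2 x"
      using c(2) by blast
    then have "\<lfloor>2 ^ 2 * ((y - - (2 ^ Suc K) *\<^sub>R One) \<bullet> i) / (2 * 2 ^ Suc K)\<rfloor>
        = \<lfloor>2 ^ 2 * ((x - - (2 ^ Suc K) *\<^sub>R One) \<bullet> i) / (2 * 2 ^ Suc K)\<rfloor>"
      using i(1) unfolding dyadic_cube_def by blast
    then have eq: "\<lfloor>y \<bullet> i / 2 ^ K\<rfloor> = \<lfloor>x \<bullet> i / 2 ^ K\<rfloor>"
      unfolding floor[OF i(1)] by linarith
    have "2 ^ K \<le> \<bar>y \<bullet> i\<bar>"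
    proof (cases "0 \<le> x \<bullet> i")
      case True
      then have "1 \<le> x \<bullet> i / 2 ^ K"
        using i(2) by simp
      then have "1 \<le> \<lfloor>y \<bullet> i / 2 ^ K\<rfloor>"
        unfolding eq by (simp add: le_floor_iff)
      then have "1 \<le> y \<bullet> i / 2 ^ K"
        by (simp add: le_floor_iff)
      then show ?thesis
        by simp
    next
      case False
      then have "x \<bullet> i / 2 ^ K < -1"
        using i(2) by (simp add: field_simps)
      then have "\<lfloor>y \<bullet> i / 2 ^ K\<rfloor> < -1"
        unfolding eq by (simp add: floor_less_iff)
      then have "y \<bullet> i / 2 ^ K < -1"
        by (simp add: floor_less_iff)
      then have "y \<bullet> i < - (2 ^ K)"
        by (simp add: field_simps)
      then show ?thesis
        by simp
    qed
    then show "y \<in> {y. 2 ^ K \<le> norm y}"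
      using Basis_le_norm[OF i(1), of y] by simp
  qed
  then have "closure (box c (c + (2 ^ K) *\<^sub>R One)) \<subseteq> {y. 2 ^ K \<le> norm y}"
    by (intro closure_minimal closed_Collect_le continuous_intros)
  moreover have "box c (c + (2 ^ K) *\<^sub>R One) \<noteq> {}"
    by (simp add: box_ne_empty inner_add_left)
  ultimately show ?thesis
    by auto
qed

text \<open>On the inner cube the density shrinks by \<open>\<rho>\<close>, since the ratio of norms
  is at most \<open>\<rho> < 1\<close> and the exponent at least 1; the changed volume costs
  \<open>(2 ^ DIM('a)) powr \<epsilon>\<close>. The rest is covered by at most
  \<open>4 ^ DIM('a)\<close> cubes of side \<open>2 ^ K\<close> that keep the distance
  \<open>2 ^ K\<close> from the origin, so \<open>good\<close> applies to each.\<close>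

lemma R_central_Suc:
  assumes good: "\<And>a l. 0 < l \<Longrightarrow> l \<le> 2 \<or> (\<forall>x\<in>cube a l. l / 2 \<le> norm x) \<Longrightarrow>
      R \<epsilon> (cube a l) \<le> ennreal B"
    and \<epsilon>: "0 < \<epsilon>" and B: "0 \<le> B"
  shows "R \<epsilon> (central_cube (Suc K)) \<le> ennreal (\<rho> * (2 ^ DIM('a)) powr \<epsilon>) * R \<epsilon> (central_cube K)
    + ennreal (4 ^ DIM('a) * ((4 ^ DIM('a)) powr \<epsilon> * B))"
proof -
  define Q Q' a l where "Q = central_cube K" and "Q' = central_cube (Suc K)"
    and "a = - (2 ^ Suc K) *\<^sub>R (One :: 'a)" and "l = (2 :: real) * 2 ^ Suc K"
  have Q: "Q \<in> cubes" "Q' \<in> cubes" "Q \<subseteq> Q'"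
    using central_cube_cubes central_cube_Suc unfolding Q_def Q'_def by blast+
  have [measurable]: "Q \<in> sets lebesgue" "Q' \<in> sets lebesgue"
    using Q cubes_sets by auto
  have l: "0 < l" "l / 2 ^ 2 = 2 ^ K"
    by (auto simp: l_def)
  have Q': "Q' = cube a l"
    by (simp add: Q'_def a_def l_def)
  have meas: "measure lebesgue Q' = 2 ^ DIM('a) * measure lebesgue Q"
    unfolding Q_def Q'_def measure_central_cube by (simp only: power_mult_distrib[symmetric] power_Suc)
  define f where "f x = ennreal (V Q' x * (measure lebesgue Q' * V Q' x) powr \<epsilon>)" for x
  have [measurable]: "f \<in> borel_measurable lebesgue"
    unfolding f_def by measurable
  define DD where "DD = {D \<in> {dyadic_cube a l 2 x | x. x \<in> dyadic_cube a l 0 a}. \<not> D \<subseteq> Q}"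
  have "DD \<subseteq> {dyadic_cube a l 2 x | x. x \<in> dyadic_cube a l 0 a}"
    unfolding DD_def by blast
  then have DD: "finite DD" "card DD \<le> (2 ^ 2) ^ DIM('a)"
    using finite_dyadic_subcubes[OF l(1), of a 2]
    by (meson finite_subset card_mono order_trans)+
  have DD_sets [measurable]: "D \<in> sets lebesgue" if "D \<in> DD" for D
    using that dyadic_cube_sets[OF l(1)] by (auto simp: DD_def)
  have V_le: "V Q' x \<le> (lam S / lam Q') powr 1 * V S x" if "S \<in> cubes" "S \<subseteq> Q'" "x \<in> S" for S x
    unfolding V_change_cube[OF that(1) Q(2) that(2,3)]
    using lam_mono[OF that(1) Q(2) that(2)] lam_pos[OF that(1)] lam_pos[OF Q(2)] P_ge
    by (intro mult_right_mono powr_mono') auto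
  have "R \<epsilon> Q' \<le> (\<integral>\<^sup>+x. f x * indicator Q x + (\<Sum>D\<in>DD. f x * indicator D x) \<partial>lebesgue)"
    unfolding R_def f_def[symmetric]
  proof (rule nn_integral_mono_AE, rule AE_mp[OF AE_cube_dyadic[OF l(1), of a]], intro always_eventually allI impI)
    fix x assume x: "x \<in> cube a l \<longrightarrow> x \<in> dyadic_cube a l 0 a"
    show "f x \<le> f x * indicator Q x + (\<Sum>D\<in>DD. f x * indicator D x)"
    proof (cases "x \<in> Q' \<and> x \<notin> Q")
      case False
      then show ?thesis
        by (auto simp: f_def V_def)
    next
      case True
      define D where "D = dyadic_cube a l 2 x"
      have "D \<in> DD"
        using x True Q' by (auto simp: DD_def D_def subset_iff intro!: exI[of _ x])
      then have "f x * indicator D x \<le> (\<Sum>D\<in>DD. f x * indicator D x)"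
        using DD by (intro member_le_sum) auto
      moreover have "x \<in> D"
        by (simp add: D_def)
      ultimately show ?thesis
        using True by simp
    qed
  qed
  also have "\<dots> = (\<integral>\<^sup>+x. f x * indicator Q x \<partial>lebesgue) + (\<Sum>D\<in>DD. \<integral>\<^sup>+x. f x * indicator D x \<partial>lebesgue)"
    by (subst nn_integral_add) (auto simp: nn_integral_sum intro!: borel_measurable_sum)
  also have "(\<integral>\<^sup>+x. f x * indicator Q x \<partial>lebesgue) \<le> ennreal (\<rho> * (2 ^ DIM('a)) powr \<epsilon>) * R \<epsilon> Q"
  proof -
    have "(\<integral>\<^sup>+x. f x * indicator Q x \<partial>lebesgue)
      \<le> ennreal (\<rho> * (\<rho> * (measure lebesgue Q' / measure lebesgue Q)) powr \<epsilon>) * R \<epsilon> Q"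
      unfolding f_def
    proof (intro R_piece Q order_refl \<epsilon>)
      fix x assume x: "x \<in> Q"
      have "V Q' x \<le> (lam Q / lam Q') powr 1 * V Q x"
        by (rule V_le[OF Q(1,3) x])
      also have "\<dots> \<le> \<rho> * V Q x"
        using central_ratio[of K] lam_pos[OF Q(1)] lam_pos[OF Q(2)]
        by (intro mult_right_mono) (auto simp: Q_def Q'_def)
      finally show "V Q' x \<le> \<rho> * V Q x" .
    qed (use \<rho> in auto)
    also have "\<dots> \<le> ennreal (\<rho> * (1 * (measure lebesgue Q' / measure lebesgue Q)) powr \<epsilon>) * R \<epsilon> Q"
      using \<rho> \<epsilon> by (intro mult_right_mono ennreal_leI mult_left_mono powr_mono2) auto
    finally show ?thesis
      using measure_cubes_pos[OF Q(1)] by (simp add: meas)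
  qed
  also have "(\<Sum>D\<in>DD. \<integral>\<^sup>+x. f x * indicator D x \<partial>lebesgue)
      \<le> (\<Sum>D\<in>DD. ennreal ((4 ^ DIM('a)) powr \<epsilon> * B))"
  proof (rule sum_mono)
    fix D assume D: "D \<in> DD"
    then obtain y x where "y \<in> dyadic_cube a l 0 a" "D = dyadic_cube a l 2 y" "x \<in> D" "x \<notin> Q"
      by (auto simp: DD_def)
    then have x: "x \<in> dyadic_cube a l 0 a" "D = dyadic_cube a l 2 x" "x \<notin> Q"
      using dyadic_cube_subset_0[of y a l 2] dyadic_cube_eq[of x a l 2 y] by auto
    obtain c where c: "D \<subseteq> cube c (2 ^ K)" "cube c (2 ^ K) \<subseteq> Q'"
      "box c (c + (2 ^ K) *\<^sub>R One) \<subseteq> D"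
      using dyadic_cube_in_cube[OF l(1) x(1), of 2] unfolding l(2) Q' x(2) by metis
    define S where "S = cube c (2 ^ K)"
    have S: "S \<in> cubes"
      unfolding S_def cubes_iff by (intro exI[of _ c] exI[of _ "2 ^ K"]) auto
    have "\<forall>y\<in>S. 2 ^ K \<le> norm y"
      unfolding S_def
      by (rule dyadic_annulus) (use c x in \<open>auto simp: a_def l_def Q_def\<close>)
    then have RS: "R \<epsilon> S \<le> ennreal B"
      unfolding S_def by (intro good) force+
    have measS: "measure lebesgue Q' / measure lebesgue S = 4 ^ DIM('a)"
      using measure_cbox_cube[of "2 ^ K" c] measure_central_cube[of "Suc K"]
      by (simp add: Q'_def S_def power_divide[symmetric])
    have "(\<integral>\<^sup>+x. f x * indicator D x \<partial>lebesgue)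
      \<le> ennreal (1 * (1 * (measure lebesgue Q' / measure lebesgue S)) powr \<epsilon>) * R \<epsilon> S"
      unfolding f_def
    proof (intro R_piece Q S \<epsilon> DD_sets D)
      show "D \<subseteq> S"
        using c by (simp add: S_def)
      fix x assume "x \<in> D"
      then have "V Q' x \<le> (lam S / lam Q') powr 1 * V S x"
        using c by (intro V_le S) (auto simp: S_def)
      also have "\<dots> \<le> 1 * V S x"
        using lam_mono[OF S Q(2)] lam_pos[OF S] lam_pos[OF Q(2)] c
        by (intro mult_right_mono) (auto simp: S_def)
      finally show "V Q' x \<le> 1 * V S x" .
    qed auto
    also have "\<dots> \<le> ennreal ((4 ^ DIM('a)) powr \<epsilon>) * ennreal B"
      unfolding measS using RS by (intro mult_mono) auto
    finally show "(\<integral>\<^sup>+x. f x * indicator D x \<partial>lebesgue) \<le> ennreal ((4 ^ DIM('a)) powr \<epsilon> * B)"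
      using B by (simp add: ennreal_mult)
  qed
  also have "(\<Sum>D\<in>DD. ennreal ((4 ^ DIM('a)) powr \<epsilon> * B)) = ennreal (card DD * ((4 ^ DIM('a)) powr \<epsilon> * B))"
    using B by (simp add: ennreal_mult ennreal_of_nat_eq_real_of_nat)
  also have "\<dots> \<le> ennreal (4 ^ DIM('a) * ((4 ^ DIM('a)) powr \<epsilon> * B))"
    using DD(2) B by (intro ennreal_leI mult_right_mono) (auto simp flip: of_nat_power_le_of_nat_cancel_iff simp: of_nat_le_iff)
  finally show ?thesis
    by (simp add: Q_def Q'_def add_mono)
qed

text \<open>The recursion is \<open>t \<mapsto> \<tau> * t + A\<close> with
  \<open>\<tau> < 1\<close>, whose fixed point is \<open>A / (1 - \<tau>)\<close>; adding
  \<open>B\<close> accommodates the start. The smallest central cube has side 2, which is the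
  threshold in \<open>good\<close>.\<close>

lemma R_central:
  assumes good: "\<And>a l. 0 < l \<Longrightarrow> l \<le> 2 \<or> (\<forall>x\<in>cube a l. l / 2 \<le> norm x) \<Longrightarrow>
      R \<epsilon> (cube a l) \<le> ennreal B"
    and \<epsilon>: "0 < \<epsilon>" and B: "0 \<le> B" and \<tau>: "\<rho> * (2 ^ DIM('a)) powr \<epsilon> < 1"
  shows "R \<epsilon> (central_cube K)
    \<le> ennreal (B + 4 ^ DIM('a) * ((4 ^ DIM('a)) powr \<epsilon> * B) / (1 - \<rho> * (2 ^ DIM('a)) powr \<epsilon>))"
    (is "_ \<le> ennreal (B + ?A / (1 - ?\<tau>))")
proof (induction K)
  case 0
  have "R \<epsilon> (central_cube 0) \<le> ennreal B"
    by (rule good) auto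
  also have "\<dots> \<le> ennreal (B + ?A / (1 - ?\<tau>))"
    using B \<tau> by (intro ennreal_leI) auto
  finally show ?case .
next
  case (Suc K)
  have \<tau>0: "0 \<le> ?\<tau>"
    using \<rho> by simp
  have "R \<epsilon> (central_cube (Suc K)) \<le> ennreal ?\<tau> * R \<epsilon> (central_cube K) + ennreal ?A"
    by (rule R_central_Suc[OF good \<epsilon> B])
  also have "\<dots> \<le> ennreal ?\<tau> * ennreal (B + ?A / (1 - ?\<tau>)) + ennreal ?A"
    by (intro add_right_mono mult_left_mono Suc) simp
  also have "\<dots> = ennreal (?\<tau> * (B + ?A / (1 - ?\<tau>)) + ?A)"
    using \<tau>0 \<tau> B by (simp add: ennreal_mult ennreal_plus)
  also have "\<dots> \<le> ennreal (B + ?A / (1 - ?\<tau>))"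
  proof (rule ennreal_leI)
    have "?\<tau> * (?A / (1 - ?\<tau>)) + ?A = ?A / (1 - ?\<tau>)"
      using \<tau> by (simp add: divide_simps) (simp add: algebra_simps)
    moreover have "?\<tau> * B \<le> 1 * B"
      using \<tau> B by (intro mult_right_mono) auto
    ultimately show "?\<tau> * (B + ?A / (1 - ?\<tau>)) + ?A \<le> B + ?A / (1 - ?\<tau>)"
      by (simp add: distrib_left)
  qed
  finally show ?case .
qed

text \<open>By \<open>lam_lower\<close> the ratio of the two norms is bounded below when the volumes
  are comparable, so the density of the small cube is at most a constant times that of the large
  one. The inner exponent \<open>pmax + 1\<close> is that of \<open>lam_lower\<close>, and
  \<open>pmax\<close> bounds \<open>P\<close>.\<close>

lemma R_enlarge:
  assumes Q: "Q \<in> cubes" "Q\<^sub>0 \<in> cubes" "Q \<subseteq> Q\<^sub>0"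
    and ratio: "measure lebesgue Q\<^sub>0 \<le> k * measure lebesgue Q" and \<epsilon>: "0 < \<epsilon>"
  shows "R \<epsilon> Q \<le> ennreal ((2 * C * k) powr ((pmax + 1) * pmax) *
    ((2 * C * k) powr ((pmax + 1) * pmax)) powr \<epsilon>) * R \<epsilon> Q\<^sub>0"
proof -
  define c where "c = (2 * C * k) powr ((pmax + 1) * pmax)"
  have pos: "0 < measure lebesgue Q" "0 < measure lebesgue Q\<^sub>0"
    using Q measure_cubes_pos by blast+
  have le: "measure lebesgue Q \<le> measure lebesgue Q\<^sub>0"
    using emeasure_mono[OF Q(3) cubes_sets[OF Q(2)]] pos by (simp add: emeasure_cubes Q)
  have "1 * measure lebesgue Q \<le> k * measure lebesgue Q"
    using le ratio by linarith
  then have k: "1 \<le> k"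
    using pos by (metis mult_le_cancel_right_pos)
  have "1 * 1 \<le> 2 * C * k"
    using C_ge k by (intro mult_mono) auto
  then have Ck: "1 \<le> 2 * C * k"
    by simp
  define N where "N = lam Q / lam Q\<^sub>0"
  have "2 * C * measure lebesgue Q\<^sub>0 / measure lebesgue Q \<le> 2 * C * k"
    using ratio pos C_ge by (simp add: divide_le_eq mult.assoc)
  then have "(2 * C * k) powr (- (pmax + 1)) \<le> N"
    using lam_lower[OF Q] pos C_ge pmax_ge unfolding N_def
    by (smt (verit) divide_pos_pos mult_pos_pos powr_mono2')
  then have "inverse N \<le> inverse ((2 * C * k) powr (- (pmax + 1)))"
    using Ck by (intro le_imp_inverse_le) auto
  then have N: "1 / N \<le> (2 * C * k) powr (pmax + 1)"
    unfolding powr_minus by (simp add: inverse_eq_divide)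
  have N0: "0 < N"
    using lam_pos Q by (simp add: N_def)
  have N1: "1 \<le> 1 / N"
    using lam_mono[OF Q] N0 by (simp add: divide_simps flip: N_def)
  have "R \<epsilon> Q = (\<integral>\<^sup>+x. ennreal (V Q x * (measure lebesgue Q * V Q x) powr \<epsilon>) * indicator Q x \<partial>lebesgue)"
    unfolding R_def by (intro nn_integral_cong) (simp add: V_def indicator_def)
  also have "\<dots> \<le> ennreal (c * (c * (measure lebesgue Q / measure lebesgue Q\<^sub>0)) powr \<epsilon>) * R \<epsilon> Q\<^sub>0"
  proof (intro R_piece Q cubes_sets \<epsilon>)
    fix x assume x: "x \<in> Q"
    have "V Q x = (1 / N) powr P x * V Q\<^sub>0 x"
      using N0 unfolding V_change_cube[OF Q x] N_def[symmetric] by (simp add: powr_divide)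
    also have "(1 / N) powr P x \<le> (1 / N) powr pmax"
      using N1 P_le by (intro powr_mono) auto
    also have "\<dots> \<le> ((2 * C * k) powr (pmax + 1)) powr pmax"
      using N N0 N1 pmax_ge by (intro powr_mono2) auto
    also have "\<dots> = c"
      using Ck by (simp add: powr_powr c_def)
    finally show "V Q x \<le> c * V Q\<^sub>0 x"
      by (simp add: mult_right_mono)
  qed (simp add: c_def)
  also have "\<dots> \<le> ennreal (c * (c * 1) powr \<epsilon>) * R \<epsilon> Q\<^sub>0"
    using le pos \<epsilon> by (intro mult_right_mono ennreal_leI mult_left_mono powr_mono2) (auto simp: c_def)
  finally show ?thesis
    by (simp add: c_def)
qed

text \<open>A point within \<open>l / 2\<close> of the origin bounds all coordinates in the cube by
  \<open>3 * l / 2\<close>. The least suitable power of two is at most \<open>3 * l\<close>, where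
  \<open>2 < l\<close> settles the exponent 0, so the side grows by at most the factor 6.\<close>

lemma enclosing_central_cube:
  assumes l: "2 < l" and x: "x \<in> cube a l" "norm x < l / 2"
  obtains K where "cube a l \<subseteq> central_cube K"
    "measure lebesgue (central_cube K) \<le> 6 ^ DIM('a) * measure lebesgue (cube a l)"
proof -
  define K where "K = (LEAST K. 3 * l / 2 \<le> 2 ^ K)"
  obtain K' where "3 * l / 2 < 2 ^ K'"
    using real_arch_pow[of 2 "3 * l / 2"] by auto
  then have "\<exists>K. 3 * l / 2 \<le> 2 ^ K"
    by (intro exI[of _ K']) auto
  then have K: "3 * l / 2 \<le> 2 ^ K"
    unfolding K_def by (rule LeastI_ex)
  have K_le: "2 ^ K \<le> 3 * l"
  proof (cases K)
    case 0
    then show ?thesis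
      using l by simp
  next
    case (Suc m)
    then have "\<not> 3 * l / 2 \<le> 2 ^ m"
      using not_less_Least[of m "\<lambda>K. 3 * l / 2 \<le> 2 ^ K"] by (simp add: K_def)
    then show ?thesis
      using Suc by simp
  qed
  show thesis
  proof (rule that[of K])
    show "cube a l \<subseteq> central_cube K"
    proof
      fix y assume y: "y \<in> cube a l"
      show "y \<in> central_cube K"
        unfolding mem_central_cube
      proof
        fix i :: 'a assume i: "i \<in> Basis"
        have "a \<bullet> i \<le> x \<bullet> i" "x \<bullet> i \<le> a \<bullet> i + l" "a \<bullet> i \<le> y \<bullet> i" "y \<bullet> i \<le> a \<bullet> i + l"
          using x(1) y i by (auto simp: mem_box inner_add_left)
        then show "\<bar>y \<bullet> i\<bar> \<le> 2 ^ K"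
          using Basis_le_norm[OF i, of x] x(2) K by linarith
      qed
    qed
    have "(2 * 2 ^ K) ^ DIM('a) \<le> (6 * l) ^ DIM('a)"
      using K_le by (intro power_mono) auto
    then show "measure lebesgue (central_cube K) \<le> 6 ^ DIM('a) * measure lebesgue (cube a l)"
      using l by (subst measure_central_cube, subst measure_cbox_cube) (auto simp: power_mult_distrib)
  qed
qed

theorem reverse_Holder:
  obtains \<epsilon> B where "0 < \<epsilon>" "0 \<le> B" "\<And>Q. Q \<in> cubes \<Longrightarrow> R \<epsilon> Q \<le> ennreal B"
proof -
  \<comment> \<open>This \<open>\<epsilon>\<close> makes \<open>b powr \<epsilon>\<close> equal to
    \<open>m powr (- (1 / 2))\<close>, so that \<open>b powr \<epsilon> * m < 1\<close>. It serves
    the geometric series, whose ratio contains \<open>\<beta>\<close>, and the recursion on central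
    cubes, whose ratio contains \<open>\<rho>\<close>.\<close>
  define b m \<epsilon> where "b = (2::real) ^ Suc (DIM('a))" and "m = max \<rho> \<beta>" and "\<epsilon> = ln (1 / m) / (2 * ln b)"
  have m: "0 < m" "m < 1" "\<rho> \<le> m" "\<beta> \<le> m"
    using \<rho> \<beta> by (auto simp: m_def)
  have b: "1 < b"
    unfolding b_def by (intro one_less_power) auto
  have \<epsilon>: "0 < \<epsilon>"
    using m b by (simp add: \<epsilon>_def)
  have "b powr \<epsilon> = (1 / m) powr (1 / 2)"
    using m b by (simp add: \<epsilon>_def powr_def)
  then have "b powr \<epsilon> * m = m powr (1 / 2)"
  proof -
    have "b powr \<epsilon> = m powr (- (1 / 2))" "m powr 1 = m"
      using \<open>b powr \<epsilon> = (1 / m) powr (1 / 2)\<close> m by (simp_all add: powr_divide powr_minus_divide)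
    then have "b powr \<epsilon> * m = m powr (- (1 / 2)) * m powr 1"
      by (simp only:)
    also have "\<dots> = m powr (1 / 2)"
      by (subst powr_add[symmetric]) simp
    finally show ?thesis .
  qed
  also have "\<dots> < 1 powr (1 / 2)"
    using m by (intro powr_less_mono2) auto
  finally have bm: "b powr \<epsilon> * m < 1"
    by simp
  have b\<beta>: "b powr \<epsilon> * \<beta> < 1"
    using bm m mult_left_mono[of \<beta> m "b powr \<epsilon>"] by simp
  have "\<rho> * (2 ^ DIM('a)) powr \<epsilon> \<le> m * b powr \<epsilon>"
    using m \<rho> \<epsilon> by (intro mult_mono powr_mono2) (auto simp: b_def)
  then have \<tau>: "\<rho> * (2 ^ DIM('a)) powr \<epsilon> < 1"
    using bm by (simp add: mult.commute)
  define B where "B = 2 powr \<epsilon> + (2 * b) powr \<epsilon> / (1 - b powr \<epsilon> * \<beta>)"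
  have B: "0 \<le> B"
    using b\<beta> by (simp add: B_def)
  note good = R_good[OF _ _ b_def \<epsilon> b\<beta>, folded B_def]
  define B' where "B' = B + 4 ^ DIM('a) * ((4 ^ DIM('a)) powr \<epsilon> * B) / (1 - \<rho> * (2 ^ DIM('a)) powr \<epsilon>)"
  define B'' where "B'' = (2 * C * 6 ^ DIM('a)) powr ((pmax + 1) * pmax) *
    ((2 * C * 6 ^ DIM('a)) powr ((pmax + 1) * pmax)) powr \<epsilon> * B'"
  have B': "0 \<le> B'"
    using B \<tau> by (simp add: B'_def)
  show thesis
  proof (rule that[of \<epsilon> "max B B''"])
    fix Q :: "'a set" assume Q: "Q \<in> cubes"
    then obtain a l where al: "0 < l" "Q = cube a l"
      unfolding cubes_iff by blast
    show "R \<epsilon> Q \<le> ennreal (max B B'')"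
    proof (cases "l \<le> 2 \<or> (\<forall>x\<in>cube a l. l / 2 \<le> norm x)")
      case True
      then have "R \<epsilon> Q \<le> ennreal B"
        unfolding al(2) by (rule good[OF al(1)])
      then show ?thesis
        by (rule order_trans) (simp add: ennreal_leI)
    next
      case False
      then obtain x where x: "x \<in> cube a l" "norm x < l / 2"
        by force
      obtain K where K: "Q \<subseteq> central_cube K"
          "measure lebesgue (central_cube K) \<le> 6 ^ DIM('a) * measure lebesgue Q"
        using enclosing_central_cube[OF _ x] False unfolding al(2) by (metis linorder_not_le)
      have "R \<epsilon> Q \<le> ennreal ((2 * C * 6 ^ DIM('a)) powr ((pmax + 1) * pmax) *
          ((2 * C * 6 ^ DIM('a)) powr ((pmax + 1) * pmax)) powr \<epsilon>) * R \<epsilon> (central_cube K)"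
        by (rule R_enlarge[OF Q central_cube_cubes K \<epsilon>])
      also have "\<dots> \<le> ennreal ((2 * C * 6 ^ DIM('a)) powr ((pmax + 1) * pmax) *
          ((2 * C * 6 ^ DIM('a)) powr ((pmax + 1) * pmax)) powr \<epsilon>) * ennreal B'"
        using R_central[OF good \<epsilon> B \<tau>, folded B'_def] by (intro mult_left_mono) auto
      also have "\<dots> = ennreal B''"
        using B' by (simp add: B''_def ennreal_mult)
      finally show ?thesis
        by (rule order_trans) (simp add: ennreal_leI)
    qed
  qed (use \<epsilon> B in auto)
qed

end

section \<open>Log-Hoelder continuous exponents\<close>

lemma log_Holder_transport:
  assumes "log_Holder L\<^sub>1 f\<^sub>1" "log_Holder L\<^sub>2 f\<^sub>2" "0 \<le> K\<^sub>1" "0 \<le> K\<^sub>2"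
    and le: "\<And>x y. \<bar>g x - g y\<bar> \<le> K\<^sub>1 * \<bar>f\<^sub>1 x - f\<^sub>1 y\<bar> + K\<^sub>2 * \<bar>f\<^sub>2 x - f\<^sub>2 y\<bar>"
  shows "log_Holder (K\<^sub>1 * L\<^sub>1 + K\<^sub>2 * L\<^sub>2) g"
proof -
  have *: "\<bar>g x - g y\<bar> * t \<le> K\<^sub>1 * L\<^sub>1 + K\<^sub>2 * L\<^sub>2"
    if t: "0 \<le> t" "\<bar>f\<^sub>1 x - f\<^sub>1 y\<bar> * t \<le> L\<^sub>1" "\<bar>f\<^sub>2 x - f\<^sub>2 y\<bar> * t \<le> L\<^sub>2" for x y t
  proof -
    have "\<bar>g x - g y\<bar> * t \<le> (K\<^sub>1 * \<bar>f\<^sub>1 x - f\<^sub>1 y\<bar> + K\<^sub>2 * \<bar>f\<^sub>2 x - f\<^sub>2 y\<bar>) * t"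
      using le t(1) by (rule mult_right_mono)
    also have "\<dots> = K\<^sub>1 * (\<bar>f\<^sub>1 x - f\<^sub>1 y\<bar> * t) + K\<^sub>2 * (\<bar>f\<^sub>2 x - f\<^sub>2 y\<bar> * t)"
      by (simp add: algebra_simps)
    also have "\<dots> \<le> K\<^sub>1 * L\<^sub>1 + K\<^sub>2 * L\<^sub>2"
      using t assms(3,4) by (intro add_mono mult_left_mono) auto
    finally show ?thesis .
  qed
  have e: "1 \<le> exp (1::real)"
    by simp
  have "0 \<le> ln (exp 1 + 1 / norm (x - y))" "0 \<le> ln (exp 1 + min (norm x) (norm y))" for x y :: 'a
    using e by (auto intro!: ln_ge_zero add_increasing2)
  then show ?thesis
    using assms(1,2) unfolding log_Holder_def by (auto intro!: *)
qed

lemma log_Holder_inverse: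
  assumes "log_Holder L f" "\<And>x. m \<le> f x" "0 < m"
  shows "log_Holder (L / m\<^sup>2) (\<lambda>x. 1 / f x)"
proof -
  have "log_Holder (1 / m\<^sup>2 * L + 0 * L) (\<lambda>x. 1 / f x)"
  proof (rule log_Holder_transport[OF assms(1,1)])
    fix x y
    have pos: "0 < f x" "0 < f y" "m\<^sup>2 \<le> f x * f y"
      using assms(2)[of x] assms(2)[of y] assms(3) by (auto simp: power2_eq_square intro: mult_mono)
    have "\<bar>1 / f x - 1 / f y\<bar> = \<bar>f x - f y\<bar> / (f x * f y)"
      using pos by (simp add: diff_frac_eq abs_mult abs_minus_commute)
    also have "\<dots> \<le> \<bar>f x - f y\<bar> / m\<^sup>2"
      using pos assms(3) by (intro divide_left_mono) auto
    finally show "\<bar>1 / f x - 1 / f y\<bar> \<le> 1 / m\<^sup>2 * \<bar>f x - f y\<bar> + 0 * \<bar>f x - f y\<bar>"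
      by simp
  qed auto
  then show ?thesis
    by simp
qed

lemma log_Holder_continuous:
  fixes f :: "'a::real_normed_vector \<Rightarrow> real"
  assumes "log_Holder L f"
  shows "continuous_on UNIV f"
  unfolding continuous_on_iff
proof (intro ballI allI impI)
  fix x :: 'a and e :: real assume e: "0 < e"
  \<comment> \<open>Chosen so that \<open>ln (1 / d) = L / e\<close>: below distance
    \<open>d\<close> the logarithmic factor exceeds \<open>L / e\<close>.\<close>
  define d where "d = exp (- (L / e))"
  show "\<exists>d>0. \<forall>x'\<in>UNIV. dist x' x < d \<longrightarrow> dist (f x') (f x) < e"
  proof (intro exI[of _ d] conjI ballI impI)
    show "0 < d"
      by (simp add: d_def)
    fix y assume y: "dist y x < d"
    show "dist (f y) (f x) < e"
    proof (cases "y = x")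
      case False
      define n where "n = norm (y - x)"
      have n: "0 < n" "n < d"
        using y False by (auto simp: n_def dist_norm)
      have "L / e = ln (1 / d)"
        by (simp add: d_def ln_div)
      also have "\<dots> < ln (exp 1 + 1 / n)"
      proof (subst ln_less_cancel_iff)
        show "1 / d < exp 1 + 1 / n"
          using n by (smt (verit) exp_gt_zero frac_less2)
      qed (use n \<open>0 < d\<close> in \<open>auto intro: add_pos_pos\<close>)
      finally have less: "L / e < ln (exp 1 + 1 / n)" .
      have L: "\<bar>f y - f x\<bar> * ln (exp 1 + 1 / n) \<le> L"
        using assms by (simp add: log_Holder_def n_def)
      show ?thesis
      proof (rule ccontr)
        assume "\<not> dist (f y) (f x) < e"
        then have "e * ln (exp 1 + 1 / n) \<le> \<bar>f y - f x\<bar> * ln (exp 1 + 1 / n)"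
          using n one_le_exp_iff[of 1] by (intro mult_right_mono ln_ge_zero) (auto simp: dist_real_def intro: add_increasing2)
        then show False
          using L less e by (simp add: field_simps)
      qed
    qed (use e in simp)
  qed
qed

lemma ln_exp_1_add_pos:
  fixes t :: real
  assumes "0 \<le> t" shows "0 < ln (exp 1 + t)"
proof -
  have "1 < exp (1::real)"
    by simp
  then have "1 < exp 1 + t"
    using assms by linarith
  then show ?thesis
    by (rule ln_gt_zero)
qed

text \<open>The factor 3 is the exponent in \<open>exp 1 + s \<le> 4 * s \<le> s ^ 3\<close>, valid
  for \<open>s = 1 / t > 2\<close>.\<close>

lemma ln_exp_1_add_inverse_le:
  fixes t :: real
  assumes "0 < t" "t < 1 / 2"
  shows "ln (exp 1 + 1 / t) \<le> 3 * (- ln t)"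
proof -
  define s where "s = 1 / t"
  have s: "2 < s"
    using assms by (simp add: s_def field_simps)
  have "4 * s \<le> s ^ 2 * s"
    using s power_mono[of 2 s 2] by (intro mult_right_mono) auto
  then have "4 * s \<le> s ^ 3"
    by (simp add: power2_eq_square power3_eq_cube)
  then have "exp 1 + s \<le> s ^ 3"
    using s exp_le by linarith
  then have "ln (exp 1 + s) \<le> ln (s ^ 3)"
    using s by (intro ln_mono add_pos_pos) auto
  also have "\<dots> = 3 * ln s"
    using s by (simp add: ln_realpow)
  also have "ln s = - ln t"
    using assms by (simp add: s_def ln_div)
  finally show ?thesis
    by (simp add: s_def)
qed

text \<open>Because \<open>ln (exp 1 + norm x) \<ge> 1\<close>, the condition at infinity bounds
  \<open>f\<close> by \<open>p\<^sub>i + C'\<close>. As \<open>f\<close> is nonnegative this also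
  bounds its differences, which settles pairs at distance at least \<open>1 / 2\<close>, where the
  local condition is silent.\<close>

lemma LH_imp_log_Holder:
  assumes LH: "(\<lambda>x. ereal (f x)) \<in> LH" and f: "\<And>x. 0 \<le> f x"
  shows "\<exists>L. log_Holder L (f :: 'a::euclidean_space \<Rightarrow> real)"
proof -
  obtain C where C: "0 < C" "\<And>x y. norm (x - y) < 1/2 \<Longrightarrow> \<bar>f x - f y\<bar> \<le> C / (- ln (norm (x - y)))"
    using LH by (auto simp: LH_def LH0_def)
  obtain p\<^sub>i C' where C': "0 < C'" "\<And>x. \<bar>f x - p\<^sub>i\<bar> \<le> C' / ln (exp 1 + norm x)"
    using LH by (auto simp: LH_def LH_infinity_def)
  have e: "1 < exp (1::real)"
    by simp
  have pos: "0 < ln (exp 1 + norm x)" for x :: 'a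
    by (rule ln_exp_1_add_pos) simp
  define b where "b = p\<^sub>i + C'"
  have f_le: "f x \<le> b" for x
  proof -
    have "ln (exp 1) \<le> ln (exp 1 + norm x)"
      by (intro ln_mono) auto
    then have "C' / ln (exp 1 + norm x) \<le> C' / 1"
      using C'(1) pos[of x] by (intro divide_left_mono) auto
    then show ?thesis
      using C'(2)[of x] by (simp add: b_def)
  qed
  have b: "0 \<le> b"
    using f f_le order_trans by blast
  have 1: "\<bar>f x - f y\<bar> * ln (exp 1 + 1 / norm (x - y)) \<le> b * ln (exp 1 + 2) + 3 * C" for x y
  proof -
    define n where "n = norm (x - y)"
    have bl: "0 \<le> b * ln (exp 1 + (2::real))"
      using b e by (intro mult_nonneg_nonneg ln_ge_zero) auto
    consider "x = y" | "0 < n" "n < 1/2" | "1/2 \<le> n"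
      by (force simp: n_def)
    then show ?thesis
    proof cases
      case 1
      then show ?thesis
        using bl C by simp
    next
      case 2
      have lnn: "0 < - ln n"
        using 2 by simp
      have "\<bar>f x - f y\<bar> * ln (exp 1 + 1 / n) \<le> (C / (- ln n)) * (3 * (- ln n))"
        using C(2)[of x y] C(1) 2 lnn e ln_exp_1_add_inverse_le[of n]
        by (intro mult_mono ln_ge_zero) (auto simp: n_def intro: add_increasing2)
      also have "\<dots> = 3 * C"
        using lnn by simp
      finally show ?thesis
        using bl by (simp add: n_def)
    next
      case 3
      have "1 / n \<le> 2"
        using 3 by (simp add: divide_le_eq)
      then have "ln (exp 1 + 1 / n) \<le> ln (exp 1 + 2)"
        using 3 by (intro ln_mono add_pos_nonneg) auto
      moreover have "\<bar>f x - f y\<bar> \<le> b"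
        using f[of x] f_le[of x] f[of y] f_le[of y] by linarith
      ultimately have "\<bar>f x - f y\<bar> * ln (exp 1 + 1 / n) \<le> b * ln (exp 1 + 2)"
        using 3 e b by (intro mult_mono ln_ge_zero) (auto intro: add_increasing2)
      then show ?thesis
        using C by (simp add: n_def)
    qed
  qed
  have 2: "\<bar>f x - f y\<bar> * ln (exp 1 + min (norm x) (norm y)) \<le> 2 * C'" for x y
  proof -
    define m where "m = ln (exp 1 + min (norm x) (norm y))"
    have m: "0 < m" "m \<le> ln (exp 1 + norm x)" "m \<le> ln (exp 1 + norm y)"
      unfolding m_def by (auto intro!: ln_mono ln_exp_1_add_pos add_pos_nonneg)
    have "\<bar>f z - p\<^sub>i\<bar> \<le> C' / m" if "m \<le> ln (exp 1 + norm z)" for z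
      using C'(2)[of z] frac_le[of C' C' m "ln (exp 1 + norm z)"] C'(1) m that by linarith
    then have "\<bar>f x - p\<^sub>i\<bar> \<le> C' / m" "\<bar>f y - p\<^sub>i\<bar> \<le> C' / m"
      using m by blast+
    then have "\<bar>f x - f y\<bar> \<le> 2 * C' / m"
      by (simp add: abs_le_iff)
    then show ?thesis
      using m(1) by (simp add: m_def field_simps)
  qed
  have "log_Holder (max (b * ln (exp 1 + 2) + 3 * C) (2 * C')) f"
    unfolding log_Holder_def using 1 2 by (auto simp: le_max_iff_disj)
  then show ?thesis
    by blast
qed

text \<open>The limit value is recovered along the ray through a basis vector, where the two-point
  estimate gives a Cauchy sequence. Letting the second point tend to infinity along the ray turns
  the minimum of the norms into \<open>norm x\<close>.\<close>

lemma log_Holder_imp_LH: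
  fixes f :: "'a::euclidean_space \<Rightarrow> real"
  assumes LH: "log_Holder L f"
  shows "(\<lambda>x. ereal (f x)) \<in> LH"
proof -
  define C where "C = max L 1"
  have C: "0 < C" "L \<le> C"
    by (auto simp: C_def)
  have e: "1 < exp (1::real)"
    by simp
  have pos: "0 < ln (exp 1 + t)" if "0 \<le> t" for t :: real
    using that by (rule ln_exp_1_add_pos)
  have H: "\<bar>f x - f y\<bar> \<le> C / ln (exp 1 + 1 / norm (x - y))"
    "\<bar>f x - f y\<bar> \<le> C / ln (exp 1 + min (norm x) (norm y))" for x y
    using LH C pos[of "1 / norm (x - y)"] pos[of "min (norm x) (norm y)"]
    unfolding log_Holder_def by (auto simp: le_divide_eq intro: order_trans)
  have "(\<lambda>x. ereal (f x)) \<in> LH0"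
    unfolding LH0_def
  proof (intro CollectI exI[of _ C] conjI allI impI C)
    fix x y :: 'a assume n: "norm (x - y) < 1/2"
    show "\<bar>ereal (f x) - ereal (f y)\<bar> \<le> ereal (C / (- ln (norm (x - y))))"
    proof (cases "x = y")
      case False
      define n where "n = norm (x - y)"
      have n': "0 < n" "n < 1/2"
        using n False by (auto simp: n_def)
      have "- ln n = ln (1 / n)"
        using n' by (simp add: ln_div)
      also have "\<dots> \<le> ln (exp 1 + 1 / n)"
        using n' by (intro ln_mono) auto
      finally have "- ln n \<le> ln (exp 1 + 1 / n)" .
      moreover have "0 < - ln n"
        using n' by simp
      ultimately have "C / ln (exp 1 + 1 / n) \<le> C / (- ln n)"
        using C by (intro divide_left_mono mult_pos_pos) auto
      then show ?thesis
        using H(1)[of x y] by (simp add: n_def)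
    qed simp
  qed
  moreover have "(\<lambda>x. ereal (f x)) \<in> LH_infinity"
  proof -
    obtain i :: 'a where i: "i \<in> Basis"
      using nonempty_Basis by blast
    define g where "g n = f (real n *\<^sub>R i)" for n
    have norm_g: "norm (real n *\<^sub>R i) = real n" for n
      using i by simp
    have "Cauchy g"
      unfolding Cauchy_def
    proof (intro allI impI)
      fix r :: real assume r: "0 < r"
      obtain M :: nat where M: "exp (C / r) < M"
        using reals_Archimedean2 by blast
      show "\<exists>M. \<forall>m\<ge>M. \<forall>n\<ge>M. dist (g m) (g n) < r"
      proof (intro exI[of _ M] allI impI)
        fix m n assume mn: "M \<le> m" "M \<le> n"
        define t where "t = real (min m n)"
        have t: "exp (C / r) < exp 1 + t" "0 \<le> t"
          using M mn by (auto simp: t_def intro: add_strict_increasing2)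
        then have "C / r < ln (exp 1 + t)"
          by (metis exp_ln exp_less_cancel_iff exp_gt_zero less_trans)
        then have "C / ln (exp 1 + t) < r"
          using r pos[OF t(2)] by (simp add: field_simps)
        then show "dist (g m) (g n) < r"
          using H(2)[of "real m *\<^sub>R i" "real n *\<^sub>R i"] unfolding norm_g
          by (simp add: g_def t_def dist_real_def of_nat_min)
      qed
    qed
    then obtain p\<^sub>i where lim: "g \<longlonglongrightarrow> p\<^sub>i"
      using Cauchy_convergent_iff convergent_def by blast
    have "\<bar>f x - p\<^sub>i\<bar> \<le> C / ln (exp 1 + norm x)" for x
    proof (rule tendsto_upperbound)
      show "(\<lambda>n. \<bar>f x - g n\<bar>) \<longlonglongrightarrow> \<bar>f x - p\<^sub>i\<bar>"
        by (intro tendsto_intros lim)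
      obtain M :: nat where M: "norm x < M"
        using reals_Archimedean2 by blast
      show "\<forall>\<^sub>F n in sequentially. \<bar>f x - g n\<bar> \<le> C / ln (exp 1 + norm x)"
        using eventually_ge_at_top[of M]
      proof eventually_elim
        case (elim n)
        then have "min (norm x) (norm (real n *\<^sub>R i)) = norm x"
          using M unfolding norm_g by simp
        then show ?case
          using H(2)[of x "real n *\<^sub>R i"] by (simp add: g_def)
      qed
    qed simp
    then show ?thesis
      unfolding LH_infinity_def
      by (intro CollectI exI[of _ p\<^sub>i] exI[of _ C] conjI allI C) simp
  qed
  ultimately show ?thesis
    by (simp add: LH_def)
qed

lemma AE_le_imp_le:
  fixes f g :: "'a::euclidean_space \<Rightarrow> real"
  assumes "continuous_on UNIV f" "continuous_on UNIV g" "AE x in lebesgue. f x \<le> g x"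
  shows "f x \<le> g x"
proof -
  have "open {x. g x < f x}"
    using assms(1,2) by (intro open_Collect_less) auto
  moreover have "{x. g x < f x} \<in> null_sets lebesgue"
  proof (subst AE_iff_null_sets)
    show "{x. g x < f x} \<in> sets lebesgue"
      using \<open>open {x. g x < f x}\<close> by auto
    show "AE x in lebesgue. x \<notin> {x. g x < f x}"
      using assms(3) by eventually_elim auto
  qed
  ultimately have "{x. g x < f x} = {}"
    using open_not_negligible negligible_iff_null_sets by blast
  then show ?thesis
    by (auto simp: not_less[symmetric])
qed

text \<open>
  Exponents in the class are continuous, so the essential bounds hold everywhere. They are
  expressed through \<open>1 / p\<close>, which also covers \<open>s = \<infinity>\<close>.
\<close>

lemma exponent_class_iff:
  fixes p :: "'a::euclidean_space \<Rightarrow> ereal"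
  assumes rs: "1 \<le> r" "r < s"
  shows "p \<in> exponent_class r s \<longleftrightarrow> (\<exists>f L \<eta>. p = (\<lambda>x. ereal (f x)) \<and> log_Holder L f \<and> 0 < \<eta> \<and>
    (\<forall>x. 1 \<le> f x \<and> real_of_ereal (1 / s) + \<eta> \<le> 1 / f x \<and> 1 / f x \<le> real_of_ereal (1 / r) - \<eta>))"
    (is "_ \<longleftrightarrow> ?R")
proof
  obtain r' where r': "r = ereal r'" "1 \<le> r'"
    using rs by (cases r) auto
  have ir: "real_of_ereal (1 / r) = 1 / r'"
    using r' by (simp add: one_ereal_def)
  have s_cases: "s = \<infinity> \<and> real_of_ereal (1 / s) = 0 \<or>
      (\<exists>s'. s = ereal s' \<and> r' < s' \<and> real_of_ereal (1 / s) = 1 / s')"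
    using rs r' by (cases s) (auto simp: one_ereal_def)
  {
    assume p: "p \<in> exponent_class r s"
    define f where "f x = real_of_ereal (p x)" for x
    have LH: "p \<in> LH" "\<And>x. 1 \<le> p x"
      using p by (auto simp: exponent_class_def var_exponents_def)
    have fin: "p = (\<lambda>x. ereal (f x))"
    proof
      fix x
      obtain p\<^sub>i C where "\<bar>p x - ereal p\<^sub>i\<bar> \<le> ereal C"
        using LH(1) unfolding LH_def LH_infinity_def by blast
      then show "p x = ereal (f x)"
        using LH(2)[of x] by (cases "p x") (auto simp: f_def)
    qed
    have f1: "1 \<le> f x" for x
      using LH(2)[of x] unfolding fin by simp
    obtain b where b: "esssup lebesgue p < ereal b" "ereal b < s"
    proof -
      have "esssup lebesgue p < s"
        using p by (simp add: exponent_class_def)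
      moreover have "esssup lebesgue p \<noteq> - \<infinity>"
      proof
        assume "esssup lebesgue p = - \<infinity>"
        then have "AE x in (lebesgue :: 'a measure). (1::real) \<le> 0"
          using esssup_AE[where f = p and M = lebesgue] unfolding fin by simp
        then show False
          using AE_le_imp_le[of "\<lambda>_::'a. 1" "\<lambda>_. 0"] by simp
      qed
      ultimately show thesis
        using that ereal_dense2[of "esssup lebesgue p" s] by blast
    qed
    obtain a where a: "r < ereal a" "AE x in lebesgue. ereal a \<le> p x"
    proof -
      have "r < Sup {z. AE x in lebesgue. z \<le> p x}"
        using p by (simp add: exponent_class_def essinf_def)
      then obtain z where z: "r < z" "AE x in lebesgue. z \<le> p x"
        by (auto simp: less_Sup_iff)
      obtain a where "r < ereal a" "ereal a < z"
        using ereal_dense2[OF z(1)] by blast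
      moreover have "AE x in lebesgue. ereal a \<le> p x"
        using z(2) by eventually_elim (use \<open>ereal a < z\<close> in \<open>meson less_imp_le less_le_trans\<close>)
      ultimately show thesis
        using that by blast
    qed
    obtain L where L: "log_Holder L f"
      using LH_imp_log_Holder[of f] LH(1) f1 order_trans[OF zero_le_one] unfolding fin by blast
    then have cont: "continuous_on UNIV f"
      by (rule log_Holder_continuous)
    have fa: "a \<le> f x" for x
      using a(2) unfolding fin by (intro AE_le_imp_le[OF continuous_on_const cont]) simp
    have "AE x in lebesgue. f x \<le> b"
      using esssup_AE[where f = p and M = lebesgue]
    proof eventually_elim
      case (elim x)
      then show ?case
        using b(1) unfolding fin by (metis ereal_less_eq(3) less_imp_le order_trans)
    qed
    then have fb: "f x \<le> b" for x
      by (intro AE_le_imp_le[OF cont continuous_on_const])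
    have a': "r' < a" "0 < a" "0 < b"
      using a(1) r' f1[of 0] fb[of 0] by auto
    have b': "real_of_ereal (1 / s) < 1 / b"
      using s_cases b(2) a' by (auto simp: frac_less2)
    define \<eta> where "\<eta> = min (1 / b - real_of_ereal (1 / s)) (1 / r' - 1 / a)"
    have "1 / a < 1 / r'"
      using a' r' by (intro divide_strict_left_mono) auto
    then have "0 < \<eta>"
      using b' by (simp add: \<eta>_def)
    moreover have "real_of_ereal (1 / s) + \<eta> \<le> 1 / f x \<and> 1 / f x \<le> real_of_ereal (1 / r) - \<eta>" for x
    proof -
      have "1 / b \<le> 1 / f x" "1 / f x \<le> 1 / a"
        using fa[of x] fb[of x] f1[of x] a' by (auto intro!: divide_left_mono)
      moreover have "\<eta> \<le> 1 / b - real_of_ereal (1 / s)" "\<eta> \<le> 1 / r' - 1 / a"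
        by (simp_all add: \<eta>_def)
      ultimately show ?thesis
        unfolding ir by linarith
    qed
    ultimately show ?R
      using fin L f1 by blast
  next
    assume ?R
    then obtain f L \<eta> where f: "p = (\<lambda>x. ereal (f x))" "log_Holder L f" "0 < \<eta>" "\<And>x. 1 \<le> f x"
      "\<And>x. real_of_ereal (1 / s) + \<eta> \<le> 1 / f x" "\<And>x. 1 / f x \<le> real_of_ereal (1 / r) - \<eta>"
      by blast
    have cont: "continuous_on UNIV f"
      by (rule log_Holder_continuous[OF f(2)])
    have meas: "p \<in> borel_measurable lebesgue"
      unfolding f(1) using borel_measurable_continuous_onI[OF cont]
      by (intro borel_measurable_ereal measurable_completion) simp
    define a b where "a = 1 / (1 / r' - \<eta>)" and "b = 1 / (real_of_ereal (1 / s) + \<eta>)"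
    have fpos: "0 < f x" for x
      using f(4)[of x] by simp
    have "0 < 1 / f 0"
      using fpos by simp
    then have ar: "0 < 1 / r' - \<eta>"
      using f(6)[of 0] unfolding ir by linarith
    have "1 / (1 / r') < a"
      unfolding a_def using ar f(3) r' by (intro divide_strict_left_mono) auto
    then have ra: "r < ereal a"
      using r' by simp
    have sp: "0 \<le> real_of_ereal (1 / s)"
      using s_cases r' by auto
    have bs: "ereal b < s"
      using s_cases
    proof (elim disjE exE conjE)
      fix s' assume s': "s = ereal s'" "r' < s'" "real_of_ereal (1 / s) = 1 / s'"
      have "b < 1 / (1 / s')"
        unfolding b_def s'(3) using s' r' f(3)
        by (intro divide_strict_left_mono mult_pos_pos add_pos_pos) auto
      then show ?thesis
        using s' by simp
    qed simp
    have fa: "a \<le> f x" for x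
      using f(6)[of x] ar fpos[of x] unfolding ir a_def by (simp add: field_simps)
    have fb: "f x \<le> b" for x
      using f(5)[of x] sp f(3) fpos[of x] unfolding b_def by (simp add: field_simps)
    have "ereal a \<le> essinf lebesgue p"
      unfolding essinf_def f(1) using fa by (intro Sup_upper) simp
    moreover have "esssup lebesgue p \<le> ereal b"
      using fb meas unfolding f(1) by (intro esssup_I) auto
    ultimately show "p \<in> exponent_class r s"
      using ra bs meas f(4) log_Holder_imp_LH[OF f(2)]
      unfolding exponent_class_def var_exponents_def f(1)
      by (auto simp: one_ereal_def intro: less_le_trans le_less_trans)
  }
qed

section \<open>The variable Lebesgue norm\<close>

text \<open>For a finite exponent the essential supremum is taken over the empty set, where it is
  the bottom element 0.\<close>

lemma modular_real_exponent:
  "modular (\<lambda>x. ereal (v x)) f = (\<integral>\<^sup>+x. ennreal (\<bar>f x\<bar> powr v x) \<partial>lebesgue)"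
proof -
  have "ae_filter (restrict_space lebesgue {}) = (bot :: 'a filter)"
    by (simp add: ae_filter_eq_bot_iff space_restrict_space)
  moreover have "(\<lambda>x. ennreal \<bar>f x\<bar>) \<in> borel_measurable (restrict_space lebesgue {})"
    by (auto simp: measurable_def space_restrict_space sets_restrict_space)
  ultimately have "esssup (restrict_space lebesgue {}) (\<lambda>x. ennreal \<bar>f x\<bar>) = 0"
    by (simp add: esssup_def bot_ennreal)
  then show ?thesis
    by (simp add: modular_def)
qed

lemma var_norm_AE_cong:
  assumes "AE x in lebesgue. f x = g x"
  shows "var_norm (\<lambda>x. ereal (v x)) f = var_norm (\<lambda>x. ereal (v x)) g"
proof -
  have "modular (\<lambda>x. ereal (v x)) (\<lambda>x. f x / l) = modular (\<lambda>x. ereal (v x)) (\<lambda>x. g x / l)" for l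
    unfolding modular_real_exponent
    by (rule nn_integral_cong_AE) (use assms in eventually_elim, simp)
  then show ?thesis
    by (simp add: var_norm_def)
qed

lemma var_norm_le:
  assumes "0 < l" "modular p (\<lambda>x. f x / l) \<le> 1"
  shows "var_norm p f \<le> ennreal l"
  unfolding var_norm_def using assms by (intro Inf_lower) auto

text \<open>
  For a bounded exponent the modular is continuous under scaling, hence equals \<open>1\<close> at the norm.
\<close>

lemma var_norm_attained:
  fixes W v :: "'a::euclidean_space \<Rightarrow> real"
  assumes [measurable]: "W \<in> borel_measurable lebesgue" "v \<in> borel_measurable lebesgue"
    and Q: "Q \<in> sets lebesgue" "emeasure lebesgue Q \<noteq> 0"
    and W: "\<And>x. 0 < W x" and v: "\<And>x. 1 \<le> v x" "\<And>x. v x \<le> vmax"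
    and fin: "var_norm (\<lambda>x. ereal (v x)) (\<lambda>x. W x * indicator Q x) < \<infinity>"
  obtains n where "0 < n" "var_norm (\<lambda>x. ereal (v x)) (\<lambda>x. W x * indicator Q x) = ennreal n"
    "(\<integral>\<^sup>+x. ennreal (indicator Q x * (W x / n) powr v x) \<partial>lebesgue) = 1"
proof -
  note Q(1)[measurable]
  define M where "M l = (\<integral>\<^sup>+x. ennreal (indicator Q x * (W x / l) powr v x) \<partial>lebesgue)" for l
  have mod: "modular (\<lambda>x. ereal (v x)) (\<lambda>x. W x * indicator Q x / l) = M l" if "0 < l" for l
    unfolding modular_real_exponent M_def
    using W that by (intro nn_integral_cong) (auto simp: indicator_def less_imp_le)
  define S where "S = {l. 0 < l \<and> M l \<le> 1}"
  have norm_eq: "var_norm (\<lambda>x. ereal (v x)) (\<lambda>x. W x * indicator Q x) = Inf (ennreal ` S)"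
    unfolding var_norm_def S_def using mod by (intro arg_cong[where f = Inf]) auto
  have vmax: "1 \<le> vmax"
    using v order_trans by blast
  have scale: "M l \<le> ennreal c * M n"
    if "0 < l" "0 < n" "0 \<le> c" "\<And>x. (n / l) powr v x \<le> c" for l n c
  proof -
    have "M l \<le> (\<integral>\<^sup>+x. ennreal c * ennreal (indicator Q x * (W x / n) powr v x) \<partial>lebesgue)"
      unfolding M_def
    proof (rule nn_integral_mono)
      fix x
      have "W x / l = (n / l) * (W x / n)"
        using that by simp
      then have "(W x / l) powr v x = (n / l) powr v x * (W x / n) powr v x"
        by (metis powr_mult)
      then have "(W x / l) powr v x \<le> c * (W x / n) powr v x"
        using that by (simp add: mult_right_mono)
      then have "indicator Q x * (W x / l) powr v x \<le> c * (indicator Q x * (W x / n) powr v x)"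
        by (simp add: indicator_def)
      then show "ennreal (indicator Q x * (W x / l) powr v x)
          \<le> ennreal c * ennreal (indicator Q x * (W x / n) powr v x)"
        using that by (simp add: ennreal_leI flip: ennreal_mult)
    qed
    also have "\<dots> = ennreal c * M n"
      unfolding M_def by (rule nn_integral_cmult) measurable
    finally show ?thesis .
  qed
  have Mpos: "M 1 \<noteq> 0"
  proof
    assume "M 1 = 0"
    then have "AE x in lebesgue. ennreal (indicator Q x * (W x / 1) powr v x) = 0"
      unfolding M_def by (subst (asm) nn_integral_0_iff_AE) auto
    then have "AE x in lebesgue. x \<notin> Q"
    proof eventually_elim
      case (elim x)
      then show ?case
        using W[of x] by (auto simp: indicator_def split: if_splits)
    qed
    then show False
      using Q by (simp add: AE_iff_measurable[OF Q(1)])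
  qed
  have "S \<noteq> {}"
    using fin unfolding norm_eq by (auto simp: top_ennreal.rep_eq)
  define n where "n = Inf S"
  have bdd: "bdd_below S"
    by (auto simp: S_def bdd_below_def intro!: exI[of _ 0] less_imp_le)
  \<comment> \<open>A positive lower bound for \<open>S\<close>, so that the infimum is positive:
    for \<open>l \<le> 1\<close> in \<open>S\<close>, scaling with \<open>v \<ge> 1\<close> gives
    \<open>M 1 \<le> l * M l \<le> l\<close>.\<close>
  obtain m where m: "0 < m" "m \<le> 1" "ennreal m \<le> M 1"
  proof (cases "M 1")
    case (real r)
    then show thesis
      using that[of "min r 1"] Mpos by (auto simp: ennreal_leI)
  next
    case top
    then show thesis
      using that[of 1] by simp
  qed
  have "m \<le> l" if l: "l \<in> S" for l
  proof (cases "l \<le> 1")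
    case True
    have "M 1 \<le> ennreal l * M l"
    proof (rule scale)
      fix x
      show "(l / 1) powr v x \<le> l"
        using True l v(1)[of x] powr_mono'[of 1 "v x" l] by (simp add: S_def)
    qed (use l in \<open>auto simp: S_def\<close>)
    also have "\<dots> \<le> ennreal l * 1"
      using l by (intro mult_left_mono) (auto simp: S_def)
    finally have "ennreal m \<le> ennreal l"
      using m(3) by simp
    then show ?thesis
      using l by (simp add: S_def)
  qed (use m in simp)
  then have n: "0 < n"
    using cInf_greatest[OF \<open>S \<noteq> {}\<close>] m(1) unfolding n_def by (meson less_le_trans)
  \<comment> \<open>As \<open>v \<le> vmax\<close>, shrinking the scale by at most the factor
    \<open>t powr (1 / vmax)\<close> multiplies the modular by at most \<open>t\<close>. Applied to
    members of \<open>S\<close> just above \<open>n\<close> it yields \<open>M n \<le> 1\<close>;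
    applied to a scale just below \<open>n\<close> it yields \<open>1 \<le> M n\<close>.\<close>
  have scale': "M l \<le> ennreal t * M k" if "0 < l" "l \<le> k" "k \<le> l * t powr (1 / vmax)" "0 < t" for l k t
  proof (rule scale)
    fix x
    have "(k / l) powr v x \<le> (k / l) powr vmax"
      using that v by (intro powr_mono) auto
    also have "\<dots> \<le> (t powr (1 / vmax)) powr vmax"
      using that vmax by (intro powr_mono2) (auto simp: divide_le_eq mult.commute)
    also have "\<dots> = t"
      using that vmax by (simp add: powr_powr)
    finally show "(k / l) powr v x \<le> t" .
  qed (use that in auto)
  have M_le: "M n \<le> 1"
  proof (rule ccontr)
    assume "\<not> M n \<le> 1"
    then obtain z where z: "1 < z" "z < M n"
      by (meson dense linorder_not_le)
    obtain t where t: "1 < t" "ennreal t < M n"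
    proof (cases z)
      case (real t)
      then show thesis
        using that[of t] z by (simp add: ennreal_less_iff flip: ennreal_1)
    qed (use z in simp)
    then have "1 powr (1 / vmax) < t powr (1 / vmax)"
      using vmax by (intro powr_less_mono2) auto
    then have "n < n * t powr (1 / vmax)"
      using n by simp
    then obtain k where k: "k \<in> S" "k < n * t powr (1 / vmax)"
      using cInf_lessD[OF \<open>S \<noteq> {}\<close>] unfolding n_def by blast
    have "n \<le> k"
      using cInf_lower[OF k(1) bdd] by (simp add: n_def)
    then have "M n \<le> ennreal t * M k"
      using k n t by (intro scale') auto
    also have "\<dots> \<le> ennreal t * 1"
      using k by (intro mult_left_mono) (auto simp: S_def)
    finally show False
      using t by simp
  qed
  have M_ge: "1 \<le> M n"
  proof (rule ccontr)
    assume "\<not> 1 \<le> M n"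
    obtain t where t: "0 < t" "t < 1" "M n \<le> ennreal t"
    proof (cases "M n")
      case (real r)
      then have "r < 1"
        using \<open>\<not> 1 \<le> M n\<close> by (simp add: not_le ennreal_less_iff flip: ennreal_1)
      then show thesis
        using that[of "max r (1 / 2)"] real by (auto simp: ennreal_leI)
    qed (use \<open>\<not> 1 \<le> M n\<close> in simp)
    define l where "l = n / (1 / t) powr (1 / vmax)"
    have "1 powr (1 / vmax) < (1 / t) powr (1 / vmax)"
      using vmax t by (intro powr_less_mono2) auto
    then have l: "0 < l" "l < n" "n = l * (1 / t) powr (1 / vmax)"
      using n by (auto simp: l_def divide_less_eq intro!: divide_pos_pos)
    have "M l \<le> ennreal (1 / t) * M n"
      using l t by (intro scale') auto
    also have "\<dots> \<le> ennreal (1 / t) * ennreal t"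
      by (intro mult_left_mono t) auto
    also have "\<dots> = 1"
      using t by (simp flip: ennreal_mult)
    finally have "l \<in> S"
      using l by (simp add: S_def)
    then show False
      using cInf_lower[OF _ bdd, of l] l by (simp add: n_def)
  qed
  show thesis
  proof (rule that[OF n])
    show "(\<integral>\<^sup>+x. ennreal (indicator Q x * (W x / n) powr v x) \<partial>lebesgue) = 1"
      using M_le M_ge by (simp add: M_def)
    show "var_norm (\<lambda>x. ereal (v x)) (\<lambda>x. W x * indicator Q x) = ennreal n"
      unfolding norm_eq
    proof (rule antisym)
      show "Inf (ennreal ` S) \<le> ennreal n"
        using n M_le by (intro Inf_lower) (auto simp: S_def)
      show "ennreal n \<le> Inf (ennreal ` S)"
        using cInf_lower[OF _ bdd] by (intro Inf_greatest) (auto simp: n_def intro!: ennreal_leI)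
    qed
  qed
qed

section \<open>Interpolation of weights\<close>

text \<open>The parameter \<open>\<alpha>\<close> is the reciprocal of the exponent. The reciprocals
  in question are affine in \<open>1 / p\<close>, the quantity in which interpolation is
  linear.\<close>

abbreviation exponent_integral ::
  "('a::euclidean_space \<Rightarrow> real) \<Rightarrow> ('a \<Rightarrow> real) \<Rightarrow> real \<Rightarrow> 'a set \<Rightarrow> ennreal" where
  "exponent_integral \<alpha> f l Q \<equiv> \<integral>\<^sup>+x. ennreal (indicator Q x * (f x / l) powr (1 / \<alpha> x)) \<partial>lebesgue"

abbreviation higher_integral ::
  "real \<Rightarrow> ('a::euclidean_space \<Rightarrow> real) \<Rightarrow> ('a \<Rightarrow> real) \<Rightarrow> real \<Rightarrow> 'a set \<Rightarrow> ennreal" where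
  "higher_integral \<epsilon> \<alpha> f l Q \<equiv>
    \<integral>\<^sup>+x. ennreal (indicator Q x * ((f x / l) powr (1 / \<alpha> x)
      * (measure lebesgue Q * (f x / l) powr (1 / \<alpha> x)) powr \<epsilon>)) \<partial>lebesgue"

definition weight_norms :: "('a::euclidean_space \<Rightarrow> real) \<Rightarrow> ('a \<Rightarrow> real) \<Rightarrow> real \<Rightarrow> ('a \<Rightarrow> real)
    \<Rightarrow> ('a set \<Rightarrow> real) \<Rightarrow> ('a set \<Rightarrow> real) \<Rightarrow> real \<Rightarrow> bool" where
  "weight_norms \<alpha> \<beta> \<delta> w lam sig C \<longleftrightarrow>
     w \<in> borel_measurable lebesgue \<and> (\<forall>x. 0 < w x) \<and> 1 \<le> C \<and>
     (\<forall>Q\<in>cubes. 0 < lam Q \<and> 0 < sig Q \<and> lam Q * sig Q \<le> C * measure lebesgue Q powr \<delta> \<and>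
       exponent_integral \<alpha> w (lam Q) Q = 1 \<and>
       exponent_integral \<beta> (\<lambda>x. inverse (w x)) (sig Q) Q = 1)"

text \<open>This symmetry yields the estimate for \<open>1 / w_0\<close> from the one for
  \<open>w_0\<close>.\<close>

lemma weight_norms_swap:
  "weight_norms \<alpha> \<beta> \<delta> w lam sig C \<Longrightarrow> weight_norms \<beta> \<alpha> \<delta> (\<lambda>x. inverse (w x)) sig lam C"
  by (auto simp: weight_norms_def mult.commute)

text \<open>The reciprocal exponents sum to \<open>\<delta>\<close> rather than 1. Taking the power
  \<open>1 / \<delta>\<close> of weight and norms makes \<open>\<delta> / \<alpha>\<close> and
  \<open>\<delta> / \<beta>\<close> conjugate and the bound linear in the volume; the margin
  \<open>\<eta>\<close> bounds the exponent by \<open>\<delta> / \<eta>\<close>.\<close>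

lemma reverse_Holder_weight_norms:
  fixes w :: "'a::euclidean_space \<Rightarrow> real"
  assumes w: "weight_norms \<alpha> \<beta> \<delta> w lam sig C"
    and \<eta>: "0 < \<eta>" "\<And>x. \<eta> \<le> \<alpha> x" "\<And>x. \<eta> \<le> \<beta> x" and sum: "\<And>x. \<alpha> x + \<beta> x = \<delta>"
    and LH: "log_Holder L \<alpha>"
  obtains \<epsilon> B where "0 < \<epsilon>" "0 \<le> B" "\<And>Q. Q \<in> cubes \<Longrightarrow>
    higher_integral \<epsilon> \<alpha> w (lam Q) Q \<le> ennreal B"
proof -
  have pos: "0 < \<alpha> x" "0 < \<beta> x" "\<alpha> x \<le> \<delta>" "\<beta> x \<le> \<delta>" for x
    using \<eta>(1) \<eta>(2,3)[of x] sum[of x] by linarith+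
  have \<delta>: "0 < \<delta>"
    using pos(1,3) by (rule less_le_trans)
  have w': "w \<in> borel_measurable lebesgue" "\<And>x. 0 < w x" "1 \<le> C"
    "\<And>Q. Q \<in> cubes \<Longrightarrow> 0 < lam Q" "\<And>Q. Q \<in> cubes \<Longrightarrow> 0 < sig Q"
    "\<And>Q. Q \<in> cubes \<Longrightarrow> lam Q * sig Q \<le> C * measure lebesgue Q powr \<delta>"
    "\<And>Q. Q \<in> cubes \<Longrightarrow> exponent_integral \<alpha> w (lam Q) Q = 1"
    "\<And>Q. Q \<in> cubes \<Longrightarrow>
      exponent_integral \<beta> (\<lambda>x. inverse (w x)) (sig Q) Q = 1"
    using w unfolding weight_norms_def by blast+
  note w'(1)[measurable]
  have cont: "continuous_on UNIV \<alpha>"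
    by (rule log_Holder_continuous[OF LH])
  have \<alpha>[measurable]: "\<alpha> \<in> borel_measurable lebesgue"
    using borel_measurable_continuous_onI[OF cont] by (intro measurable_completion) simp
  have "\<beta> = (\<lambda>x. \<delta> - \<alpha> x)"
    using sum by (auto simp: fun_eq_iff algebra_simps)
  then have \<beta>[measurable]: "\<beta> \<in> borel_measurable lebesgue"
    by simp
  have root: "(t powr (1 / \<delta>) / u powr (1 / \<delta>)) powr (\<delta> / e) = (t / u) powr (1 / e)"
    if "0 < t" "0 < u" for t u e :: real
    using that \<delta> by (simp add: powr_powr flip: powr_divide)
  have LH': "log_Holder (\<delta> * (L / \<eta>\<^sup>2) + 0 * L) (\<lambda>x. \<delta> / \<alpha> x)"
  proof (rule log_Holder_transport[OF log_Holder_inverse[OF LH \<eta>(2,1)] LH])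
    fix x y
    have "\<delta> / \<alpha> x - \<delta> / \<alpha> y = \<delta> * (1 / \<alpha> x - 1 / \<alpha> y)"
      by (simp add: right_diff_distrib)
    then show "\<bar>\<delta> / \<alpha> x - \<delta> / \<alpha> y\<bar> \<le> \<delta> * \<bar>1 / \<alpha> x - 1 / \<alpha> y\<bar> + 0 * \<bar>\<alpha> x - \<alpha> y\<bar>"
      using \<delta> by (simp add: abs_mult)
  qed (use \<delta> in auto)
  interpret variable_muckenhoupt "\<lambda>x. \<delta> / \<alpha> x" "\<lambda>x. \<delta> / \<beta> x" "\<lambda>x. w x powr (1 / \<delta>)"
    "\<lambda>Q. lam Q powr (1 / \<delta>)" "\<lambda>Q. sig Q powr (1 / \<delta>)" "C powr (1 / \<delta>)" "\<delta> / \<eta>"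
    "\<delta> * (L / \<eta>\<^sup>2) + 0 * L"
  proof unfold_locales
    fix x :: 'a
    show "0 < w x powr (1 / \<delta>)"
      using w'(2)[of x] by simp
    show "1 \<le> \<delta> / \<alpha> x" "1 \<le> \<delta> / \<beta> x"
      using pos[of x] by simp_all
    show "\<delta> / \<alpha> x \<le> \<delta> / \<eta>"
      using \<eta>(1) \<eta>(2)[of x] pos[of x] \<delta> by (intro divide_left_mono) auto
    show "1 / (\<delta> / \<alpha> x) + 1 / (\<delta> / \<beta> x) = 1"
      using pos[of x] sum[of x] \<delta> by (simp add: add_divide_distrib[symmetric])
  next
    fix Q :: "'a set" assume Q: "Q \<in> cubes"
    show "0 < lam Q powr (1 / \<delta>)" "0 < sig Q powr (1 / \<delta>)"
      using w'(4,5)[OF Q] by simp_all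
    show "(\<integral>\<^sup>+x. ennreal (indicator Q x * (w x powr (1 / \<delta>) / lam Q powr (1 / \<delta>)) powr (\<delta> / \<alpha> x)) \<partial>lebesgue) = 1"
      using w'(7)[OF Q] by (simp only: root[OF w'(2) w'(4)[OF Q]])
    have "inverse (w x powr (1 / \<delta>)) = inverse (w x) powr (1 / \<delta>)" for x
      using w'(2)[of x] by (simp add: inverse_powr)
    moreover have "0 < inverse (w x)" for x
      using w'(2)[of x] by simp
    ultimately show "(\<integral>\<^sup>+x. ennreal (indicator Q x * (inverse (w x powr (1 / \<delta>)) / sig Q powr (1 / \<delta>)) powr (\<delta> / \<beta> x)) \<partial>lebesgue) \<le> 1"
      using w'(8)[OF Q] by (simp only: root[OF _ w'(5)[OF Q]] order_refl)
    have "lam Q powr (1 / \<delta>) * sig Q powr (1 / \<delta>) = (lam Q * sig Q) powr (1 / \<delta>)"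
      by (simp add: powr_mult)
    also have "\<dots> \<le> (C * measure lebesgue Q powr \<delta>) powr (1 / \<delta>)"
      using w'(4-6)[OF Q] \<delta> by (intro powr_mono2) auto
    also have "\<dots> = C powr (1 / \<delta>) * measure lebesgue Q"
      using \<delta> measure_cubes_pos[OF Q] by (simp add: powr_mult powr_powr)
    finally show "lam Q powr (1 / \<delta>) * sig Q powr (1 / \<delta>) \<le> C powr (1 / \<delta>) * measure lebesgue Q" .
  next
    show "1 \<le> C powr (1 / \<delta>)"
      using w'(3) \<delta> by (intro ge_one_powr_ge_zero) auto
    show "log_Holder (\<delta> * (L / \<eta>\<^sup>2) + 0 * L) (\<lambda>x. \<delta> / \<alpha> x)"
      by (rule LH')
  qed measurable
  obtain \<epsilon> B where \<epsilon>: "0 < \<epsilon>" "0 \<le> B" "\<And>Q. Q \<in> cubes \<Longrightarrow> R \<epsilon> Q \<le> ennreal B"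
    using reverse_Holder by blast
  show thesis
  proof (rule that[OF \<epsilon>(1,2)])
    fix Q :: "'a set" assume Q: "Q \<in> cubes"
    have "V Q x = indicator Q x * (w x / lam Q) powr (1 / \<alpha> x)" for x
      unfolding V_def by (simp only: root[OF w'(2) w'(4)[OF Q]])
    then have "higher_integral \<epsilon> \<alpha> w (lam Q) Q = R \<epsilon> Q"
      unfolding R_def by (intro nn_integral_cong) (simp add: indicator_def)
    then show "higher_integral \<epsilon> \<alpha> w (lam Q) Q \<le> ennreal B"
      using \<epsilon>(3)[OF Q] by simp
  qed
qed

text \<open>Hoelder's inequality at the level of integrands. With
  \<open>c = a - \<theta> * \<delta>\<close> and \<open>e = \<theta> * \<delta> / c\<close> one has
  \<open>1 / c = (1 + e) / a\<close>, and the power of \<open>m\<close> is chosen to combine with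
  the excess into \<open>(m * X powr (1 / a)) powr e\<close>, the form of the reverse Hoelder
  integrand.\<close>

lemma interpolation_pointwise:
  fixes X Y m \<theta> \<delta> a b a\<^sub>0 \<epsilon> :: real
  assumes pos: "0 < X" "0 < Y" "0 < m" and \<theta>: "0 < \<theta>" "\<theta> < 1"
    and a: "0 < a" "0 < a - \<theta> * \<delta>" "0 < \<delta>" and b: "0 < b"
    and a\<^sub>0: "a\<^sub>0 = ((a - \<theta> * \<delta>) + \<theta> * b) / (1 - \<theta>)"
    and \<epsilon>: "\<theta> * \<delta> / (a - \<theta> * \<delta>) \<le> \<epsilon>"
  shows "(X powr (1 / (1 - \<theta>)) * Y powr (\<theta> / (1 - \<theta>)) * m powr (\<theta> * \<delta> / (1 - \<theta>))) powr (1 / a\<^sub>0)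
    \<le> X powr (1 / a) + X powr (1 / a) * (m * X powr (1 / a)) powr \<epsilon> + Y powr (1 / b)"
proof -
  define c where "c = a - \<theta> * \<delta>"
  define t where "t = 1 / (c + \<theta> * b)"
  define e where "e = \<theta> * \<delta> / c"
  have c: "0 < c" "0 < c + \<theta> * b" "0 < t"
    using a b \<theta> by (auto simp: c_def t_def intro!: add_pos_pos divide_pos_pos)
  have t: "1 / (1 - \<theta>) * (1 / a\<^sub>0) = t"
    using \<theta> c by (simp add: a\<^sub>0 t_def flip: c_def)
  have t': "u / (1 - \<theta>) * (1 / a\<^sub>0) = u * t" for u
    using t by (simp add: mult.assoc flip: t)
  have e: "0 \<le> e" "e \<le> \<epsilon>"
    using \<epsilon> \<theta> a by (simp_all add: e_def c_def)
  \<comment> \<open>The conjugate exponents are dictated by the shares of \<open>c\<close> and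
    \<open>\<theta> * b\<close> in their sum \<open>1 / t\<close>.\<close>
  define x y p q where "x = X powr t * m powr (\<theta> * \<delta> * t)" and "y = Y powr (\<theta> * t)"
    and "p = 1 / (t * c)" and "q = 1 / (t * (\<theta> * b))"
  have pq: "0 < p" "0 < q" "1 / p + 1 / q = 1"
    using c \<theta> b by (auto simp: p_def q_def t_def add_divide_distrib[symmetric])
  have "(X powr (1 / (1 - \<theta>)) * Y powr (\<theta> / (1 - \<theta>)) * m powr (\<theta> * \<delta> / (1 - \<theta>))) powr (1 / a\<^sub>0)
      = x * y"
    unfolding x_def y_def by (simp only: powr_mult powr_powr t t') (simp only: mult_1 mult_ac)
  also have "\<dots> \<le> x powr p + y powr q"
    using pq by (intro Young_weak) (auto simp: x_def y_def)
  also have "y powr q = Y powr (1 / b)"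
    using c \<theta> by (simp add: y_def q_def powr_powr)
  also have "x powr p = X powr (1 / c) * m powr e"
    using c by (simp add: x_def p_def powr_powr powr_mult e_def)
  also have "X powr (1 / c) = X powr (1 / a) * (X powr (1 / a)) powr e"
  proof -
    have "1 / c = 1 / a + 1 / a * e"
      using a c by (simp add: e_def c_def field_simps)
    then show ?thesis
      by (simp add: powr_powr powr_add)
  qed
  also have "X powr (1 / a) * (X powr (1 / a)) powr e * m powr e
      = X powr (1 / a) * (m * X powr (1 / a)) powr e"
    by (simp add: powr_mult mult_ac)
  \<comment> \<open>In the application \<open>e\<close> varies with the point; the fixed
    \<open>\<epsilon>\<close> replaces it where the base exceeds 1, and the summand 1 covers the
    rest.\<close>
  also have "(m * X powr (1 / a)) powr e \<le> 1 + (m * X powr (1 / a)) powr \<epsilon>"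
  proof (cases "m * X powr (1 / a) \<le> 1")
    case True
    then have "(m * X powr (1 / a)) powr e \<le> 1"
      using pos e by (intro powr_le1) auto
    then show ?thesis
      by (rule add_increasing2[rotated]) simp
  next
    case False
    then have "(m * X powr (1 / a)) powr e \<le> (m * X powr (1 / a)) powr \<epsilon>"
      using e by (intro powr_mono) auto
    then show ?thesis
      by simp
  qed
  finally show ?thesis
    by (simp add: distrib_left mult_left_mono)
qed

text \<open>At the scale in parentheses the modular is at most \<open>1 + B + 1\<close>, by
  \<open>interpolation_pointwise\<close> and the three integrals. Since
  \<open>1 / \<alpha>\<^sub>0 x \<ge> 1\<close>, enlarging the scale by \<open>B + 2\<close> divides
  the modular by at least \<open>B + 2\<close>.\<close>

lemma var_norm_interpolated_weight:
  fixes w w1 w0 :: "'a::euclidean_space \<Rightarrow> real"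
  assumes w: "weight_norms \<alpha> \<beta> \<delta> w lam sig C" and w1: "weight_norms \<alpha>\<^sub>1 \<beta>\<^sub>1 \<delta> w1 lam\<^sub>1 sig\<^sub>1 C\<^sub>1"
    and meas: "\<alpha> \<in> borel_measurable lebesgue" "\<beta>\<^sub>1 \<in> borel_measurable lebesgue"
    and \<eta>: "0 < \<eta>" "\<And>x. \<eta> \<le> \<alpha> x" and \<beta>\<^sub>1: "\<And>x. 0 < \<beta>\<^sub>1 x" and \<delta>: "0 < \<delta>"
    and \<theta>: "0 < \<theta>" "\<theta> < 1" "\<theta> * \<delta> \<le> \<eta> / 2" "2 * \<theta> * \<delta> / \<eta> \<le> \<epsilon>"
    and Q: "Q \<in> cubes"
    and RH: "0 \<le> B" "higher_integral \<epsilon> \<alpha> w (lam Q) Q \<le> ennreal B"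
    and \<alpha>\<^sub>0: "\<And>x. \<alpha>\<^sub>0 x = ((\<alpha> x - \<theta> * \<delta>) + \<theta> * \<beta>\<^sub>1 x) / (1 - \<theta>)" "\<And>x. \<alpha>\<^sub>0 x \<le> 1"
    and w0: "AE x in lebesgue. w0 x = w x powr (1 / (1 - \<theta>)) * inverse (w1 x) powr (\<theta> / (1 - \<theta>))"
  shows "var_norm (\<lambda>x. ereal (1 / \<alpha>\<^sub>0 x)) (\<lambda>x. w0 x * indicator Q x)
    \<le> ennreal ((B + 2) * (lam Q powr (1 / (1 - \<theta>)) * sig\<^sub>1 Q powr (\<theta> / (1 - \<theta>))
        * measure lebesgue Q powr (- (\<theta> * \<delta> / (1 - \<theta>)))))"
proof -
  note meas[measurable]
  have [measurable]: "w \<in> borel_measurable lebesgue" "w1 \<in> borel_measurable lebesgue" "Q \<in> sets lebesgue"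
    using w w1 cubes_sets[OF Q] by (auto simp: weight_norms_def)
  have wpos: "0 < w x" "0 < w1 x" for x
    using w w1 by (auto simp: weight_norms_def)
  have lpos: "0 < lam Q" "0 < sig\<^sub>1 Q"
    using w w1 Q by (auto simp: weight_norms_def)
  define m where "m = measure lebesgue Q"
  have m: "0 < m"
    using measure_cubes_pos[OF Q] by (simp add: m_def)
  define l\<^sub>0 where "l\<^sub>0 = lam Q powr (1 / (1 - \<theta>)) * sig\<^sub>1 Q powr (\<theta> / (1 - \<theta>)) * m powr (- (\<theta> * \<delta> / (1 - \<theta>)))"
  have l\<^sub>0: "0 < l\<^sub>0"
    using lpos m by (simp add: l\<^sub>0_def)
  have a: "0 < \<alpha> x" "0 < \<alpha> x - \<theta> * \<delta>" "\<eta> / 2 \<le> \<alpha> x - \<theta> * \<delta>" for x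
    using \<eta>(1) \<eta>(2)[of x] \<theta>(3) by linarith+
  have \<epsilon>: "\<theta> * \<delta> / (\<alpha> x - \<theta> * \<delta>) \<le> \<epsilon>" for x
  proof -
    have "\<theta> * \<delta> / (\<alpha> x - \<theta> * \<delta>) \<le> \<theta> * \<delta> / (\<eta> / 2)"
      using a[of x] \<eta>(1) \<theta>(1) \<delta> by (intro divide_left_mono) auto
    also have "\<dots> \<le> \<epsilon>"
      using \<theta>(4) by (simp add: mult_ac)
    finally show ?thesis .
  qed
  have \<alpha>\<^sub>0_pos: "0 < \<alpha>\<^sub>0 x" for x
    unfolding \<alpha>\<^sub>0(1) using a(2)[of x] \<beta>\<^sub>1[of x] \<theta> by (intro divide_pos_pos add_pos_pos) auto
  let ?X = "\<lambda>x. w x / lam Q" and ?Y = "\<lambda>x. inverse (w1 x) / sig\<^sub>1 Q"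
  let ?V = "\<lambda>x. ?X x powr (1 / \<alpha> x)"
  have pw: "ennreal (\<bar>w0 x * indicator Q x / ((B + 2) * l\<^sub>0)\<bar> powr (1 / \<alpha>\<^sub>0 x))
      \<le> ennreal (1 / (B + 2)) * (ennreal (indicator Q x * ?V x)
        + ennreal (indicator Q x * (?V x * (m * ?V x) powr \<epsilon>))
        + ennreal (indicator Q x * ?Y x powr (1 / \<beta>\<^sub>1 x)))"
    if w0x: "w0 x = w x powr (1 / (1 - \<theta>)) * inverse (w1 x) powr (\<theta> / (1 - \<theta>))" for x
  proof (cases "x \<in> Q")
    case True
    define z where "z = ?X x powr (1 / (1 - \<theta>)) * ?Y x powr (\<theta> / (1 - \<theta>)) * m powr (\<theta> * \<delta> / (1 - \<theta>))"
    have XY: "0 < ?X x" "0 < ?Y x"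
      using wpos[of x] lpos by simp_all
    have z: "0 < z"
      unfolding z_def using XY m by (intro mult_pos_pos) (metis powr_gt_zero less_irrefl)+
    have "w0 x / l\<^sub>0 = z"
      using wpos[of x] lpos m
      by (simp add: w0x z_def l\<^sub>0_def powr_divide powr_minus powr_mult field_simps)
    then have "w0 x / ((B + 2) * l\<^sub>0) = z / (B + 2)"
      by (metis divide_divide_eq_left mult.commute)
    then have "\<bar>w0 x * indicator Q x / ((B + 2) * l\<^sub>0)\<bar> powr (1 / \<alpha>\<^sub>0 x) = (z / (B + 2)) powr (1 / \<alpha>\<^sub>0 x)"
      using True z RH(1) by simp
    also have "\<dots> = z powr (1 / \<alpha>\<^sub>0 x) / (B + 2) powr (1 / \<alpha>\<^sub>0 x)"
      by (simp add: powr_divide)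
    also have "\<dots> \<le> z powr (1 / \<alpha>\<^sub>0 x) / (B + 2) powr 1"
      using RH(1) \<alpha>\<^sub>0(2)[of x] \<alpha>\<^sub>0_pos[of x] by (intro divide_left_mono powr_mono) auto
    also have "\<dots> = 1 / (B + 2) * z powr (1 / \<alpha>\<^sub>0 x)"
      using RH(1) by simp
    also have "\<dots> \<le> 1 / (B + 2) * (?V x + ?V x * (m * ?V x) powr \<epsilon> + ?Y x powr (1 / \<beta>\<^sub>1 x))"
      unfolding z_def using RH(1)
      by (intro mult_left_mono interpolation_pointwise XY m \<theta> a \<delta> \<beta>\<^sub>1 \<alpha>\<^sub>0 \<epsilon>) auto
    finally have "ennreal (\<bar>w0 x * indicator Q x / ((B + 2) * l\<^sub>0)\<bar> powr (1 / \<alpha>\<^sub>0 x))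
      \<le> ennreal (1 / (B + 2) * (?V x + ?V x * (m * ?V x) powr \<epsilon> + ?Y x powr (1 / \<beta>\<^sub>1 x)))"
      by (rule ennreal_leI)
    also have "\<dots> = ennreal (1 / (B + 2)) * (ennreal (?V x) + ennreal (?V x * (m * ?V x) powr \<epsilon>)
        + ennreal (?Y x powr (1 / \<beta>\<^sub>1 x)))"
      using RH(1) by (subst ennreal_mult) (auto simp: ennreal_plus)
    finally show ?thesis
      using True by simp
  qed simp
  have i1: "(\<integral>\<^sup>+x. ennreal (indicator Q x * ?V x) \<partial>lebesgue) = 1"
    and i3: "(\<integral>\<^sup>+x. ennreal (indicator Q x * ?Y x powr (1 / \<beta>\<^sub>1 x)) \<partial>lebesgue) = 1"
    using w w1 Q by (auto simp: weight_norms_def)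
  have "modular (\<lambda>x. ereal (1 / \<alpha>\<^sub>0 x)) (\<lambda>x. w0 x * indicator Q x / ((B + 2) * l\<^sub>0))
      \<le> (\<integral>\<^sup>+x. ennreal (1 / (B + 2)) * (ennreal (indicator Q x * ?V x)
        + ennreal (indicator Q x * (?V x * (m * ?V x) powr \<epsilon>))
        + ennreal (indicator Q x * ?Y x powr (1 / \<beta>\<^sub>1 x))) \<partial>lebesgue)"
    unfolding modular_real_exponent by (rule nn_integral_mono_AE) (use w0 in eventually_elim, rule pw)
  also have "\<dots> = ennreal (1 / (B + 2)) * ((\<integral>\<^sup>+x. ennreal (indicator Q x * ?V x) \<partial>lebesgue)
        + (\<integral>\<^sup>+x. ennreal (indicator Q x * (?V x * (m * ?V x) powr \<epsilon>)) \<partial>lebesgue)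
        + (\<integral>\<^sup>+x. ennreal (indicator Q x * ?Y x powr (1 / \<beta>\<^sub>1 x)) \<partial>lebesgue))"
    by (subst nn_integral_cmult, measurable, subst nn_integral_add, measurable, subst nn_integral_add, measurable)
  also have "\<dots> \<le> ennreal (1 / (B + 2)) * (1 + ennreal B + 1)"
    unfolding i1 i3 using RH(2) by (intro mult_left_mono add_mono) (auto simp: m_def)
  also have "1 + ennreal B + 1 = ennreal (B + 2)"
  proof -
    have "B + 2 = (1 + B) + 1"
      by simp
    then show ?thesis
      using RH(1) by (simp only: ennreal_plus ennreal_1 zero_le_one add_nonneg_nonneg)
  qed
  also have "ennreal (1 / (B + 2)) * ennreal (B + 2) = 1"
    using RH(1) by (subst ennreal_mult[symmetric]) auto
  finally have "modular (\<lambda>x. ereal (1 / \<alpha>\<^sub>0 x)) (\<lambda>x. w0 x * indicator Q x / ((B + 2) * l\<^sub>0)) \<le> 1" .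
  then show ?thesis
    using l\<^sub>0 RH(1) unfolding l\<^sub>0_def[unfolded m_def, symmetric] by (intro var_norm_le) auto
qed

section \<open>The exponent and weight classes in terms of reciprocals\<close>

text \<open>
  Relating all exponents to \<open>a = 1 / p\<close>: with \<open>1 / r\<^sub>1 = I\<close> and \<open>1 / s\<^sub>1 = S\<close> one has
  \<open>1 / q = a - \<gamma>\<close>, \<open>1 / r\<^sub>2 = I - \<gamma>\<close> and \<open>1 / s\<^sub>2 = S - \<gamma>\<close>.
\<close>

locale exponent_bounds =
  fixes r1 r2 s1 s2 :: ereal and \<gamma> I S :: real
  assumes r1: "1 \<le> r1" "r1 < s1" and r2: "1 \<le> r2" "r2 < s2"
    and I: "1 / r1 = ereal I" "1 / r2 = ereal (I - \<gamma>)"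
    and S: "1 / s1 = ereal S" "1 / s2 = ereal (S - \<gamma>)"
    and SI: "0 \<le> S" "0 \<le> S - \<gamma>" "S < I" "I \<le> 1" "0 \<le> \<gamma>"
begin

definition admissible :: "('a::euclidean_space \<Rightarrow> real) \<Rightarrow> bool" where
  "admissible a \<longleftrightarrow> (\<exists>L \<eta>. log_Holder L a \<and> 0 < \<eta> \<and> (\<forall>x. S + \<eta> \<le> a x \<and> a x \<le> I - \<eta>))"

lemma admissible_in_exponent_class:
  fixes b :: "'a::euclidean_space \<Rightarrow> real"
  assumes "1 \<le> r" "r < s" "1 / r = ereal I'" "1 / s = ereal S'" "0 \<le> S'" "I' \<le> 1"
    and b: "log_Holder L b" "0 < \<eta>" "\<And>x. S' + \<eta> \<le> b x" "\<And>x. b x \<le> I' - \<eta>"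
  shows "(\<lambda>x. ereal (1 / b x)) \<in> exponent_class r s"
  unfolding exponent_class_iff[OF assms(1,2)]
proof (intro exI conjI allI)
  have pos: "\<eta> \<le> b x" "0 < b x" for x
    using b(2) b(3)[of x] assms(5) by linarith+
  show "(\<lambda>x. ereal (1 / b x)) = (\<lambda>x. ereal (1 / b x))" "0 < \<eta>"
    using b by simp_all
  show "log_Holder (L / \<eta>\<^sup>2) (\<lambda>x. 1 / b x)"
    by (rule log_Holder_inverse[OF b(1) pos(1) b(2)])
  fix x
  show "1 \<le> 1 / b x"
    using pos[of x] b(4)[of x] b(2) assms(6) by (simp add: le_divide_eq)
  show "real_of_ereal (1 / s) + \<eta> \<le> 1 / (1 / b x)" "1 / (1 / b x) \<le> real_of_ereal (1 / r) - \<eta>"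
    using b(3,4)[of x] assms(3,4) by simp_all
qed

lemma exponent_pairs_iff:
  fixes p q :: "'a::euclidean_space \<Rightarrow> ereal"
  shows "(p, q) \<in> exponent_pairs \<gamma> r1 r2 s1 s2 \<longleftrightarrow>
    (\<exists>a. admissible a \<and> p = (\<lambda>x. ereal (1 / a x)) \<and> q = (\<lambda>x. ereal (1 / (a x - \<gamma>))))"
proof
  assume pq: "(p, q) \<in> exponent_pairs \<gamma> r1 r2 s1 s2"
  then obtain f L \<eta> where f: "p = (\<lambda>x. ereal (f x))" "log_Holder L f" "0 < \<eta>" "\<And>x. 1 \<le> f x"
      "\<And>x. S + \<eta> \<le> 1 / f x" "\<And>x. 1 / f x \<le> I - \<eta>"
    unfolding exponent_pairs_def by (auto simp: exponent_class_iff[OF r1] I S)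
  obtain g where g: "q = (\<lambda>x. ereal (g x))" "\<And>x. 1 \<le> g x"
    using pq unfolding exponent_pairs_def by (auto simp: exponent_class_iff[OF r2])
  have pq\<gamma>: "1 / f x - 1 / g x = \<gamma>" for x
  proof -
    have "1 / p x - 1 / q x = ereal \<gamma>"
      using pq by (simp add: exponent_pairs_def)
    moreover have "f x \<noteq> 0" "g x \<noteq> 0"
      using f(4)[of x] g(2)[of x] by auto
    ultimately show ?thesis
      by (simp add: f(1) g(1) one_ereal_def)
  qed
  have "g x = 1 / (1 / f x - \<gamma>)" for x
    using pq\<gamma>[of x] by (simp add: algebra_simps)
  moreover have "f x = 1 / (1 / f x)" for x
    by simp
  moreover have "admissible (\<lambda>x. 1 / f x)"
    unfolding admissible_def using log_Holder_inverse[OF f(2,4)] f(3,5,6) by auto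
  ultimately show "\<exists>a. admissible a \<and> p = (\<lambda>x. ereal (1 / a x)) \<and> q = (\<lambda>x. ereal (1 / (a x - \<gamma>)))"
    using f(1) g(1) by (intro exI[of _ "\<lambda>x. 1 / f x"]) simp
next
  assume "\<exists>a. admissible a \<and> p = (\<lambda>x. ereal (1 / a x)) \<and> q = (\<lambda>x. ereal (1 / (a x - \<gamma>)))"
  then obtain a L \<eta> where a: "p = (\<lambda>x. ereal (1 / a x))" "q = (\<lambda>x. ereal (1 / (a x - \<gamma>)))"
      "log_Holder L a" "0 < \<eta>" "\<And>x. S + \<eta> \<le> a x" "\<And>x. a x \<le> I - \<eta>"
    unfolding admissible_def by blast
  have "p \<in> exponent_class r1 s1"
    unfolding a(1) by (rule admissible_in_exponent_class[OF r1 I(1) S(1) SI(1,4) a(3-6)])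
  moreover have "q \<in> exponent_class r2 s2"
    unfolding a(2)
  proof (rule admissible_in_exponent_class[OF r2 I(2) S(2) SI(2) _ _ a(4)])
    show "I - \<gamma> \<le> 1"
      using SI by simp
    have "log_Holder (1 * L + 0 * L) (\<lambda>x. a x - \<gamma>)"
      by (rule log_Holder_transport[OF a(3,3)]) auto
    then show "log_Holder L (\<lambda>x. a x - \<gamma>)"
      by simp
    show "S - \<gamma> + \<eta> \<le> a x - \<gamma>" "a x - \<gamma> \<le> I - \<gamma> - \<eta>" for x
      using a(5,6)[of x] by auto
  qed
  moreover have "1 / p x - 1 / q x = ereal \<gamma>" for x
  proof -
    have "0 < a x" "0 < a x - \<gamma>"
      using a(4) a(5)[of x] SI by linarith+
    then show ?thesis
      by (simp add: a(1,2) one_ereal_def)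
  qed
  ultimately show "(p, q) \<in> exponent_pairs \<gamma> r1 r2 s1 s2"
    by (simp add: exponent_pairs_def I S)
qed

lemma weight_const_admissible:
  fixes a :: "'a::euclidean_space \<Rightarrow> real"
  assumes "admissible a"
  shows "weight_const (\<lambda>x. ereal (1 / a x)) (\<lambda>x. ereal (1 / (a x - \<gamma>))) r1 r2 s1 s2 w =
    (SUP Q\<in>cubes. ennreal (measure lebesgue Q powr (- (I - S)))
      * var_norm (\<lambda>x. ereal (1 / (a x - S))) (\<lambda>x. w x * indicator Q x)
      * var_norm (\<lambda>x. ereal (1 / (I - a x))) (\<lambda>x. inverse (w x) * indicator Q x))"
proof -
  obtain \<eta> where \<eta>: "0 < \<eta>" "\<And>x. S + \<eta> \<le> a x" "\<And>x. a x \<le> I - \<eta>"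
    using assms unfolding admissible_def by blast
  have pos: "0 < a x" "0 < a x - \<gamma>" "0 < a x - S" "0 < I - a x" for x
    using \<eta>(1) \<eta>(2,3)[of x] SI by linarith+
  have rec: "1 / ereal t = ereal (1 / t)" if "t \<noteq> 0" for t
    using that by (simp add: one_ereal_def)
  have "1 / (1 / ereal (1 / (a x - \<gamma>)) - 1 / s2) = ereal (1 / (a x - S))"
    "1 / (1 / r1 - 1 / ereal (1 / a x)) = ereal (1 / (I - a x))" for x
    using pos[of x] by (simp_all add: S I rec)
  moreover have "real_of_ereal (1 / r1 - 1 / s1) = I - S"
    by (simp add: I S)
  ultimately show ?thesis
    unfolding weight_const_def by simp
qed

lemma weight_norms_exist:
  fixes a :: "'a::euclidean_space \<Rightarrow> real"
  assumes a: "admissible a"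
    and w: "w \<in> weight_class (\<lambda>x. ereal (1 / a x)) (\<lambda>x. ereal (1 / (a x - \<gamma>))) r1 r2 s1 s2"
  obtains w' lam sig C where "weight_norms (\<lambda>x. a x - S) (\<lambda>x. I - a x) (I - S) w' lam sig C"
    "AE x in lebesgue. w x = w' x"
proof -
  obtain L \<eta> where \<eta>: "log_Holder L a" "0 < \<eta>" "\<And>x. S + \<eta> \<le> a x" "\<And>x. a x \<le> I - \<eta>"
    using a unfolding admissible_def by blast
  have [measurable]: "a \<in> borel_measurable lebesgue"
    using borel_measurable_continuous_onI[OF log_Holder_continuous[OF \<eta>(1)]]
    by (intro measurable_completion) simp
  have wm [measurable]: "w \<in> borel_measurable lebesgue" and wpos: "AE x in lebesgue. 0 < w x"
    and const: "weight_const (\<lambda>x. ereal (1 / a x)) (\<lambda>x. ereal (1 / (a x - \<gamma>))) r1 r2 s1 s2 w < \<infinity>"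
    using w by (auto simp: weight_class_def weight_def)
  \<comment> \<open>A representative that is positive everywhere; the norms do not see the null set
    on which it differs from \<open>w\<close>.\<close>
  define w' where "w' x = (if 0 < w x then w x else 1)" for x
  have w'[measurable]: "w' \<in> borel_measurable lebesgue" "(\<lambda>x. inverse (w' x)) \<in> borel_measurable lebesgue"
    unfolding w'_def by measurable
  have w'pos: "0 < w' x" "0 < inverse (w' x)" for x
    by (auto simp: w'_def)
  have ae: "AE x in lebesgue. w x = w' x"
    using wpos by eventually_elim (simp add: w'_def)
  define N\<^sub>1 N\<^sub>2 where "N\<^sub>1 Q = var_norm (\<lambda>x. ereal (1 / (a x - S))) (\<lambda>x. w' x * indicator Q x)"
    and "N\<^sub>2 Q = var_norm (\<lambda>x. ereal (1 / (I - a x))) (\<lambda>x. inverse (w' x) * indicator Q x)" for Q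
  have N: "N\<^sub>1 Q = var_norm (\<lambda>x. ereal (1 / (a x - S))) (\<lambda>x. w x * indicator Q x)"
    "N\<^sub>2 Q = var_norm (\<lambda>x. ereal (1 / (I - a x))) (\<lambda>x. inverse (w x) * indicator Q x)" for Q
    unfolding N\<^sub>1_def N\<^sub>2_def
    by (intro var_norm_AE_cong; use ae in eventually_elim, simp)+
  define K where "K = (SUP Q\<in>cubes. ennreal (measure lebesgue Q powr (- (I - S))) * N\<^sub>1 Q * N\<^sub>2 Q)"
  have K: "K < \<infinity>"
    using const unfolding weight_const_admissible[OF a] K_def N .
  have exps: "1 \<le> 1 / (a x - S)" "1 / (a x - S) \<le> 1 / \<eta>" "1 \<le> 1 / (I - a x)" "1 / (I - a x) \<le> 1 / \<eta>" for x
    using \<eta>(2) \<eta>(3,4)[of x] SI by (auto simp: le_divide_eq intro!: divide_left_mono)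
  have norms: "\<exists>n. 0 < n \<and> N\<^sub>1 Q = ennreal n \<and>
      exponent_integral (\<lambda>x. a x - S) w' n Q = 1"
    "\<exists>n. 0 < n \<and> N\<^sub>2 Q = ennreal n \<and>
      exponent_integral (\<lambda>x. I - a x) (\<lambda>x. inverse (w' x)) n Q = 1"
    if Q: "Q \<in> cubes" for Q
  proof -
    have Qs: "Q \<in> sets lebesgue" "emeasure lebesgue Q \<noteq> 0"
      using cubes_sets[OF Q] emeasure_cubes[OF Q] measure_cubes_pos[OF Q] by (simp_all only: ennreal_eq_0_iff not_le)
    have m: "(\<lambda>x. 1 / (a x - S)) \<in> borel_measurable lebesgue" "(\<lambda>x. 1 / (I - a x)) \<in> borel_measurable lebesgue"
      by measurable
    have "ennreal (measure lebesgue Q powr (- (I - S))) * N\<^sub>1 Q * N\<^sub>2 Q \<le> K"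
      unfolding K_def using Q by (rule SUP_upper)
    then have fin: "ennreal (measure lebesgue Q powr (- (I - S))) * N\<^sub>1 Q * N\<^sub>2 Q < \<infinity>"
      using K by (rule le_less_trans)
    have attained: "\<exists>n. 0 < n \<and> N\<^sub>1 Q = ennreal n \<and>
        exponent_integral (\<lambda>x. a x - S) w' n Q = 1"
      if "N\<^sub>1 Q < \<infinity>"
      by (rule var_norm_attained[OF w'(1) m(1) Qs w'pos(1) exps(1,2) that[unfolded N\<^sub>1_def]])
        (auto simp: N\<^sub>1_def)
    have attained': "\<exists>n. 0 < n \<and> N\<^sub>2 Q = ennreal n \<and>
        exponent_integral (\<lambda>x. I - a x) (\<lambda>x. inverse (w' x)) n Q = 1"
      if "N\<^sub>2 Q < \<infinity>"
      by (rule var_norm_attained[OF w'(2) m(2) Qs w'pos(2) exps(3,4) that[unfolded N\<^sub>2_def]])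
        (auto simp: N\<^sub>2_def)
    \<comment> \<open>Since \<open>0 * \<infinity> = 0\<close>, a finite product alone does not
      bound its factors. A vanishing norm is excluded because it would be finite, hence attained at
      a positive number.\<close>
    have n0: "N\<^sub>1 Q \<noteq> 0"
    proof
      assume "N\<^sub>1 Q = 0"
      then show False
        using attained by auto
    qed
    have n0': "N\<^sub>2 Q \<noteq> 0"
    proof
      assume "N\<^sub>2 Q = 0"
      then show False
        using attained' by auto
    qed
    have "ennreal (measure lebesgue Q powr (- (I - S))) \<noteq> 0"
      using measure_cubes_pos[OF Q] by simp
    moreover have "ennreal (measure lebesgue Q powr (- (I - S))) * N\<^sub>1 Q * N\<^sub>2 Q \<noteq> top"
      using fin by (simp only: less_top infinity_ennreal_def)
    ultimately have "N\<^sub>1 Q \<noteq> top" "N\<^sub>2 Q \<noteq> top"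
      using n0 n0' unfolding ennreal_mult_eq_top_iff mult_eq_0_iff by blast+
    then have fin': "N\<^sub>1 Q < \<infinity>" "N\<^sub>2 Q < \<infinity>"
      by (simp_all only: less_top infinity_ennreal_def)
    show "\<exists>n. 0 < n \<and> N\<^sub>1 Q = ennreal n \<and>
      exponent_integral (\<lambda>x. a x - S) w' n Q = 1"
      "\<exists>n. 0 < n \<and> N\<^sub>2 Q = ennreal n \<and>
      exponent_integral (\<lambda>x. I - a x) (\<lambda>x. inverse (w' x)) n Q = 1"
      using attained[OF fin'(1)] attained'[OF fin'(2)] .
  qed
  define lam where "lam Q = (SOME n. 0 < n \<and> N\<^sub>1 Q = ennreal n \<and>
      exponent_integral (\<lambda>x. a x - S) w' n Q = 1)" for Q
  define sig where "sig Q = (SOME n. 0 < n \<and> N\<^sub>2 Q = ennreal n \<and>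
      exponent_integral (\<lambda>x. I - a x) (\<lambda>x. inverse (w' x)) n Q = 1)" for Q
  have lam: "0 < lam Q \<and> N\<^sub>1 Q = ennreal (lam Q) \<and>
      exponent_integral (\<lambda>x. a x - S) w' (lam Q) Q = 1"
    if "Q \<in> cubes" for Q
    unfolding lam_def by (rule someI_ex[OF norms(1)[OF that]])
  have sig: "0 < sig Q \<and> N\<^sub>2 Q = ennreal (sig Q) \<and>
      exponent_integral (\<lambda>x. I - a x) (\<lambda>x. inverse (w' x)) (sig Q) Q = 1"
    if "Q \<in> cubes" for Q
    unfolding sig_def by (rule someI_ex[OF norms(2)[OF that]])
  obtain k where k: "0 \<le> k" "K = ennreal k"
    using K by (cases K) auto
  have "lam Q * sig Q \<le> max 1 k * measure lebesgue Q powr (I - S)" if Q: "Q \<in> cubes" for Q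
  proof -
    have "ennreal (measure lebesgue Q powr (- (I - S))) * N\<^sub>1 Q * N\<^sub>2 Q \<le> K"
      unfolding K_def using Q by (rule SUP_upper)
    then have "ennreal (measure lebesgue Q powr (- (I - S)) * lam Q * sig Q) \<le> ennreal k"
      using lam[OF Q] sig[OF Q] k by (simp add: ennreal_mult)
    then have "measure lebesgue Q powr (- (I - S)) * lam Q * sig Q \<le> k"
      using k by simp
    then have "lam Q * sig Q \<le> k * measure lebesgue Q powr (I - S)"
      using measure_cubes_pos[OF Q] by (simp only: powr_minus) (simp add: field_simps)
    also have "\<dots> \<le> max 1 k * measure lebesgue Q powr (I - S)"
      by (intro mult_right_mono) auto
    finally show ?thesis .
  qed
  then have "weight_norms (\<lambda>x. a x - S) (\<lambda>x. I - a x) (I - S) w' lam sig (max 1 k)"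
    unfolding weight_norms_def using lam sig w'pos w' by auto
  then show thesis
    using that ae by blast
qed

end

section \<open>Algebra of the interpolated exponents and weights\<close>

text \<open>As no range is prescribed for \<open>z\<close>, degenerate solutions must be excluded:
  \<open>z = 0\<close> makes the right side infinite, and an infinite \<open>z\<close> leaves only
  \<open>\<theta> * a\<^sub>1\<close>, which is less than \<open>a\<close>.\<close>

lemma ereal_interpolation_iff:
  fixes a a\<^sub>1 \<theta> :: real
  assumes a: "0 < a" "0 < a\<^sub>1" and \<theta>: "0 < \<theta>" "\<theta> < 1" and pos: "0 < (a - \<theta> * a\<^sub>1) / (1 - \<theta>)"
  shows "1 / ereal (1 / a) = ereal (1 - \<theta>) / z + ereal \<theta> / ereal (1 / a\<^sub>1)
    \<longleftrightarrow> z = ereal (1 / ((a - \<theta> * a\<^sub>1) / (1 - \<theta>)))"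
proof -
  have pos': "0 < a - \<theta> * a\<^sub>1"
    using pos \<theta> by (simp add: zero_less_divide_iff)
  have "1 / ereal (1 / a) = ereal a" "ereal \<theta> / ereal (1 / a\<^sub>1) = ereal (\<theta> * a\<^sub>1)"
    using a by (simp_all add: one_ereal_def)
  then have "1 / ereal (1 / a) = ereal (1 - \<theta>) / z + ereal \<theta> / ereal (1 / a\<^sub>1)
      \<longleftrightarrow> ereal a = ereal (1 - \<theta>) / z + ereal (\<theta> * a\<^sub>1)"
    by (simp only:)
  also have "\<dots> \<longleftrightarrow> z = ereal (1 / ((a - \<theta> * a\<^sub>1) / (1 - \<theta>)))"
  proof (cases z)
    case (real r)
    show ?thesis
    proof (cases "r = 0")
      case True
      then show ?thesis
        using real pos' \<theta> by (simp add: divide_ereal_def)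
    next
      case False
      then have "a = (1 - \<theta>) / r + \<theta> * a\<^sub>1 \<longleftrightarrow> r = (1 - \<theta>) / (a - \<theta> * a\<^sub>1)"
        using pos' \<theta> by (auto simp: field_simps)
      then show ?thesis
        using real False by simp
    qed
  qed (use pos' in auto)
  finally show ?thesis .
qed

text \<open>With \<open>u = 1 / (1 - \<theta>)\<close> and
  \<open>v = \<theta> / (1 - \<theta>)\<close> the powers of \<open>m\<close> cancel because
  \<open>u = 1 + v\<close>. This makes the weight constant independent of the cube.\<close>

lemma powr_weight_product_le:
  fixes m C C\<^sub>1 \<delta> \<theta> :: real
  assumes "0 < m" "0 < l" "0 < s" "0 < l\<^sub>1" "0 < s\<^sub>1" and \<theta>: "0 < \<theta>" "\<theta> < 1"
    and le: "l * s \<le> C * m powr \<delta>" "l\<^sub>1 * s\<^sub>1 \<le> C\<^sub>1 * m powr \<delta>" and C: "0 \<le> C" "0 \<le> C\<^sub>1"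
  shows "m powr (- \<delta>)
      * (l powr (1 / (1 - \<theta>)) * s\<^sub>1 powr (\<theta> / (1 - \<theta>)) * m powr (- (\<theta> * \<delta> / (1 - \<theta>))))
      * (s powr (1 / (1 - \<theta>)) * l\<^sub>1 powr (\<theta> / (1 - \<theta>)) * m powr (- (\<theta> * \<delta> / (1 - \<theta>))))
    \<le> C powr (1 / (1 - \<theta>)) * C\<^sub>1 powr (\<theta> / (1 - \<theta>))"
proof -
  define u v where "u = 1 / (1 - \<theta>)" and "v = \<theta> / (1 - \<theta>)"
  have uv: "0 \<le> u" "0 \<le> v" "u = 1 + v" "\<theta> * \<delta> / (1 - \<theta>) = v * \<delta>"
    using \<theta> by (auto simp: u_def v_def field_simps)
  have "m powr (- \<delta>) * (l powr u * s\<^sub>1 powr v * m powr (- (v * \<delta>))) * (s powr u * l\<^sub>1 powr v * m powr (- (v * \<delta>)))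
      = (l * s) powr u * (l\<^sub>1 * s\<^sub>1) powr v * (m powr (- \<delta>) * m powr (- (v * \<delta>)) * m powr (- (v * \<delta>)))"
    by (simp add: powr_mult mult_ac)
  also have "\<dots> \<le> (C * m powr \<delta>) powr u * (C\<^sub>1 * m powr \<delta>) powr v
      * (m powr (- \<delta>) * m powr (- (v * \<delta>)) * m powr (- (v * \<delta>)))"
  proof -
    have "(l * s) powr u \<le> (C * m powr \<delta>) powr u" "(l\<^sub>1 * s\<^sub>1) powr v \<le> (C\<^sub>1 * m powr \<delta>) powr v"
      using assms uv by (auto intro: powr_mono2)
    then show ?thesis
      by (intro mult_right_mono[OF mult_mono]) auto
  qed
  also have "\<dots> = C powr u * C\<^sub>1 powr v * (m powr (\<delta> * u) * m powr (\<delta> * v)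
      * (m powr (- \<delta>) * m powr (- (v * \<delta>)) * m powr (- (v * \<delta>))))"
    by (simp add: powr_mult powr_powr mult_ac)
  also have "m powr (\<delta> * u) * m powr (\<delta> * v) * (m powr (- \<delta>) * m powr (- (v * \<delta>)) * m powr (- (v * \<delta>)))
      = m powr (\<delta> * u + \<delta> * v + (- \<delta> + - (v * \<delta>) + - (v * \<delta>)))"
    by (simp only: powr_add)
  also have "\<delta> * u + \<delta> * v + (- \<delta> + - (v * \<delta>) + - (v * \<delta>)) = 0"
    unfolding uv(3) by (simp add: algebra_simps)
  finally show ?thesis
    using assms(1) by (simp only: uv(4) u_def[symmetric] v_def[symmetric]) simp
qed

context exponent_bounds begin

text \<open>The new value differs from \<open>a\<close> by
  \<open>\<theta> * (a - a\<^sub>1) / (1 - \<theta>)\<close>, so a small \<open>\<theta>\<close>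
  uses up at most half of the margin \<open>\<eta>\<close>.\<close>

lemma interpolated_bounds:
  assumes \<theta>: "0 < \<theta>" "\<theta> \<le> 1 / 2" "4 * \<theta> * (I - S) \<le> \<eta>"
    and a: "S + \<eta> \<le> a" "a \<le> I - \<eta>" and a\<^sub>1: "S \<le> a\<^sub>1" "a\<^sub>1 \<le> I" and \<eta>: "0 < \<eta>"
  shows "S + \<eta> / 2 \<le> (a - \<theta> * a\<^sub>1) / (1 - \<theta>)" "(a - \<theta> * a\<^sub>1) / (1 - \<theta>) \<le> I - \<eta> / 2"
proof -
  have "(a - \<theta> * a\<^sub>1) / (1 - \<theta>) - a = \<theta> * (a - a\<^sub>1) / (1 - \<theta>)"
    using \<theta> by (simp add: field_simps)
  also have "\<bar>\<dots>\<bar> = \<theta> * \<bar>a - a\<^sub>1\<bar> / (1 - \<theta>)"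
    using \<theta> by (simp add: abs_mult)
  also have "\<dots> \<le> \<theta> * (I - S) / (1 / 2)"
    using a a\<^sub>1 \<theta> \<eta> SI by (intro frac_le mult_left_mono) auto
  also have "\<dots> \<le> \<eta> / 2"
    using \<theta>(3) by simp
  finally have "\<bar>(a - \<theta> * a\<^sub>1) / (1 - \<theta>) - a\<bar> \<le> \<eta> / 2" .
  then show "S + \<eta> / 2 \<le> (a - \<theta> * a\<^sub>1) / (1 - \<theta>)" "(a - \<theta> * a\<^sub>1) / (1 - \<theta>) \<le> I - \<eta> / 2"
    using a by linarith+
qed

lemma log_Holder_interpolated:
  assumes "log_Holder L a" "log_Holder L\<^sub>1 a\<^sub>1" and \<theta>: "0 < \<theta>" "\<theta> < 1"
  shows "log_Holder (1 / (1 - \<theta>) * L + \<theta> / (1 - \<theta>) * L\<^sub>1) (\<lambda>x. (a x - \<theta> * a\<^sub>1 x) / (1 - \<theta>))"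
proof (rule log_Holder_transport[OF assms(1,2)])
  fix x y
  have "(a x - \<theta> * a\<^sub>1 x) / (1 - \<theta>) - (a y - \<theta> * a\<^sub>1 y) / (1 - \<theta>)
      = 1 / (1 - \<theta>) * (a x - a y) - \<theta> / (1 - \<theta>) * (a\<^sub>1 x - a\<^sub>1 y)"
    by (simp add: diff_divide_distrib algebra_simps)
  also have "\<bar>\<dots>\<bar> \<le> \<bar>1 / (1 - \<theta>) * (a x - a y)\<bar> + \<bar>\<theta> / (1 - \<theta>) * (a\<^sub>1 x - a\<^sub>1 y)\<bar>"
    by (rule abs_triangle_ineq4)
  also have "\<dots> = 1 / (1 - \<theta>) * \<bar>a x - a y\<bar> + \<theta> / (1 - \<theta>) * \<bar>a\<^sub>1 x - a\<^sub>1 y\<bar>"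
    using \<theta> by (simp add: abs_mult)
  finally show "\<bar>(a x - \<theta> * a\<^sub>1 x) / (1 - \<theta>) - (a y - \<theta> * a\<^sub>1 y) / (1 - \<theta>)\<bar>
      \<le> 1 / (1 - \<theta>) * \<bar>a x - a y\<bar> + \<theta> / (1 - \<theta>) * \<bar>a\<^sub>1 x - a\<^sub>1 y\<bar>" .
qed (use \<theta> in auto)

lemma interpolates_iff:
  fixes a a\<^sub>1 :: "'a::euclidean_space \<Rightarrow> real" and \<theta> :: real
  defines "a\<^sub>0 \<equiv> \<lambda>x. (a x - \<theta> * a\<^sub>1 x) / (1 - \<theta>)"
  assumes \<theta>: "0 < \<theta>" "\<theta> < 1"
    and pos: "\<And>x. \<gamma> < a x" "\<And>x. \<gamma> < a\<^sub>1 x" "\<And>x. \<gamma> < a\<^sub>0 x"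
  shows "interpolates \<theta> p0 q0 w0 (\<lambda>x. ereal (1 / a\<^sub>1 x)) (\<lambda>x. ereal (1 / (a\<^sub>1 x - \<gamma>))) w1
      (\<lambda>x. ereal (1 / a x)) (\<lambda>x. ereal (1 / (a x - \<gamma>))) w \<longleftrightarrow>
    p0 = (\<lambda>x. ereal (1 / a\<^sub>0 x)) \<and> q0 = (\<lambda>x. ereal (1 / (a\<^sub>0 x - \<gamma>))) \<and>
    weight w0 \<and> (AE x in lebesgue. w x = w0 x powr (1 - \<theta>) * w1 x powr \<theta>)"
proof -
  have "1 / ereal (1 / a x) = ereal (1 - \<theta>) / p0 x + ereal \<theta> / ereal (1 / a\<^sub>1 x)
      \<longleftrightarrow> p0 x = ereal (1 / a\<^sub>0 x)" for x
    unfolding a\<^sub>0_def using pos[of x] SI(5) \<theta> by (intro ereal_interpolation_iff) (auto simp: a\<^sub>0_def)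
  moreover have "1 / ereal (1 / (a x - \<gamma>)) = ereal (1 - \<theta>) / q0 x + ereal \<theta> / ereal (1 / (a\<^sub>1 x - \<gamma>))
      \<longleftrightarrow> q0 x = ereal (1 / (a\<^sub>0 x - \<gamma>))" for x
  proof -
    \<comment> \<open>The coefficients \<open>1 / (1 - \<theta>)\<close> and
      \<open>- \<theta> / (1 - \<theta>)\<close> sum to 1, so the shift by \<open>\<gamma>\<close>
      is preserved and \<open>q0\<close> has the same parameter function as
      \<open>p0\<close>.\<close>
    have eq: "(a x - \<gamma> - \<theta> * (a\<^sub>1 x - \<gamma>)) / (1 - \<theta>) = a\<^sub>0 x - \<gamma>"
      using \<theta> by (simp add: a\<^sub>0_def field_simps)
    show ?thesis
      using pos[of x] \<theta> by (subst ereal_interpolation_iff) (auto simp: eq)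
  qed
  ultimately show ?thesis
    unfolding interpolates_def fun_eq_iff by simp
qed

text \<open>Both norms come from \<open>var_norm_interpolated_weight\<close>, the second for the
  inverse weights with the roles of \<open>a - S\<close> and \<open>I - a\<close> exchanged. The
  resulting constant is uniform in the cube by \<open>powr_weight_product_le\<close>.\<close>

lemma interpolated_weight_class:
  fixes a a\<^sub>1 :: "'a::euclidean_space \<Rightarrow> real" and \<theta> :: real
  defines "a\<^sub>0 \<equiv> \<lambda>x. (a x - \<theta> * a\<^sub>1 x) / (1 - \<theta>)"
  assumes w: "weight_norms (\<lambda>x. a x - S) (\<lambda>x. I - a x) (I - S) w' lam sig C"
    and w1: "weight_norms (\<lambda>x. a\<^sub>1 x - S) (\<lambda>x. I - a\<^sub>1 x) (I - S) w1' lam\<^sub>1 sig\<^sub>1 C\<^sub>1"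
    and meas: "a \<in> borel_measurable lebesgue" "a\<^sub>1 \<in> borel_measurable lebesgue"
    and \<eta>: "0 < \<eta>" "\<And>x. S + \<eta> \<le> a x" "\<And>x. a x \<le> I - \<eta>" and a\<^sub>1: "\<And>x. S < a\<^sub>1 x" "\<And>x. a\<^sub>1 x < I"
    and \<theta>: "0 < \<theta>" "\<theta> < 1" "\<theta> * (I - S) \<le> \<eta> / 2"
      "2 * \<theta> * (I - S) / \<eta> \<le> \<epsilon>" "2 * \<theta> * (I - S) / \<eta> \<le> \<epsilon>'"
    and RH: "0 \<le> B" "\<And>Q. Q \<in> cubes \<Longrightarrow>
      higher_integral \<epsilon> (\<lambda>x. a x - S) w' (lam Q) Q \<le> ennreal B"
    and RH': "0 \<le> B'" "\<And>Q. Q \<in> cubes \<Longrightarrow>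
      higher_integral \<epsilon>' (\<lambda>x. I - a x) (\<lambda>x. inverse (w' x)) (sig Q) Q \<le> ennreal B'"
    and adm: "admissible a\<^sub>0"
    and w0: "weight w0" "AE x in lebesgue. w' x = w0 x powr (1 - \<theta>) * w1' x powr \<theta>"
  shows "w0 \<in> weight_class (\<lambda>x. ereal (1 / a\<^sub>0 x)) (\<lambda>x. ereal (1 / (a\<^sub>0 x - \<gamma>))) r1 r2 s1 s2"
proof -
  note meas[measurable]
  have \<delta>: "0 < I - S"
    using SI by simp
  have w'pos: "0 < w' x" "0 < w1' x" for x
    using w w1 by (auto simp: weight_norms_def)
  have w0pos: "AE x in lebesgue. 0 < w0 x"
    using w0(1) by (simp add: weight_def)
  have w0_eq: "AE x in lebesgue. w0 x = w' x powr (1 / (1 - \<theta>)) * inverse (w1' x) powr (\<theta> / (1 - \<theta>))"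
    using w0(2) w0pos
  proof eventually_elim
    case (elim x)
    have "w' x powr (1 / (1 - \<theta>)) = w0 x * w1' x powr (\<theta> / (1 - \<theta>))"
      unfolding elim(1) using elim(2) \<theta> by (simp add: powr_mult powr_powr)
    moreover have "w1' x powr (\<theta> / (1 - \<theta>)) * inverse (w1' x) powr (\<theta> / (1 - \<theta>)) = 1"
      using w'pos(2)[of x] by (simp flip: powr_mult)
    ultimately show ?case
      by (simp add: mult.assoc)
  qed
  then have inv_eq: "AE x in lebesgue. inverse (w0 x) =
      inverse (w' x) powr (1 / (1 - \<theta>)) * inverse (inverse (w1' x)) powr (\<theta> / (1 - \<theta>))"
  proof eventually_elim
    case (elim x)
    show ?case
      unfolding elim using w'pos[of x] by (simp add: inverse_powr)
  qed
  have a\<^sub>0_bounds: "S \<le> a\<^sub>0 x" "a\<^sub>0 x \<le> I" for x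
    using adm unfolding admissible_def by (metis add_le_same_cancel1 diff_le_self less_eq_real_def
        add_increasing2 order_trans le_add_same_cancel1 diff_ge_0_iff_ge diff_add_cancel)+
  define K where "K = (B + 2) * (B' + 2) * (C powr (1 / (1 - \<theta>)) * C\<^sub>1 powr (\<theta> / (1 - \<theta>)))"
  have "weight_const (\<lambda>x. ereal (1 / a\<^sub>0 x)) (\<lambda>x. ereal (1 / (a\<^sub>0 x - \<gamma>))) r1 r2 s1 s2 w0 \<le> ennreal K"
    unfolding weight_const_admissible[OF adm]
  proof (rule SUP_least)
    fix Q :: "'a set" assume Q: "Q \<in> cubes"
    define m where "m = measure lebesgue Q"
    define X where "X = lam Q powr (1 / (1 - \<theta>)) * sig\<^sub>1 Q powr (\<theta> / (1 - \<theta>)) * m powr (- (\<theta> * (I - S) / (1 - \<theta>)))"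
    define Y where "Y = sig Q powr (1 / (1 - \<theta>)) * lam\<^sub>1 Q powr (\<theta> / (1 - \<theta>)) * m powr (- (\<theta> * (I - S) / (1 - \<theta>)))"
    have nonneg: "0 \<le> X" "0 \<le> Y"
      by (simp_all add: X_def Y_def)
    have 1: "var_norm (\<lambda>x. ereal (1 / (a\<^sub>0 x - S))) (\<lambda>x. w0 x * indicator Q x) \<le> ennreal ((B + 2) * X)"
      unfolding X_def m_def
    proof (rule var_norm_interpolated_weight[OF w w1])
      fix x
      show "\<eta> \<le> a x - S" "0 < I - a\<^sub>1 x"
        using \<eta>(2)[of x] a\<^sub>1(2)[of x] by simp_all
      show "a\<^sub>0 x - S = (a x - S - \<theta> * (I - S) + \<theta> * (I - a\<^sub>1 x)) / (1 - \<theta>)"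
        using \<theta> by (simp add: a\<^sub>0_def field_simps)
      show "a\<^sub>0 x - S \<le> 1"
        using a\<^sub>0_bounds[of x] SI by simp
    qed (use \<eta>(1) \<delta> \<theta> Q RH w0_eq in auto)
    have 2: "var_norm (\<lambda>x. ereal (1 / (I - a\<^sub>0 x))) (\<lambda>x. inverse (w0 x) * indicator Q x) \<le> ennreal ((B' + 2) * Y)"
      unfolding Y_def m_def
    proof (rule var_norm_interpolated_weight[OF weight_norms_swap[OF w] weight_norms_swap[OF w1],
          where \<epsilon> = \<epsilon>'])
      fix x
      show "\<eta> \<le> I - a x" "0 < a\<^sub>1 x - S"
        using \<eta>(3)[of x] a\<^sub>1(1)[of x] by simp_all
      show "I - a\<^sub>0 x = (I - a x - \<theta> * (I - S) + \<theta> * (a\<^sub>1 x - S)) / (1 - \<theta>)"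
        using \<theta> by (simp add: a\<^sub>0_def field_simps)
      show "I - a\<^sub>0 x \<le> 1"
        using a\<^sub>0_bounds[of x] SI by simp
      show "AE x in lebesgue. inverse (w0 x) =
          inverse (w' x) powr (1 / (1 - \<theta>)) * inverse (inverse (w1' x)) powr (\<theta> / (1 - \<theta>))"
        by (rule inv_eq)
    qed (use \<eta>(1) \<delta> \<theta> Q RH' in auto)
    have facts: "0 < m" "0 < lam Q" "0 < sig Q" "0 < lam\<^sub>1 Q" "0 < sig\<^sub>1 Q"
      "lam Q * sig Q \<le> C * m powr (I - S)" "lam\<^sub>1 Q * sig\<^sub>1 Q \<le> C\<^sub>1 * m powr (I - S)" "0 \<le> C" "0 \<le> C\<^sub>1"
      using w w1 Q measure_cubes_pos[OF Q] by (auto simp: weight_norms_def m_def)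
    have prod: "m powr (- (I - S)) * X * Y \<le> C powr (1 / (1 - \<theta>)) * C\<^sub>1 powr (\<theta> / (1 - \<theta>))"
      unfolding X_def Y_def by (rule powr_weight_product_le) (use facts \<theta> in auto)
    have "ennreal (m powr (- (I - S)))
      * var_norm (\<lambda>x. ereal (1 / (a\<^sub>0 x - S))) (\<lambda>x. w0 x * indicator Q x)
      * var_norm (\<lambda>x. ereal (1 / (I - a\<^sub>0 x))) (\<lambda>x. inverse (w0 x) * indicator Q x)
      \<le> ennreal (m powr (- (I - S))) * ennreal ((B + 2) * X) * ennreal ((B' + 2) * Y)"
      using 1 2 by (intro mult_mono) auto
    also have "\<dots> = ennreal ((B + 2) * (B' + 2) * (m powr (- (I - S)) * X * Y))"
      using RH(1) RH'(1) nonneg by (simp add: mult_ac flip: ennreal_mult)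
    also have "\<dots> \<le> ennreal K"
      unfolding K_def using prod RH(1) RH'(1) by (intro ennreal_leI mult_left_mono) auto
    finally show "ennreal (measure lebesgue Q powr (- (I - S)))
      * var_norm (\<lambda>x. ereal (1 / (a\<^sub>0 x - S))) (\<lambda>x. w0 x * indicator Q x)
      * var_norm (\<lambda>x. ereal (1 / (I - a\<^sub>0 x))) (\<lambda>x. inverse (w0 x) * indicator Q x) \<le> ennreal K"
      by (simp only: m_def)
  qed
  also have "\<dots> < \<infinity>"
    by simp
  finally show ?thesis
    using w0(1) by (simp add: weight_class_def)
qed

theorem interpolation:
  fixes a a\<^sub>1 :: "'a::euclidean_space \<Rightarrow> real"
  assumes a: "admissible a" and a\<^sub>1: "admissible a\<^sub>1"
    and w: "w \<in> weight_class (\<lambda>x. ereal (1 / a x)) (\<lambda>x. ereal (1 / (a x - \<gamma>))) r1 r2 s1 s2"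
    and w1: "w1 \<in> weight_class (\<lambda>x. ereal (1 / a\<^sub>1 x)) (\<lambda>x. ereal (1 / (a\<^sub>1 x - \<gamma>))) r1 r2 s1 s2"
  defines "interp \<equiv> \<lambda>\<theta> p0 q0 w0. interpolates \<theta> p0 q0 w0
    (\<lambda>x. ereal (1 / a\<^sub>1 x)) (\<lambda>x. ereal (1 / (a\<^sub>1 x - \<gamma>))) w1
    (\<lambda>x. ereal (1 / a x)) (\<lambda>x. ereal (1 / (a x - \<gamma>))) w"
  shows "\<exists>\<eta>. 0 < \<eta> \<and> \<eta> < 1 \<and> (\<forall>\<theta>. 0 < \<theta> \<and> \<theta> < \<eta> \<longrightarrow>
    (\<exists>p0 q0 w0. interp \<theta> p0 q0 w0) \<and>
    (\<forall>p0 q0 w0. interp \<theta> p0 q0 w0 \<longrightarrow>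
      (p0, q0) \<in> exponent_pairs \<gamma> r1 r2 s1 s2 \<and> w0 \<in> weight_class p0 q0 r1 r2 s1 s2))"
proof -
  obtain L \<eta> where \<eta>: "log_Holder L a" "0 < \<eta>" "\<And>x. S + \<eta> \<le> a x" "\<And>x. a x \<le> I - \<eta>"
    using a unfolding admissible_def by blast
  obtain L\<^sub>1 \<eta>\<^sub>1 where \<eta>\<^sub>1: "log_Holder L\<^sub>1 a\<^sub>1" "0 < \<eta>\<^sub>1" "\<And>x. S + \<eta>\<^sub>1 \<le> a\<^sub>1 x" "\<And>x. a\<^sub>1 x \<le> I - \<eta>\<^sub>1"
    using a\<^sub>1 unfolding admissible_def by blast
  have a\<^sub>1_bounds: "S < a\<^sub>1 x" "a\<^sub>1 x < I" for x
    using \<eta>\<^sub>1(2) \<eta>\<^sub>1(3,4)[of x] by linarith+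
  have meas: "a \<in> borel_measurable lebesgue" "a\<^sub>1 \<in> borel_measurable lebesgue"
    using borel_measurable_continuous_onI[OF log_Holder_continuous[OF \<eta>(1)]]
      borel_measurable_continuous_onI[OF log_Holder_continuous[OF \<eta>\<^sub>1(1)]]
    by (auto intro: measurable_completion)
  obtain w' lam sig C where w': "weight_norms (\<lambda>x. a x - S) (\<lambda>x. I - a x) (I - S) w' lam sig C"
    "AE x in lebesgue. w x = w' x"
    by (rule weight_norms_exist[OF a w])
  obtain w1' lam\<^sub>1 sig\<^sub>1 C\<^sub>1 where w1': "weight_norms (\<lambda>x. a\<^sub>1 x - S) (\<lambda>x. I - a\<^sub>1 x) (I - S) w1' lam\<^sub>1 sig\<^sub>1 C\<^sub>1"
    "AE x in lebesgue. w1 x = w1' x"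
    by (rule weight_norms_exist[OF a\<^sub>1 w1])
  have pos': "0 < w' x" "0 < w1' x" for x
    using w'(1) w1'(1) by (auto simp: weight_norms_def)
  have LH1: "log_Holder (1 * L + 0 * L) (\<lambda>x. a x - S)" and LH2: "log_Holder (1 * L + 0 * L) (\<lambda>x. I - a x)"
    by (rule log_Holder_transport[OF \<eta>(1,1)]; simp)+
  obtain \<epsilon> B where RH: "0 < \<epsilon>" "0 \<le> B" "\<And>Q. Q \<in> cubes \<Longrightarrow>
      higher_integral \<epsilon> (\<lambda>x. a x - S) w' (lam Q) Q \<le> ennreal B"
    by (rule reverse_Holder_weight_norms[OF w'(1) \<eta>(2) _ _ _ LH1]) (use \<eta> in \<open>auto simp: algebra_simps\<close>)
  obtain \<epsilon>' B' where RH': "0 < \<epsilon>'" "0 \<le> B'" "\<And>Q. Q \<in> cubes \<Longrightarrow>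
      higher_integral \<epsilon>' (\<lambda>x. I - a x) (\<lambda>x. inverse (w' x)) (sig Q) Q \<le> ennreal B'"
    by (rule reverse_Holder_weight_norms[OF weight_norms_swap[OF w'(1)] \<eta>(2) _ _ _ LH2])
      (use \<eta> in \<open>auto simp: algebra_simps\<close>)
  define \<delta> where "\<delta> = I - S"
  have \<delta>: "0 < \<delta>"
    using SI by (simp add: \<delta>_def)
  \<comment> \<open>The entries \<open>1 / 2\<close> and \<open>\<eta> / (4 * \<delta>)\<close> keep
    the new exponents admissible by \<open>interpolated_bounds\<close>; the other two keep the
    increase of the exponents within the gains \<open>\<epsilon>\<close> and
    \<open>\<epsilon>'\<close> of the two reverse Hoelder inequalities.\<close>
  define T where "T = min (1 / 2) (min (\<eta> / (4 * \<delta>)) (min (\<epsilon> * \<eta> / (2 * \<delta>)) (\<epsilon>' * \<eta> / (2 * \<delta>))))"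
  show ?thesis
  proof (intro exI[of _ T] conjI allI impI)
    show "0 < T" "T < 1"
      using \<delta> \<eta>(2) RH(1) RH'(1) by (auto simp: T_def)
    fix \<theta> assume \<theta>T: "0 < \<theta> \<and> \<theta> < T"
    then have "\<theta> \<le> \<eta> / (4 * \<delta>)" "\<theta> \<le> \<epsilon> * \<eta> / (2 * \<delta>)" "\<theta> \<le> \<epsilon>' * \<eta> / (2 * \<delta>)"
      by (auto simp: T_def)
    then have \<theta>: "4 * \<theta> * \<delta> \<le> \<eta>" "2 * \<theta> * \<delta> / \<eta> \<le> \<epsilon>" "2 * \<theta> * \<delta> / \<eta> \<le> \<epsilon>'"
      using \<delta> \<eta>(2) by (simp_all add: field_simps)
    have \<theta>1: "0 < \<theta>" "\<theta> < 1" "\<theta> \<le> 1 / 2"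
      using \<theta>T by (auto simp: T_def)
    define a\<^sub>0 where "a\<^sub>0 = (\<lambda>x. (a x - \<theta> * a\<^sub>1 x) / (1 - \<theta>))"
    have a\<^sub>0: "S + \<eta> / 2 \<le> a\<^sub>0 x" "a\<^sub>0 x \<le> I - \<eta> / 2" for x
      unfolding a\<^sub>0_def
      using interpolated_bounds[OF \<theta>1(1,3) \<theta>(1)[unfolded \<delta>_def] \<eta>(3,4) less_imp_le less_imp_le \<eta>(2)] a\<^sub>1_bounds
      by blast+
    have adm: "admissible a\<^sub>0"
      unfolding admissible_def using log_Holder_interpolated[OF \<eta>(1) \<eta>\<^sub>1(1) \<theta>1(1,2)] a\<^sub>0 \<eta>(2)
      by (fold a\<^sub>0_def) (meson half_gt_zero)
    have \<gamma>: "\<gamma> < a x" "\<gamma> < a\<^sub>1 x" "\<gamma> < a\<^sub>0 x" for x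
      using \<eta>(2) \<eta>(3)[of x] a\<^sub>1_bounds[of x] a\<^sub>0[of x] SI by linarith+
    have interp_iff: "interp \<theta> p0 q0 w0 \<longleftrightarrow>
        p0 = (\<lambda>x. ereal (1 / a\<^sub>0 x)) \<and> q0 = (\<lambda>x. ereal (1 / (a\<^sub>0 x - \<gamma>))) \<and>
        weight w0 \<and> (AE x in lebesgue. w x = w0 x powr (1 - \<theta>) * w1 x powr \<theta>)" for p0 q0 w0
      unfolding interp_def a\<^sub>0_def
      by (rule interpolates_iff) (use \<theta>1 \<gamma> in \<open>auto simp: a\<^sub>0_def\<close>)
    \<comment> \<open>The solution for \<open>w_0\<close>, formed from the positive representatives
      and hence positive everywhere; it shows that the claim about all solutions is not
      vacuous.\<close>
    define v where "v x = w' x powr (1 / (1 - \<theta>)) * inverse (w1' x) powr (\<theta> / (1 - \<theta>))" for x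
    have "weight v"
      unfolding weight_def
    proof
      have [measurable]: "w' \<in> borel_measurable lebesgue" "w1' \<in> borel_measurable lebesgue"
        using w'(1) w1'(1) by (auto simp: weight_norms_def)
      show "v \<in> borel_measurable lebesgue"
        unfolding v_def by measurable
      have "0 < v x" for x
        unfolding v_def using pos'[of x] by (intro mult_pos_pos) auto
      then show "AE x in lebesgue. 0 < v x"
        by simp
    qed
    moreover have "AE x in lebesgue. w x = v x powr (1 - \<theta>) * w1 x powr \<theta>"
      using w'(2) w1'(2)
    proof eventually_elim
      case (elim x)
      have "v x powr (1 - \<theta>) = w' x * inverse (w1' x) powr \<theta>"
        using \<theta>1 pos'[of x] by (simp add: v_def powr_mult powr_powr)
      moreover have "inverse (w1' x) powr \<theta> * w1' x powr \<theta> = 1"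
        using pos'[of x] by (simp flip: powr_mult)
      ultimately show ?case
        using elim by (simp add: mult.assoc)
    qed
    ultimately show "\<exists>p0 q0 w0. interp \<theta> p0 q0 w0"
      using interp_iff by blast
    fix p0 q0 w0 assume "interp \<theta> p0 q0 w0"
    then have w0: "p0 = (\<lambda>x. ereal (1 / a\<^sub>0 x))" "q0 = (\<lambda>x. ereal (1 / (a\<^sub>0 x - \<gamma>)))"
      "weight w0" "AE x in lebesgue. w x = w0 x powr (1 - \<theta>) * w1 x powr \<theta>"
      using interp_iff by blast+
    show "(p0, q0) \<in> exponent_pairs \<gamma> r1 r2 s1 s2"
      unfolding exponent_pairs_iff using adm w0(1,2) by blast
    have "AE x in lebesgue. w' x = w0 x powr (1 - \<theta>) * w1' x powr \<theta>"
      using w'(2) w1'(2) w0(4) by eventually_elim simp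
    then show "w0 \<in> weight_class p0 q0 r1 r2 s1 s2"
      unfolding w0(1,2) a\<^sub>0_def
      using \<theta> \<theta>1 \<eta>(2) a\<^sub>1_bounds
      by (intro interpolated_weight_class[OF w'(1) w1'(1) meas \<eta>(2-4) _ _ _ _ _ _ _ RH(2,3) RH'(2,3)
            adm[unfolded a\<^sub>0_def] w0(3)]) (auto simp: \<delta>_def)
  qed
qed

end

theorem theorem1p8:
  fixes r1 r2 s1 s2 :: ereal and \<gamma> :: real
    and p q p1 q1 :: "'a::euclidean_space \<Rightarrow> ereal"
    and w w1 :: "'a \<Rightarrow> real"
  assumes "1 \<le> r1" "r1 < s1" "1 \<le> r2" "r2 < s2"
    and "0 \<le> \<gamma>" "\<gamma> < 1"
    and "(p1, q1) \<in> exponent_pairs \<gamma> r1 r2 s1 s2"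
    and "w1 \<in> weight_class p1 q1 r1 r2 s1 s2"
    and "(p, q) \<in> exponent_pairs \<gamma> r1 r2 s1 s2"
    and "w \<in> weight_class p q r1 r2 s1 s2"
  shows "\<exists>\<eta>. 0 < \<eta> \<and> \<eta> < 1 \<and>
    (\<forall>\<theta>. 0 < \<theta> \<and> \<theta> < \<eta> \<longrightarrow>
       (\<exists>p0 q0 w0. interpolates \<theta> p0 q0 w0 p1 q1 w1 p q w) \<and>
       (\<forall>p0 q0 w0. interpolates \<theta> p0 q0 w0 p1 q1 w1 p q w \<longrightarrow>
          (p0, q0) \<in> exponent_pairs \<gamma> r1 r2 s1 s2 \<and>
          w0 \<in> weight_class p0 q0 r1 r2 s1 s2))"
proof -
  have rec: "\<exists>t. 1 / r = ereal t \<and> 0 \<le> t \<and> t \<le> 1" if "1 \<le> r" for r :: ereal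
    using that by (cases r) (auto simp: one_ereal_def)
  have rec_less: "1 / s < 1 / r" if "1 \<le> r" "r < s" for r s :: ereal
    using that by (cases r; cases s) (auto simp: one_ereal_def frac_less2)
  have "1 \<le> s1" "1 \<le> s2"
    using assms(1-4) by (meson less_imp_le order_trans)+
  then obtain I I2 S S2 where t: "1 / r1 = ereal I" "1 / r2 = ereal I2" "1 / s1 = ereal S" "1 / s2 = ereal S2"
      "I \<le> 1" "0 \<le> S" "0 \<le> S2"
    using rec assms(1,3) by metis
  have "1 / r1 - 1 / r2 = ereal \<gamma>" "1 / s1 - 1 / s2 = ereal \<gamma>"
    using assms(9) by (simp_all add: exponent_pairs_def)
  then have "I2 = I - \<gamma>" "S2 = S - \<gamma>"
    by (simp_all add: t)
  then interpret exponent_bounds r1 r2 s1 s2 \<gamma> I S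
    using assms(1-5) t rec_less[OF assms(1,2)] by unfold_locales auto
  obtain a where a: "admissible a" "p = (\<lambda>x. ereal (1 / a x))" "q = (\<lambda>x. ereal (1 / (a x - \<gamma>)))"
    using assms(9) unfolding exponent_pairs_iff by blast
  obtain a\<^sub>1 where a\<^sub>1: "admissible a\<^sub>1" "p1 = (\<lambda>x. ereal (1 / a\<^sub>1 x))" "q1 = (\<lambda>x. ereal (1 / (a\<^sub>1 x - \<gamma>)))"
    using assms(7) unfolding exponent_pairs_iff by blast
  show ?thesis
    using interpolation[OF a(1) a\<^sub>1(1)] assms(8,10) unfolding a(2,3) a\<^sub>1(2,3) by blast
qed

end
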